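(* Let $L>0$, let $g:\mathbb{R}\to\mathbb{R}$ be continuous and nondecreasing with $g(0)=0$, and let $F:\mathbb{R}\to\mathbb{R}$ be globally Lipschitz continuous with $F(0)=0$. Suppose that $F$ is nonincreasing and that there are positive constants $\alpha_1\le\alpha_2$ and a nonnegative constant $S$ such that $$\alpha_1|s|\le |g(s)|\le \alpha_2|s|\quad\text{for all } s\in\mathbb{R}\text{ with }|s|\ge S. \qquad (\ast)$$ Then there exist $E_S\ge 0$, $M>0$ and $\mu>0$ such that, for every weak solution $\mathbf{u}$ of the system (P) and for all $t\ge 0$, $$\{\mathcal{E}^{\mathbf{u}}(t)-E_S\}^+\le M\exp(-\mu t)\,\{\mathcal{E}^{\mathbf{u}}(0)-E_S\}^+ .$$ Furthermore, if $(\ast)$ holds with $S=0$, then this estimate holds with $E_S=0$, i.e., there exist $M,\mu>0$ such that $\mathcal{E}^{\mathbf{u}}(t)\le M\exp(-\mu t)\mathcal{E}^{\mathbf{u}}(0)$ for all $t\ge0$ and every weak solution $\mathbf{u}$. (System (P), weak solutions and $\mathcal{E}^{\mathbf{u}}$ are defined in the context.)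
   Context: Setting. Let $\Omega=(0,L)$. System (P) is $$\partial_{tt}u-\partial_{xx}u=0 \text{ on }\Omega\times\mathbb{R}^+,\qquad \partial_{tt}u(0,t)-\partial_xu(0,t)=F(\partial_tu(0,t)),\qquad \partial_xu(L,t)=-g(\partial_tu(L,t)).$$ Spaces. $H=L^2(\Omega)\times\mathbb{R}$ with scalar product $((u_1,\theta_1),(u_2,\theta_2))_H=\int_\Omega u_1u_2\,dx+\theta_1\theta_2$. $V=\{(u,u(0)):u\in H^1(\Omega)\}$, a closed subspace of $H^1(\Omega)\times\mathbb{R}$, with the inherited scalar product. $\mathcal{H}=V\times H$ with the product Hilbert structure. Elements of $H$ are written $\mathbf{v}=(v,\theta)$, elements of $V$ are written $\mathbf{u}=(u,u(0))$, and elements of $\mathcal{H}$ are written $[\mathbf{u},\mathbf{v}]$. $W=\{\mathbf{u}\in V:u\in H^2(\Omega)\}$. Cauchy problem. (P) is recast as $\dot{\mathbf{X}}(t)+\mathcal{A}_g(\mathbf{X}(t))=\mathcal{F}(\mathbf{X}(t))$, $\mathbf{X}(0)=\mathbf{X}^0$, where $\mathbf{X}=[\mathbf{u},\mathbf{v}]$ with $\mathbf{v}=\mathbf{u}'$, $\mathcal{D}(\mathcal{A}_g)=\{[\mathbf{u},\mathbf{v}]\in W\times V:\partial_xu(L)=-g(v(L))\}$, $\mathcal{A}_g([\mathbf{u},\mathbf{v}])=-[\mathbf{v},(\partial_{xx}u,\partial_xu(0))]$, and $\mathcal{F}([\mathbf{u},(v,\theta)])=[0,(0,F(\theta))]$.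 Solutions. A strong solution is a (locally) absolutely continuous $\mathcal{H}$-valued function on $\mathbb{R}^+$ satisfying the differential equation for a.e. $t\ge0$, with initial data in $\mathcal{D}(\mathcal{A}_g)$. A weak solution, with initial data in $\mathcal{H}$, is a limit of strong solutions in $\mathcal{C}([0,T],\mathcal{H})$ for every $T>0$. It is known that for every $[\mathbf{u}^0,\mathbf{v}^0]\in\mathcal{H}$ there is a unique weak solution $[\mathbf{u},\mathbf{u}']$, with $\mathbf{u}\in\mathcal{C}(\mathbb{R}^+,V)\cap\mathcal{C}^1(\mathbb{R}^+,H)$; one calls $\mathbf{u}$ itself the weak solution. Energy. For $[\mathbf{u},\mathbf{v}]\in\mathcal{H}$, $\mathcal{E}(\mathbf{u},\mathbf{v})=\frac12\left\{\int_\Omega|\partial_xu|^2dx+\|\mathbf{v}\|_H^2\right\}$. For a weak solution $\mathbf{u}$, $\mathcal{E}^{\mathbf{u}}(t)=\mathcal{E}(\mathbf{u}(t),\mathbf{u}'(t))$. For real $s$, $s^+=\max\{s,0\}$. *)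

theory Defs
  imports "HOL-Analysis.Analysis" "HOL-Library.Function_Algebras"
begin

text \<open>Together with the product instances this makes \<open>((real \<Rightarrow> real) \<times> real) \<times> ((real \<Rightarrow> real) \<times> real)\<close>
  a real vector space.\<close>

instantiation "fun" :: (type, real_vector) real_vector
begin

definition scaleR_fun_def: "c *\<^sub>R f = (\<lambda>x. c *\<^sub>R f x)"

instance
  by standard (simp_all add: scaleR_fun_def plus_fun_def scaleR_add_right scaleR_add_left)

end

text \<open>Elements of $L^2(0,L)$ are represented by functions on the real line. Two functions represent
  the same element iff they agree almost everywhere on \<open>{0<..<L}\<close>; accordingly the norms below are
  seminorms on functions.\<close>

definition L2 :: "real \<Rightarrow> (real \<Rightarrow> real) set" where
  "L2 L = {f. f \<in> borel_measurable (lebesgue_on {0<..<L}) \<and>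
              integrable (lebesgue_on {0<..<L}) (\<lambda>x. (f x)\<^sup>2)}"

definition L2_inner :: "real \<Rightarrow> (real \<Rightarrow> real) \<Rightarrow> (real \<Rightarrow> real) \<Rightarrow> real" where
  "L2_inner L f h = (LINT x | lebesgue_on {0<..<L}. f x * h x)"

text \<open>Continuously differentiable test functions with compact support in \<open>(0,L)\<close>, as usual for
  Sobolev spaces on an interval; smooth ones give the same weak derivatives.\<close>

definition test_fun :: "real \<Rightarrow> (real \<Rightarrow> real) \<Rightarrow> (real \<Rightarrow> real) \<Rightarrow> bool" where
  "test_fun L \<phi> \<phi>' \<longleftrightarrow>
     (\<forall>x. (\<phi> has_real_derivative \<phi>' x) (at x)) \<and> continuous_on UNIV \<phi>' \<and>
     (\<exists>a b. 0 < a \<and> b < L \<and> (\<forall>x. x \<notin> {a..b} \<longrightarrow> \<phi> x = 0))"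

definition weak_deriv :: "real \<Rightarrow> (real \<Rightarrow> real) \<Rightarrow> (real \<Rightarrow> real) \<Rightarrow> bool" where
  "weak_deriv L u w \<longleftrightarrow>
     (\<forall>\<phi> \<phi>'. test_fun L \<phi> \<phi>' \<longrightarrow> L2_inner L u \<phi>' = - L2_inner L w \<phi>)"

text \<open>Elements of $H^1(0,L)$ are represented by functions which coincide on \<open>{0..L}\<close> with their
  continuous representative, so that the traces \<open>u 0\<close> and \<open>u L\<close> are function values.\<close>

definition H1 :: "real \<Rightarrow> (real \<Rightarrow> real) set" where
  "H1 L = {u \<in> L2 L. continuous_on {0..L} u \<and> (\<exists>w \<in> L2 L. weak_deriv L u w)}"

definition H2 :: "real \<Rightarrow> (real \<Rightarrow> real) set" where
  "H2 L = {u \<in> H1 L. \<exists>w \<in> H1 L. weak_deriv L u w}"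

text \<open>A representative of $\partial_x u$ for \<open>u\<close> in $H^1(0,L)$, unique up to null sets; if \<open>u\<close> is in
  $H^2(0,L)$, the continuous one, so that the boundary values $\partial_x u(0)$ and
  $\partial_x u(L)$ make sense.\<close>

definition Dx :: "real \<Rightarrow> (real \<Rightarrow> real) \<Rightarrow> (real \<Rightarrow> real)" where
  "Dx L u = (if u \<in> H2 L then SOME w. w \<in> H1 L \<and> weak_deriv L u w
             else SOME w. w \<in> L2 L \<and> weak_deriv L u w)"

type_synonym bvec = "(real \<Rightarrow> real) \<times> real"
type_synonym state = "bvec \<times> bvec"

definition H_space :: "real \<Rightarrow> bvec set" where
  "H_space L = L2 L \<times> UNIV"

definition H_inner :: "real \<Rightarrow> bvec \<Rightarrow> bvec \<Rightarrow> real" where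
  "H_inner L p q = L2_inner L (fst p) (fst q) + snd p * snd q"

definition H_norm :: "real \<Rightarrow> bvec \<Rightarrow> real" where
  "H_norm L p = sqrt (H_inner L p p)"

definition V_space :: "real \<Rightarrow> bvec set" where
  "V_space L = {(u, u 0) | u. u \<in> H1 L}"

text \<open>The scalar product inherited from $H^1(0,L) \times \mathbf{R}$.\<close>

definition V_inner :: "real \<Rightarrow> bvec \<Rightarrow> bvec \<Rightarrow> real" where
  "V_inner L p q = L2_inner L (fst p) (fst q) + L2_inner L (Dx L (fst p)) (Dx L (fst q))
                   + snd p * snd q"

definition W_space :: "real \<Rightarrow> bvec set" where
  "W_space L = {p \<in> V_space L. fst p \<in> H2 L}"

definition state_space :: "real \<Rightarrow> state set" where
  "state_space L = V_space L \<times> H_space L"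

definition state_norm :: "real \<Rightarrow> state \<Rightarrow> real" where
  "state_norm L X = sqrt (V_inner L (fst X) (fst X) + H_inner L (snd X) (snd X))"

definition dom_A :: "real \<Rightarrow> (real \<Rightarrow> real) \<Rightarrow> state set" where
  "dom_A L g = {X \<in> W_space L \<times> V_space L.
                  Dx L (fst (fst X)) L = - g (fst (snd X) L)}"

text \<open>The expression for the operator does not involve \<open>g\<close>, which only enters its domain.\<close>

definition op_A :: "real \<Rightarrow> state \<Rightarrow> state" where
  "op_A L X = (case X of ((u, _), v) \<Rightarrow> - (v, (Dx L (Dx L u), Dx L u 0)))"

definition op_F :: "(real \<Rightarrow> real) \<Rightarrow> state \<Rightarrow> state" where
  "op_F F X = (case X of (_, (_, \<theta>)) \<Rightarrow> (0, (0, F \<theta>)))"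

text \<open>Derivative at \<open>t\<close> of a function on \<open>{0..}\<close>, one-sided at \<open>t = 0\<close>.\<close>

definition has_time_deriv ::
    "('a::real_vector \<Rightarrow> real) \<Rightarrow> (real \<Rightarrow> 'a) \<Rightarrow> 'a \<Rightarrow> real \<Rightarrow> bool" where
  "has_time_deriv N X Y t \<longleftrightarrow>
     ((\<lambda>s. N ((X s - X t) /\<^sub>R (s - t) - Y)) \<longlongrightarrow> 0) (at t within {0..})"

text \<open>Absolute continuity on every \<open>{0..T}\<close>; a pair \<open>(a, b)\<close> stands for the interval from \<open>a\<close>
  to \<open>b\<close>.\<close>

definition loc_abs_cont :: "('a::real_vector \<Rightarrow> real) \<Rightarrow> (real \<Rightarrow> 'a) \<Rightarrow> bool" where
  "loc_abs_cont N X \<longleftrightarrow>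
     (\<forall>T>0. \<forall>\<epsilon>>0. \<exists>\<delta>>0. \<forall>I :: (real \<times> real) set.
        finite I \<longrightarrow> (\<forall>(a, b) \<in> I. 0 \<le> a \<and> a \<le> b \<and> b \<le> T) \<longrightarrow>
        disjoint_family_on (\<lambda>(a, b). {a<..<b}) I \<longrightarrow>
        (\<Sum>(a, b) \<in> I. b - a) < \<delta> \<longrightarrow> (\<Sum>(a, b) \<in> I. N (X b - X a)) < \<epsilon>)"

definition strong_solution ::
    "real \<Rightarrow> (real \<Rightarrow> real) \<Rightarrow> (real \<Rightarrow> real) \<Rightarrow> (real \<Rightarrow> state) \<Rightarrow> bool" where
  "strong_solution L g F X \<longleftrightarrow>
     (\<forall>t\<ge>0. X t \<in> state_space L) \<and> X 0 \<in> dom_A L g \<and>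
     loc_abs_cont (state_norm L) X \<and>
     (AE t in lebesgue. t \<ge> 0 \<longrightarrow> X t \<in> dom_A L g \<and>
        (\<exists>X' \<in> state_space L. has_time_deriv (state_norm L) X X' t \<and>
           X' + op_A L (X t) = op_F F (X t)))"

definition weak_solution_state ::
    "real \<Rightarrow> (real \<Rightarrow> real) \<Rightarrow> (real \<Rightarrow> real) \<Rightarrow> (real \<Rightarrow> state) \<Rightarrow> bool" where
  "weak_solution_state L g F X \<longleftrightarrow>
     (\<forall>t\<ge>0. X t \<in> state_space L) \<and>
     (\<exists>Xn :: nat \<Rightarrow> real \<Rightarrow> state. (\<forall>n. strong_solution L g F (Xn n)) \<and>
        (\<forall>T>0. \<forall>\<epsilon>>0. \<forall>\<^sub>F n in sequentially. \<forall>t\<in>{0..T}. state_norm L (Xn n t - X t) < \<epsilon>))"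

text \<open>The first component of a weak solution of the Cauchy problem is itself called a weak
  solution; the second component is then its derivative as an \<open>H_space\<close>-valued function.\<close>

definition weak_solution ::
    "real \<Rightarrow> (real \<Rightarrow> real) \<Rightarrow> (real \<Rightarrow> real) \<Rightarrow> (real \<Rightarrow> bvec) \<Rightarrow> bool" where
  "weak_solution L g F u \<longleftrightarrow> (\<exists>v. weak_solution_state L g F (\<lambda>t. (u t, v t)))"

definition Dt :: "real \<Rightarrow> (real \<Rightarrow> bvec) \<Rightarrow> real \<Rightarrow> bvec" where
  "Dt L u t = (SOME v. v \<in> H_space L \<and> has_time_deriv (H_norm L) u v t)"

definition energy :: "real \<Rightarrow> bvec \<Rightarrow> bvec \<Rightarrow> real" where
  "energy L u v = ((LINT x | lebesgue_on {0<..<L}. \<bar>Dx L (fst u) x\<bar>\<^sup>2) + (H_norm L v)\<^sup>2) / 2"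

definition solution_energy :: "real \<Rightarrow> (real \<Rightarrow> bvec) \<Rightarrow> real \<Rightarrow> real" where
  "solution_energy L u t = energy L (u t) (Dt L u t)"

definition pos_part :: "real \<Rightarrow> real" where
  "pos_part s = max s 0"

definition growth_condition :: "real \<Rightarrow> real \<Rightarrow> real \<Rightarrow> (real \<Rightarrow> real) \<Rightarrow> bool" where
  "growth_condition \<alpha>\<^sub>1 \<alpha>\<^sub>2 S g \<longleftrightarrow>
     (\<forall>s. \<bar>s\<bar> \<ge> S \<longrightarrow> \<alpha>\<^sub>1 * \<bar>s\<bar> \<le> \<bar>g s\<bar> \<and> \<bar>g s\<bar> \<le> \<alpha>\<^sub>2 * \<bar>s\<bar>)"

end

theory Submission
  imports Defs
begin

text \<open>Along a strong solution the multiplier functional \<open>\<rho> = \<integral> (x + 1) (\<partial>\<^sub>x u) (\<partial>\<^sub>t u) dx\<close> satisfies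
  \<open>\<rho>' \<le> (L + 1) / 2 (s\<^sup>2 + g(s)\<^sup>2) - E\<close> with \<open>s = \<partial>\<^sub>t u(L)\<close>, while \<open>E' \<le> - s g(s)\<close>. The growth
  condition bounds \<open>s\<^sup>2 + g(s)\<^sup>2\<close> by a multiple of \<open>s g(s)\<close> plus a constant, which vanishes if
  \<open>S = 0\<close>. So for small \<open>\<epsilon>\<close> the functional \<open>E + \<epsilon> \<rho>\<close>, equivalent to \<open>E\<close>, decays
  exponentially up to a constant \<open>K\<close>, and this passes to the limit for weak solutions. Since \<open>E\<close> is
  also nonincreasing, \<open>K\<close> can be absorbed in the threshold \<open>E\<^sub>S\<close>.

  Absolute continuity of the solutions is only used through real-valued bilinear expressions in
  them, so no vector-valued integral is needed.\<close>

section \<open>Absolutely continuous curves\<close>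

text \<open>The obstacle is regularity. The equation holds only at almost every time and only along
  strong solutions, every norm is a seminorm on representatives, and \<open>Dx\<close> and
  \<open>Dt\<close> are fixed by choice. This shapes three steps. Differential inequalities are
  integrated by a growth lemma for absolutely continuous real functions. Linearity of
  \<open>Dx\<close> almost everywhere and integration by parts rest on the fact that an element of
  H^1 is the primitive of its weak derivative. Finally, the energy of a weak solution is defined
  through \<open>Dt\<close>, so its velocity component has to be identified with the time derivative
  of its position; this takes first-order estimates for the approximating strong solutions that are
  uniform in the index. The smallness of \<epsilon> is used twice: it keeps the functional
  comparable to the energy, and it lets the damping at x = L dominate the boundary term created by
  the multiplier. No constant depends on the solution, which is why the estimates survive the
  limit.\<close>

lemma has_time_deriv_abs_iff:
  "has_time_deriv abs f D t \<longleftrightarrow> (f has_real_derivative D) (at t within {0..})"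
  unfolding has_time_deriv_def has_field_derivative_iff
  by (subst Lim_null[of _ D]) (simp add: tendsto_rabs_zero_iff divide_inverse mult.commute)

lemma loc_abs_contD:
  assumes "loc_abs_cont N X" "T > 0" "\<epsilon> > 0"
  obtains \<delta> where "\<delta> > 0"
    "\<And>I :: (real \<times> real) set. \<lbrakk>finite I; \<And>a b. (a, b) \<in> I \<Longrightarrow> 0 \<le> a \<and> a \<le> b \<and> b \<le> T;
        disjoint_family_on (\<lambda>(a, b). {a<..<b}) I; (\<Sum>(a, b) \<in> I. b - a) < \<delta>\<rbrakk>
      \<Longrightarrow> (\<Sum>(a, b) \<in> I. N (X b - X a)) < \<epsilon>"
proof -
  obtain \<delta> where "\<delta> > 0" and \<delta>: "\<forall>I :: (real \<times> real) set.
        finite I \<longrightarrow> (\<forall>(a, b) \<in> I. 0 \<le> a \<and> a \<le> b \<and> b \<le> T) \<longrightarrow>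
        disjoint_family_on (\<lambda>(a, b). {a<..<b}) I \<longrightarrow>
        (\<Sum>(a, b) \<in> I. b - a) < \<delta> \<longrightarrow> (\<Sum>(a, b) \<in> I. N (X b - X a)) < \<epsilon>"
    using assms unfolding loc_abs_cont_def by blast
  show thesis
    by (rule that[OF \<open>\<delta> > 0\<close>]) (use \<delta> in blast)
qed

text \<open>A family of one interval suffices. The definition only subtracts the value at the left
  endpoint from that at the right one; \<open>sym\<close> covers the other order.\<close>

lemma loc_abs_cont_delta:
  assumes "loc_abs_cont N X" "T > 0" "\<epsilon> > 0"
    and sym: "\<And>s t. 0 \<le> s \<Longrightarrow> 0 \<le> t \<Longrightarrow> N (X s - X t) = N (X t - X s)"
  obtains \<delta> where "\<delta> > 0"
    "\<And>s t. \<lbrakk>0 \<le> s; s \<le> T; 0 \<le> t; t \<le> T; \<bar>s - t\<bar> < \<delta>\<rbrakk> \<Longrightarrow> N (X s - X t) < \<epsilon>"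
proof -
  obtain \<delta> where \<delta>: "\<delta> > 0"
    "\<And>I :: (real \<times> real) set. \<lbrakk>finite I; \<And>a b. (a, b) \<in> I \<Longrightarrow> 0 \<le> a \<and> a \<le> b \<and> b \<le> T;
        disjoint_family_on (\<lambda>(a, b). {a<..<b}) I; (\<Sum>(a, b) \<in> I. b - a) < \<delta>\<rbrakk>
      \<Longrightarrow> (\<Sum>(a, b) \<in> I. N (X b - X a)) < \<epsilon>"
    using loc_abs_contD[OF assms(1-3)] by metis
  have *: "N (X b - X a) < \<epsilon>" if "0 \<le> a" "a \<le> b" "b \<le> T" "b - a < \<delta>" for a b
    using \<delta>(2)[of "{(a, b)}"] that by (auto simp: disjoint_family_on_def)
  show thesis
  proof
    fix s t assume "0 \<le> s" "s \<le> T" "0 \<le> t" "t \<le> T" "\<bar>s - t\<bar> < \<delta>"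
    then show "N (X s - X t) < \<epsilon>"
      using *[of s t] *[of t s] sym[of s t] by (cases "s \<le> t") auto
  qed fact
qed

text \<open>Meant for the exponential weight in the decay estimate, which is Lipschitz on bounded
  intervals.\<close>

lemma loc_abs_cont_le_lipschitz:
  fixes f :: "real \<Rightarrow> real"
  assumes "\<And>T. T > 0 \<Longrightarrow> \<exists>C. \<forall>s\<in>{0..T}. \<forall>t\<in>{0..T}. \<bar>f s - f t\<bar> \<le> C * \<bar>s - t\<bar>"
  shows "loc_abs_cont abs f"
  unfolding loc_abs_cont_def
proof (intro allI impI)
  fix T \<epsilon> :: real assume "T > 0" "\<epsilon> > 0"
  then obtain C where C: "\<And>s t. s \<in> {0..T} \<Longrightarrow> t \<in> {0..T} \<Longrightarrow> \<bar>f s - f t\<bar> \<le> C * \<bar>s - t\<bar>"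
    using assms by blast
  show "\<exists>\<delta>>0. \<forall>I :: (real \<times> real) set. finite I \<longrightarrow> (\<forall>(a, b) \<in> I. 0 \<le> a \<and> a \<le> b \<and> b \<le> T) \<longrightarrow>
        disjoint_family_on (\<lambda>(a, b). {a<..<b}) I \<longrightarrow>
        (\<Sum>(a, b) \<in> I. b - a) < \<delta> \<longrightarrow> (\<Sum>(a, b) \<in> I. \<bar>f b - f a\<bar>) < \<epsilon>"
  \<comment> \<open>The given \<open>C\<close> may be zero or negative;
    \<open>\<bar>C\<bar> + 1\<close> is a positive Lipschitz constant in any case.\<close>
  proof (intro exI[of _ "\<epsilon> / (\<bar>C\<bar> + 1)"] conjI allI impI)
    fix I :: "(real \<times> real) set"
    assume I: "finite I" "\<forall>(a, b) \<in> I. 0 \<le> a \<and> a \<le> b \<and> b \<le> T"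
      and l: "(\<Sum>(a, b) \<in> I. b - a) < \<epsilon> / (\<bar>C\<bar> + 1)"
    have nn: "0 \<le> (\<Sum>(a, b) \<in> I. b - a)"
      using I by (intro sum_nonneg) auto
    have "(\<Sum>(a, b) \<in> I. \<bar>f b - f a\<bar>) \<le> (\<Sum>(a, b) \<in> I. (\<bar>C\<bar> + 1) * (b - a))"
    proof (intro sum_mono, clarify)
      fix a b assume "(a, b) \<in> I"
      then have ab: "0 \<le> a" "a \<le> b" "b \<le> T" using I by auto
      then have "\<bar>f b - f a\<bar> \<le> C * \<bar>b - a\<bar>" using C[of b a] by auto
      also have "\<dots> \<le> (\<bar>C\<bar> + 1) * (b - a)"
        using ab by (intro mult_mono) auto
      finally show "\<bar>f b - f a\<bar> \<le> (\<bar>C\<bar> + 1) * (b - a)" .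
    qed
    also have "\<dots> = (\<bar>C\<bar> + 1) * (\<Sum>(a, b) \<in> I. b - a)"
      by (simp add: sum_distrib_left case_prod_unfold)
    also have "\<dots> < \<epsilon>"
      using l by (simp add: field_simps add_pos_nonneg)
    finally show "(\<Sum>(a, b) \<in> I. \<bar>f b - f a\<bar>) < \<epsilon>" .
  qed (use \<open>\<epsilon> > 0\<close> in \<open>simp add: add_nonneg_pos\<close>)
qed

text \<open>Converts smallness of the measure of a cover into smallness of the total length of
  intervals, the quantity that absolute continuity controls.\<close>

lemma sum_lengths_le_measure:
  fixes I :: "(real \<times> real) set"
  assumes "finite I" "\<And>a b. (a, b) \<in> I \<Longrightarrow> a \<le> b \<and> {a<..<b} \<subseteq> G"
    and disj: "disjoint_family_on (\<lambda>(a, b). {a<..<b}) I" and "G \<in> lmeasurable"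
  shows "(\<Sum>(a, b) \<in> I. b - a) \<le> measure lebesgue G"
proof -
  have sub: "(\<Union>(a, b) \<in> I. {a<..<b}) \<subseteq> G"
    using assms(2) by fastforce
  have "(\<Sum>(a, b) \<in> I. b - a) = (\<Sum>(a, b) \<in> I. measure lebesgue {a<..<b})"
    using assms(2) by (intro sum.cong) auto
  also have "\<dots> = measure lebesgue (\<Union>(a, b) \<in> I. {a<..<b})"
    using assms by (subst measure_finite_Union) (auto simp: case_prod_unfold)
  also have "\<dots> \<le> measure lebesgue G"
    using assms sub by (intro measure_mono_fmeasurable) (auto simp: case_prod_unfold)
  finally show ?thesis .
qed

text \<open>Cover the exceptional null set by an open set \<open>G\<close> of small measure. Property \<open>P c d\<close> below
  allows an error supported on disjoint intervals inside \<open>G\<close>; it is additive and holds for all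
  small intervals, hence for the whole one.\<close>

lemma loc_abs_cont_growth_le:
  fixes f :: "real \<Rightarrow> real"
  assumes ac: "loc_abs_cont abs f" and ab: "0 \<le> a" "a \<le> b"
    and deriv: "AE t in lebesgue. a \<le> t \<and> t \<le> b \<longrightarrow> (\<exists>D\<le>C. has_time_deriv abs f D t)"
  shows "f b - f a \<le> C * (b - a)"
proof (rule field_le_epsilon)
  fix e :: real assume "e > 0"
  \<comment> \<open>Budget for \<open>e\<close>: one half for using the slope
    \<open>C + \<eta>\<close> instead of \<open>C\<close>, one quarter for the variation of
    \<open>f\<close> on the exceptional intervals, one quarter for their length times
    \<open>\<bar>C\<bar> + \<eta>\<close>.\<close>
  define \<eta> where "\<eta> = e / (2 * (b - a + 1))"
  have \<eta>: "\<eta> > 0" "\<eta> * (b - a) \<le> e / 2"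
    using \<open>e > 0\<close> ab by (auto simp: \<eta>_def field_simps)
  define T where "T = b + 1"
  have "T > 0" using ab by (simp add: T_def)
  obtain \<delta> where \<delta>: "\<delta> > 0"
    "\<And>I :: (real \<times> real) set. \<lbrakk>finite I; \<And>a b. (a, b) \<in> I \<Longrightarrow> 0 \<le> a \<and> a \<le> b \<and> b \<le> T;
        disjoint_family_on (\<lambda>(a, b). {a<..<b}) I; (\<Sum>(a, b) \<in> I. b - a) < \<delta>\<rbrakk>
      \<Longrightarrow> (\<Sum>(a, b) \<in> I. \<bar>f b - f a\<bar>) < e / 4"
    using loc_abs_contD[OF ac \<open>T > 0\<close>, of "e / 4"] \<open>e > 0\<close> by (metis zero_less_divide_iff zero_less_numeral)
  define \<delta>' where "\<delta>' = min \<delta> (e / (4 * (\<bar>C\<bar> + \<eta>)))"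
  have \<delta>': "\<delta>' > 0" "\<delta>' \<le> \<delta>" "(\<bar>C\<bar> + \<eta>) * \<delta>' \<le> e / 4"
  proof -
    have pos: "\<bar>C\<bar> + \<eta> > 0" using \<eta> by simp
    show "\<delta>' > 0" "\<delta>' \<le> \<delta>" using pos \<delta>(1) \<open>e > 0\<close> by (auto simp: \<delta>'_def)
    have "(\<bar>C\<bar> + \<eta>) * \<delta>' \<le> (\<bar>C\<bar> + \<eta>) * (e / (4 * (\<bar>C\<bar> + \<eta>)))"
      using pos by (intro mult_left_mono) (auto simp: \<delta>'_def)
    also have "\<dots> = e / 4" using pos by (simp del: distrib_left_numeral)
    finally show "(\<bar>C\<bar> + \<eta>) * \<delta>' \<le> e / 4" .
  qed
  obtain N where N: "N \<in> null_sets lebesgue"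
    and D: "\<And>t. t \<notin> N \<Longrightarrow> a \<le> t \<Longrightarrow> t \<le> b \<Longrightarrow> \<exists>D\<le>C. has_time_deriv abs f D t"
    by (rule AE_E3[OF deriv]) auto
  obtain G where G: "open G" "N \<subseteq> G" "G - N \<in> lmeasurable" "emeasure lebesgue (G - N) < ennreal \<delta>'"
    using sets_lebesgue_outer_open[of N \<delta>'] N \<delta>'(1) by auto
  have Geq: "G = (G - N) \<union> N" using G by auto
  have Gm: "G \<in> lmeasurable"
    by (subst Geq, rule fmeasurable.Un) (use G N in \<open>auto intro: fmeasurableI_null_sets\<close>)
  have "emeasure lebesgue G = emeasure lebesgue (G - N)"
    using emeasure_Un_null_set[OF fmeasurableD[OF G(3)] N] Geq by metis
  then have Gd: "measure lebesgue G < \<delta>'"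
    using G(4) \<delta>'(1) Gm
    by (metis emeasure_eq_measure2 ennreal_less_iff measure_nonneg)
  \<comment> \<open>The extra \<open>(\<bar>C\<bar> + \<eta>) * (y - x)\<close> is there because
    \<open>C\<close> may be negative: on an exceptional interval it compensates for
    \<open>(C + \<eta>) * (y - x)\<close>.\<close>
  define R where "R c d I \<longleftrightarrow> finite I \<and>
     (\<forall>(x, y) \<in> I. c \<le> x \<and> x < y \<and> y \<le> d \<and> {x<..<y} \<subseteq> G) \<and>
     disjoint_family_on (\<lambda>(x, y). {x<..<y}) I \<and>
     f d - f c \<le> (C + \<eta>) * (d - c) + (\<Sum>(x, y) \<in> I. \<bar>f y - f x\<bar> + (\<bar>C\<bar> + \<eta>) * (y - x))" for c d I
  \<comment> \<open>The guards make \<open>P\<close> vacuous off \<open>[a, b]\<close>, because the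
    small intervals around a point that \<open>Bolzano\<close> offers may stick out.\<close>
  define P where "P c d \<longleftrightarrow> (a \<le> c \<longrightarrow> d \<le> b \<longrightarrow> (\<exists>I. R c d I))" for c d
  have "P a b"
  proof (rule Bolzano[OF ab(2)])
    fix p q r :: real assume P: "P p q" "P q r" and le: "p \<le> q" "q \<le> r"
    show "P p r" unfolding P_def
    proof (intro impI)
      assume "a \<le> p" "r \<le> b"
      then have "q \<le> b" "a \<le> q" using le by auto
      then obtain I J where "R p q I" "R q r J"
        using P \<open>a \<le> p\<close> \<open>r \<le> b\<close> unfolding P_def by blast
      note I = this(1)[unfolded R_def] and J = this(2)[unfolded R_def]
      \<comment> \<open>Strictness of \<open>x < y\<close> in \<open>R\<close> matters here: a
        common pair would satisfy \<open>q \<le> x\<close> and \<open>y \<le> q\<close>.\<close>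
      have "I \<inter> J = {}" using I J by fastforce
      then have s: "(\<Sum>(x, y) \<in> I \<union> J. \<bar>f y - f x\<bar> + (\<bar>C\<bar> + \<eta>) * (y - x))
          = (\<Sum>(x, y) \<in> I. \<bar>f y - f x\<bar> + (\<bar>C\<bar> + \<eta>) * (y - x))
            + (\<Sum>(x, y) \<in> J. \<bar>f y - f x\<bar> + (\<bar>C\<bar> + \<eta>) * (y - x))"
        using I J by (intro sum.union_disjoint) auto
      have d: "disjoint_family_on (\<lambda>(x, y). {x<..<y}) (I \<union> J)"
        unfolding disjoint_family_on_def
      proof (intro ballI impI)
        have IJ: "{x<..<y} \<inter> {x'<..<y'} = {}" if "(x, y) \<in> I" "(x', y') \<in> J" for x y x' y'
        proof -
          have "y \<le> q" "q \<le> x'" using I J that by auto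
          then show ?thesis by auto
        qed
        fix u v assume uv: "u \<in> I \<union> J" "v \<in> I \<union> J" "u \<noteq> v"
        obtain x y x' y' where [simp]: "u = (x, y)" "v = (x', y')" by (cases u; cases v)
        consider "u \<in> I" "v \<in> I" | "u \<in> J" "v \<in> J" | "u \<in> I" "v \<in> J" | "v \<in> I" "u \<in> J"
          using uv by blast
        then show "(case u of (x, y) \<Rightarrow> {x<..<y}) \<inter> (case v of (x, y) \<Rightarrow> {x<..<y}) = {}"
        proof cases
          case 1 then show ?thesis using I uv(3) disjoint_family_onD by metis
        next
          case 2 then show ?thesis using J uv(3) disjoint_family_onD by metis
        next
          case 3 then show ?thesis using IJ by simp
        next
          case 4 then show ?thesis using IJ[of x' y' x y] by (simp add: Int_commute)
        qed
      qed
      have "\<forall>(x, y) \<in> I \<union> J. p \<le> x \<and> x < y \<and> y \<le> r \<and> {x<..<y} \<subseteq> G"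
        using I J le by fastforce
      moreover have "f r - f p \<le> (C + \<eta>) * (r - p)
            + (\<Sum>(x, y) \<in> I \<union> J. \<bar>f y - f x\<bar> + (\<bar>C\<bar> + \<eta>) * (y - x))"
        using I J unfolding s by (simp add: algebra_simps)
      ultimately show "\<exists>I. R p r I"
        using I J d unfolding R_def by (intro exI[of _ "I \<union> J"]) auto
    qed
  next
    fix x assume x: "a \<le> x" "x \<le> b"
    show "\<exists>d>0. \<forall>p q. p \<le> x \<and> x \<le> q \<and> q - p < d \<longrightarrow> P p q"
    proof (cases "x \<in> N")
      case True
      then obtain d where d: "d > 0" "ball x d \<subseteq> G"
        using G by (meson open_contains_ball subsetD)
      show ?thesis
      proof (intro exI[of _ d] conjI allI impI)
        fix p q assume pq: "p \<le> x \<and> x \<le> q \<and> q - p < d"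
        show "P p q"
        proof (cases "p = q")
          case True then show ?thesis
            unfolding P_def R_def by (intro impI exI[of _ "{}"]) (auto simp: disjoint_family_on_def)
        next
          case False
          have "{p<..<q} \<subseteq> G" using d(2) pq by (auto simp: dist_real_def subset_iff)
          moreover have "f q - f p \<le> (C + \<eta>) * (q - p) + (\<bar>f q - f p\<bar> + (\<bar>C\<bar> + \<eta>) * (q - p))"
          proof -
            have "0 \<le> (C + \<eta> + \<bar>C\<bar> + \<eta>) * (q - p)" using \<eta> pq by simp
            then show ?thesis by (simp add: algebra_simps)
          qed
          ultimately show ?thesis using False pq unfolding P_def R_def
            by (intro impI exI[of _ "{(p, q)}"]) (auto simp: disjoint_family_on_def)
        qed
      qed fact
    next
      case False
      then obtain D where D: "D \<le> C" "(f has_real_derivative D) (at x within {0..})"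
        using D x has_time_deriv_abs_iff by blast
      then obtain d where d: "d > 0"
        "\<And>y. y \<ge> 0 \<Longrightarrow> \<bar>y - x\<bar> < d \<Longrightarrow> \<bar>f y - f x - D * (y - x)\<bar> \<le> \<eta> * \<bar>y - x\<bar>"
        using \<eta>(1) unfolding has_field_derivative_def has_derivative_within_alt by auto
      show ?thesis
      proof (intro exI[of _ d] conjI allI impI)
        fix p q assume pq: "p \<le> x \<and> x \<le> q \<and> q - p < d"
        \<comment> \<open>Since \<open>x\<close> lies between \<open>p\<close> and \<open>q\<close>,
          the two first-order errors at \<open>x\<close> add up to exactly
          \<open>\<eta> * (q - p)\<close>.\<close>
        have "f q - f p \<le> (C + \<eta>) * (q - p)" if "0 \<le> p"
        proof -
          have "\<bar>f q - f x - D * (q - x)\<bar> \<le> \<eta> * (q - x)" "\<bar>f p - f x - D * (p - x)\<bar> \<le> \<eta> * (x - p)"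
            using d(2)[of q] d(2)[of p] that pq by auto
          then have "f q - f p \<le> (D + \<eta>) * (q - p)" by (simp add: algebra_simps)
          also have "\<dots> \<le> (C + \<eta>) * (q - p)" using D pq by (intro mult_right_mono) auto
          finally show ?thesis .
        qed
        then show "P p q" unfolding P_def R_def using ab by (intro impI exI[of _ "{}"]) (auto simp: disjoint_family_on_def)
      qed fact
    qed
  qed
  then obtain I where I: "finite I" "\<forall>(x, y) \<in> I. a \<le> x \<and> x < y \<and> y \<le> b \<and> {x<..<y} \<subseteq> G"
     "disjoint_family_on (\<lambda>(x, y). {x<..<y}) I"
     "f b - f a \<le> (C + \<eta>) * (b - a) + (\<Sum>(x, y) \<in> I. \<bar>f y - f x\<bar> + (\<bar>C\<bar> + \<eta>) * (y - x))"
    unfolding P_def R_def by auto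
  show "f b - f a \<le> C * (b - a) + e"
  proof -
    have len: "(\<Sum>(x, y) \<in> I. y - x) < \<delta>'"
      using sum_lengths_le_measure[OF I(1) _ I(3) Gm] I(2) Gd by fastforce
    then have "(\<Sum>(x, y) \<in> I. \<bar>f y - f x\<bar>) < e / 4"
      using I ab \<delta>'(2) by (intro \<delta>(2)) (auto simp: T_def)
    moreover have "(\<Sum>(x, y) \<in> I. (\<bar>C\<bar> + \<eta>) * (y - x)) \<le> e / 4"
    proof -
      have "(\<Sum>(x, y) \<in> I. (\<bar>C\<bar> + \<eta>) * (y - x)) = (\<bar>C\<bar> + \<eta>) * (\<Sum>(x, y) \<in> I. y - x)"
        by (simp add: sum_distrib_left case_prod_unfold)
      also have "\<dots> \<le> (\<bar>C\<bar> + \<eta>) * \<delta>'"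
        using len \<eta>(1) by (intro mult_left_mono) auto
      finally show ?thesis using \<delta>'(3) by simp
    qed
    moreover have "(\<Sum>(x, y) \<in> I. \<bar>f y - f x\<bar> + (\<bar>C\<bar> + \<eta>) * (y - x))
        = (\<Sum>(x, y) \<in> I. \<bar>f y - f x\<bar>) + (\<Sum>(x, y) \<in> I. (\<bar>C\<bar> + \<eta>) * (y - x))"
      by (simp add: sum.distrib case_prod_unfold)
    moreover have "(C + \<eta>) * (b - a) = C * (b - a) + \<eta> * (b - a)"
      by (rule distrib_right)
    ultimately show ?thesis
      using I(4) \<eta>(2) by linarith
  qed
qed


section \<open>Seminorms and bounded bilinear forms along absolutely continuous curves\<close>

text \<open>The norms in use vanish on functions that are zero almost everywhere, and their laws are
  asserted only on a subspace such as \<open>L2 L\<close>; hence carrier and seminorm are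
  parameters.\<close>

locale seminorm_on =
  fixes S :: "'a::real_vector set" and N :: "'a \<Rightarrow> real"
  assumes subspace: "subspace S"
    and nonneg: "x \<in> S \<Longrightarrow> 0 \<le> N x"
    and triangle: "x \<in> S \<Longrightarrow> y \<in> S \<Longrightarrow> N (x + y) \<le> N x + N y"
    and scale: "x \<in> S \<Longrightarrow> N (c *\<^sub>R x) = \<bar>c\<bar> * N x"
begin

lemmas closed = subspace_add[OF subspace] subspace_diff[OF subspace] subspace_scale[OF subspace]
  subspace_0[OF subspace]

lemma minus: "x \<in> S \<Longrightarrow> N (- x) = N x"
  using scale[of x "-1"] by simp

lemma diff_commute: "x \<in> S \<Longrightarrow> y \<in> S \<Longrightarrow> N (x - y) = N (y - x)"
  using minus[of "x - y"] by (simp add: closed)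

lemma triangle_diff: "x \<in> S \<Longrightarrow> y \<in> S \<Longrightarrow> z \<in> S \<Longrightarrow> N (x - z) \<le> N (x - y) + N (y - z)"
  using triangle[of "x - y" "y - z"] by (simp add: closed)

lemma abs_diff_le: "x \<in> S \<Longrightarrow> y \<in> S \<Longrightarrow> \<bar>N x - N y\<bar> \<le> N (x - y)"
  using triangle[of "x - y" y] triangle[of "y - x" x] diff_commute[of x y] by (simp add: closed)

lemma loc_abs_cont_continuous:
  assumes "loc_abs_cont N X" "\<And>t. t \<ge> 0 \<Longrightarrow> X t \<in> S" "t \<ge> 0"
  shows "((\<lambda>s. N (X s - X t)) \<longlongrightarrow> 0) (at t within {0..})"
proof (rule tendstoI)
  fix e :: real assume "e > 0"
  obtain \<delta> where \<delta>: "\<delta> > 0"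
    "\<And>s r. \<lbrakk>0 \<le> s; s \<le> t + 1; 0 \<le> r; r \<le> t + 1; \<bar>s - r\<bar> < \<delta>\<rbrakk> \<Longrightarrow> N (X s - X r) < e"
    using loc_abs_cont_delta[OF assms(1), of "t + 1" e] diff_commute assms \<open>e > 0\<close>
    by (metis add_nonneg_pos zero_less_one)
  show "\<forall>\<^sub>F s in at t within {0..}. dist (N (X s - X t)) 0 < e"
    unfolding eventually_at using \<delta> assms nonneg
    by (intro exI[of _ "min \<delta> 1"]) (auto simp: dist_real_def closed)
qed

lemma loc_abs_cont_bounded:
  assumes "loc_abs_cont N X" "\<And>t. t \<ge> 0 \<Longrightarrow> X t \<in> S"
  obtains C where "C \<ge> 0" "\<And>t. 0 \<le> t \<Longrightarrow> t \<le> T \<Longrightarrow> N (X t) \<le> C"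
proof -
  have "continuous_on {0..T} (\<lambda>t. N (X t))"
    unfolding continuous_on_def
  proof
    fix t assume t: "t \<in> {0..T}"
    have "((\<lambda>s. N (X s) - N (X t)) \<longlongrightarrow> 0) (at t within {0..})"
    proof (rule Lim_null_comparison)
      show "\<forall>\<^sub>F s in at t within {0..}. norm (N (X s) - N (X t)) \<le> N (X s - X t)"
        unfolding eventually_at_filter using abs_diff_le assms(2) t by auto
    qed (use loc_abs_cont_continuous assms t in auto)
    then show "((\<lambda>s. N (X s)) \<longlongrightarrow> N (X t)) (at t within {0..T})"
      using tendsto_within_subset[of _ _ _ "{0..}" "{0..T}"] Lim_null by fastforce
  qed
  then have "bounded ((\<lambda>t. N (X t)) ` {0..T})"
    by (intro compact_imp_bounded compact_continuous_image) auto
  then obtain C where "\<And>y. y \<in> (\<lambda>t. N (X t)) ` {0..T} \<Longrightarrow> \<bar>y\<bar> \<le> C"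
    unfolding bounded_iff by auto
  then have "\<And>t. 0 \<le> t \<Longrightarrow> t \<le> T \<Longrightarrow> \<bar>N (X t)\<bar> \<le> C" by auto
  then show thesis by (intro that[of "\<bar>C\<bar>"]) force+
qed

end

text \<open>Two different spaces are allowed because the Lyapunov functional pairs states with
  states, while the position is tested against elements of \<open>H_space\<close>.\<close>

locale bilinear_on = A: seminorm_on S N + B: seminorm_on S' N'
  for S :: "'a::real_vector set" and N and S' :: "'b::real_vector set" and N' +
  fixes B :: "'a \<Rightarrow> 'b \<Rightarrow> real" and C :: real
  assumes diff_left: "x \<in> S \<Longrightarrow> x' \<in> S \<Longrightarrow> y \<in> S' \<Longrightarrow> B (x - x') y = B x y - B x' y"
    and diff_right: "x \<in> S \<Longrightarrow> y \<in> S' \<Longrightarrow> y' \<in> S' \<Longrightarrow> B x (y - y') = B x y - B x y'"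
    and scale_left: "x \<in> S \<Longrightarrow> y \<in> S' \<Longrightarrow> B (c *\<^sub>R x) y = c * B x y"
    and scale_right: "x \<in> S \<Longrightarrow> y \<in> S' \<Longrightarrow> B x (c *\<^sub>R y) = c * B x y"
    and bound: "x \<in> S \<Longrightarrow> y \<in> S' \<Longrightarrow> \<bar>B x y\<bar> \<le> C * (N x * N' y)"
    and C_nonneg: "0 \<le> C"
begin

text \<open>The increment splits into \<open>B (X b - X a) (Y b) + B (X a) (Y b - Y a)\<close>, so
  it is at most the two increments times bounds of the curves on \<open>[0, T]\<close>.\<close>

lemma loc_abs_cont:
  assumes X: "loc_abs_cont N X" "\<And>t. t \<ge> 0 \<Longrightarrow> X t \<in> S"
    and Y: "loc_abs_cont N' Y" "\<And>t. t \<ge> 0 \<Longrightarrow> Y t \<in> S'"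
  shows "loc_abs_cont abs (\<lambda>t. B (X t) (Y t))"
  unfolding loc_abs_cont_def
proof (intro allI impI)
  fix T \<epsilon> :: real assume T: "T > 0" and "\<epsilon> > 0"
  obtain K where K: "K \<ge> 0" "\<And>t. 0 \<le> t \<Longrightarrow> t \<le> T \<Longrightarrow> N (X t) \<le> K"
    using A.loc_abs_cont_bounded[OF X] by blast
  obtain K' where K': "K' \<ge> 0" "\<And>t. 0 \<le> t \<Longrightarrow> t \<le> T \<Longrightarrow> N' (Y t) \<le> K'"
    using B.loc_abs_cont_bounded[OF Y] by blast
  define R where "R = C * (K + K') + 1"
  have "R > 0" using K K' C_nonneg by (simp add: R_def add_nonneg_pos)
  have CK: "C * K \<le> R" "C * K' \<le> R"
    using K(1) K'(1) C_nonneg by (auto simp: R_def algebra_simps)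
  define \<eta> where "\<eta> = \<epsilon> / (2 * R)"
  have "\<eta> > 0" using \<open>R > 0\<close> \<open>\<epsilon> > 0\<close> by (simp add: \<eta>_def)
  obtain \<delta> where \<delta>: "\<delta> > 0"
    "\<And>I :: (real \<times> real) set. \<lbrakk>finite I; \<And>a b. (a, b) \<in> I \<Longrightarrow> 0 \<le> a \<and> a \<le> b \<and> b \<le> T;
        disjoint_family_on (\<lambda>(a, b). {a<..<b}) I; (\<Sum>(a, b) \<in> I. b - a) < \<delta>\<rbrakk>
      \<Longrightarrow> (\<Sum>(a, b) \<in> I. N (X b - X a)) < \<eta>"
    using loc_abs_contD[OF X(1) T \<open>\<eta> > 0\<close>] by metis
  obtain \<delta>' where \<delta>': "\<delta>' > 0"
    "\<And>I :: (real \<times> real) set. \<lbrakk>finite I; \<And>a b. (a, b) \<in> I \<Longrightarrow> 0 \<le> a \<and> a \<le> b \<and> b \<le> T;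
        disjoint_family_on (\<lambda>(a, b). {a<..<b}) I; (\<Sum>(a, b) \<in> I. b - a) < \<delta>'\<rbrakk>
      \<Longrightarrow> (\<Sum>(a, b) \<in> I. N' (Y b - Y a)) < \<eta>"
    using loc_abs_contD[OF Y(1) T \<open>\<eta> > 0\<close>] by metis
  have step: "\<bar>B (X b) (Y b) - B (X a) (Y a)\<bar> \<le> R * (N (X b - X a) + N' (Y b - Y a))"
    if "0 \<le> a" "a \<le> b" "b \<le> T" for a b
  proof -
    have S: "X a \<in> S" "X b \<in> S" "Y a \<in> S'" "Y b \<in> S'" using that X Y by auto
    have nn: "0 \<le> N (X b - X a)" "0 \<le> N' (Y b - Y a)"
      using S A.nonneg B.nonneg by (auto simp: A.closed B.closed)
    have "B (X b) (Y b) - B (X a) (Y a) = B (X b - X a) (Y b) + B (X a) (Y b - Y a)"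
      using S by (simp add: diff_left diff_right)
    also have "\<bar>\<dots>\<bar> \<le> \<bar>B (X b - X a) (Y b)\<bar> + \<bar>B (X a) (Y b - Y a)\<bar>" by simp
    also have "\<dots> \<le> C * (N (X b - X a) * N' (Y b)) + C * (N (X a) * N' (Y b - Y a))"
      using S by (intro add_mono bound) (auto simp: A.closed B.closed)
    also have "\<dots> \<le> C * (N (X b - X a) * K') + C * (K * N' (Y b - Y a))"
      using that nn K K' C_nonneg by (intro add_mono mult_left_mono mult_right_mono) auto
    also have "\<dots> = (C * K') * N (X b - X a) + (C * K) * N' (Y b - Y a)" by simp
    also have "\<dots> \<le> R * N (X b - X a) + R * N' (Y b - Y a)"
      using CK nn by (intro add_mono mult_right_mono)
    finally show ?thesis by (simp add: distrib_left)
  qed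
  show "\<exists>\<delta>>0. \<forall>I :: (real \<times> real) set. finite I \<longrightarrow> (\<forall>(a, b) \<in> I. 0 \<le> a \<and> a \<le> b \<and> b \<le> T) \<longrightarrow>
        disjoint_family_on (\<lambda>(a, b). {a<..<b}) I \<longrightarrow>
        (\<Sum>(a, b) \<in> I. b - a) < \<delta> \<longrightarrow> (\<Sum>(a, b) \<in> I. \<bar>B (X b) (Y b) - B (X a) (Y a)\<bar>) < \<epsilon>"
  proof (intro exI[of _ "min \<delta> \<delta>'"] conjI allI impI)
    fix I :: "(real \<times> real) set"
    assume I: "finite I" "\<forall>(a, b) \<in> I. 0 \<le> a \<and> a \<le> b \<and> b \<le> T"
      "disjoint_family_on (\<lambda>(a, b). {a<..<b}) I" "(\<Sum>(a, b) \<in> I. b - a) < min \<delta> \<delta>'"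
    have "(\<Sum>(a, b) \<in> I. N (X b - X a)) < \<eta>" "(\<Sum>(a, b) \<in> I. N' (Y b - Y a)) < \<eta>"
      by (rule \<delta>(2) \<delta>'(2); use I in auto)+
    then have "R * ((\<Sum>(a, b) \<in> I. N (X b - X a)) + (\<Sum>(a, b) \<in> I. N' (Y b - Y a))) < R * (\<eta> + \<eta>)"
      using \<open>R > 0\<close> by (intro mult_strict_left_mono) auto
    also have "R * (\<eta> + \<eta>) = \<epsilon>" using \<open>R > 0\<close> by (simp add: \<eta>_def)
    finally have "(\<Sum>(a, b) \<in> I. R * (N (X b - X a) + N' (Y b - Y a))) < \<epsilon>"
      by (simp add: sum_distrib_left sum.distrib case_prod_unfold distrib_left)
    moreover have "(\<Sum>(a, b) \<in> I. \<bar>B (X b) (Y b) - B (X a) (Y a)\<bar>)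
        \<le> (\<Sum>(a, b) \<in> I. R * (N (X b - X a) + N' (Y b - Y a)))"
      using I step by (intro sum_mono) auto
    ultimately show "(\<Sum>(a, b) \<in> I. \<bar>B (X b) (Y b) - B (X a) (Y a)\<bar>) < \<epsilon>" by linarith
  qed (use \<delta> \<delta>' in auto)
qed

text \<open>The product rule. The difference quotient minus the claimed derivative is a sum of three
  terms, each with one factor tending to zero: the two quotient errors and \<open>Y s - Y t\<close>,
  the latter by absolute continuity.\<close>

lemma has_time_deriv:
  assumes X: "loc_abs_cont N X" "\<And>t. t \<ge> 0 \<Longrightarrow> X t \<in> S"
    and Y: "loc_abs_cont N' Y" "\<And>t. t \<ge> 0 \<Longrightarrow> Y t \<in> S'"
    and "t \<ge> 0" and X': "has_time_deriv N X X' t" "X' \<in> S" and Y': "has_time_deriv N' Y Y' t" "Y' \<in> S'"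
  shows "has_time_deriv abs (\<lambda>t. B (X t) (Y t)) (B X' (Y t) + B (X t) Y') t"
proof -
  define q where "q s = (X s - X t) /\<^sub>R (s - t)" for s
  define r where "r s = (Y s - Y t) /\<^sub>R (s - t)" for s
  have t: "X t \<in> S" "Y t \<in> S'" using X Y \<open>t \<ge> 0\<close> by auto
  have cY: "((\<lambda>s. N' (Y s - Y t)) \<longlongrightarrow> 0) (at t within {0..})"
    using B.loc_abs_cont_continuous[OF Y \<open>t \<ge> 0\<close>] .
  \<comment> \<open>\<open>N' (Y s)\<close> is majorised by
    \<open>N' (Y s - Y t) + N' (Y t)\<close>, whose limit is at hand.\<close>
  have lim: "((\<lambda>s. C * (N (q s - X') * (N' (Y s - Y t) + N' (Y t))) + C * (N X' * N' (Y s - Y t))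
       + C * (N (X t) * N' (r s - Y'))) \<longlongrightarrow> C * (0 * (0 + N' (Y t))) + C * (N X' * 0) + C * (N (X t) * 0))
       (at t within {0..})"
    using X'(1) Y'(1) cY unfolding has_time_deriv_def q_def r_def
    by (intro tendsto_intros) auto
  show ?thesis unfolding has_time_deriv_def
  proof (rule Lim_null_comparison[OF _ lim[simplified]])
    show "\<forall>\<^sub>F s in at t within {0..}.
       norm \<bar>(B (X s) (Y s) - B (X t) (Y t)) /\<^sub>R (s - t) - (B X' (Y t) + B (X t) Y')\<bar>
       \<le> C * (N (q s - X') * (N' (Y s - Y t) + N' (Y t))) + C * (N X' * N' (Y s - Y t))
       + C * (N (X t) * N' (r s - Y'))"
      unfolding eventually_at_filter
    proof (intro always_eventually allI impI)
      fix s assume s: "s \<noteq> t" "s \<in> {0..}"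
      have S: "X s \<in> S" "Y s \<in> S'" "q s \<in> S" "r s \<in> S'"
        using s X Y t by (auto simp: q_def r_def A.closed B.closed)
      have "(B (X s) (Y s) - B (X t) (Y t)) /\<^sub>R (s - t) = B (q s) (Y s) + B (X t) (r s)"
        unfolding q_def r_def using S t s
        by (simp add: diff_left diff_right scale_left scale_right A.closed B.closed algebra_simps)
      also have "\<dots> - (B X' (Y t) + B (X t) Y')
          = B (q s - X') (Y s) + B X' (Y s - Y t) + B (X t) (r s - Y')"
        using S t X' Y' by (simp add: diff_left diff_right)
      also have "\<bar>\<dots>\<bar> \<le> \<bar>B (q s - X') (Y s)\<bar> + \<bar>B X' (Y s - Y t)\<bar> + \<bar>B (X t) (r s - Y')\<bar>"
        by linarith
      also have "\<dots> \<le> C * (N (q s - X') * N' (Y s)) + C * (N X' * N' (Y s - Y t))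
          + C * (N (X t) * N' (r s - Y'))"
        using S t X' Y' by (intro add_mono bound) (auto simp: A.closed B.closed)
      also have "\<dots> \<le> C * (N (q s - X') * (N' (Y s - Y t) + N' (Y t))) + C * (N X' * N' (Y s - Y t))
          + C * (N (X t) * N' (r s - Y'))"
        using S t X' C_nonneg B.triangle[of "Y s - Y t" "Y t"]
        by (intro add_mono mult_left_mono A.nonneg) (auto simp: A.closed B.closed)
      finally show "norm \<bar>(B (X s) (Y s) - B (X t) (Y t)) /\<^sub>R (s - t) - (B X' (Y t) + B (X t) Y')\<bar>
        \<le> C * (N (q s - X') * (N' (Y s - Y t) + N' (Y t))) + C * (N X' * N' (Y s - Y t))
       + C * (N (X t) * N' (r s - Y'))" by simp
    qed
  qed
qed

end

section \<open>Semi-inner products and $L^2$\<close>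

text \<open>The form may be degenerate: functions that vanish almost everywhere have length zero,
  and in the energy so do constant displacements.\<close>

locale semi_inner_on =
  fixes S :: "'a::real_vector set" and B :: "'a \<Rightarrow> 'a \<Rightarrow> real"
  assumes subspace_S: "subspace S"
    and commute: "x \<in> S \<Longrightarrow> y \<in> S \<Longrightarrow> B x y = B y x"
    and add_left: "x \<in> S \<Longrightarrow> y \<in> S \<Longrightarrow> z \<in> S \<Longrightarrow> B (x + y) z = B x z + B y z"
    and scaleR_left: "x \<in> S \<Longrightarrow> z \<in> S \<Longrightarrow> B (c *\<^sub>R x) z = c * B x z"
    and self_nonneg: "x \<in> S \<Longrightarrow> 0 \<le> B x x"
begin

lemmas closed_S = subspace_add[OF subspace_S] subspace_diff[OF subspace_S]
  subspace_scale[OF subspace_S] subspace_0[OF subspace_S]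

lemma diff_left: "x \<in> S \<Longrightarrow> y \<in> S \<Longrightarrow> z \<in> S \<Longrightarrow> B (x - y) z = B x z - B y z"
  using add_left[of "x - y" y z] by (simp add: closed_S)

lemma add_right: "x \<in> S \<Longrightarrow> y \<in> S \<Longrightarrow> z \<in> S \<Longrightarrow> B z (x + y) = B z x + B z y"
  using add_left commute by (simp add: closed_S)

lemma diff_right: "x \<in> S \<Longrightarrow> y \<in> S \<Longrightarrow> z \<in> S \<Longrightarrow> B z (x - y) = B z x - B z y"
  using diff_left commute by (simp add: closed_S)

lemma scaleR_right: "x \<in> S \<Longrightarrow> z \<in> S \<Longrightarrow> B z (c *\<^sub>R x) = c * B z x"
  using scaleR_left commute by (simp add: closed_S)

lemma Cauchy_Schwarz_square:
  assumes "x \<in> S" "y \<in> S"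
  shows "(B x y)\<^sup>2 \<le> B x x * B y y"
proof -
  have *: "0 \<le> B x x - 2 * t * B x y + t\<^sup>2 * B y y" for t
    using self_nonneg[of "x - t *\<^sub>R y"] assms commute[of x y]
    by (simp add: closed_S diff_left diff_right scaleR_left scaleR_right power2_eq_square algebra_simps)
  show ?thesis
  proof (cases "B y y = 0")
    case True
    have "B x y = 0"
    proof (rule ccontr)
      assume "B x y \<noteq> 0"
      \<comment> \<open>With \<open>B y y = 0\<close> the quadratic is affine in \<open>t\<close>;
        at this \<open>t\<close> its value is -1.\<close>
      then show False
        using *[of "(B x x + 1) / (2 * B x y)"] True by simp
    qed
    then show ?thesis using True by simp
  next
    case False
    then have "B y y > 0" using self_nonneg[OF assms(2)] by simp
    \<comment> \<open>The substituted \<open>t\<close> is the minimiser of the quadratic.\<close>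
    then show ?thesis
      using *[of "B x y / B y y"] by (simp add: field_simps power2_eq_square)
  qed
qed

lemma Cauchy_Schwarz: "x \<in> S \<Longrightarrow> y \<in> S \<Longrightarrow> \<bar>B x y\<bar> \<le> sqrt (B x x) * sqrt (B y y)"
  using real_sqrt_le_mono[OF Cauchy_Schwarz_square[of x y]] by (simp add: real_sqrt_mult)

sublocale seminorm_on S "\<lambda>x. sqrt (B x x)"
proof
  fix x y assume xy: "x \<in> S" "y \<in> S"
  show "sqrt (B (x + y) (x + y)) \<le> sqrt (B x x) + sqrt (B y y)"
  proof (rule real_le_lsqrt)
    have "B (x + y) (x + y) = B x x + 2 * B x y + B y y"
      using xy commute[of x y] by (simp add: closed_S add_left add_right)
    also have "\<dots> \<le> B x x + 2 * (sqrt (B x x) * sqrt (B y y)) + B y y"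
      using Cauchy_Schwarz[OF xy] by simp
    also have "\<dots> = (sqrt (B x x) + sqrt (B y y))\<^sup>2"
      using xy by (simp add: power2_sum self_nonneg)
    finally show "B (x + y) (x + y) \<le> (sqrt (B x x) + sqrt (B y y))\<^sup>2" .
  qed (use xy in \<open>simp add: self_nonneg\<close>)
next
  fix x c assume "x \<in> S"
  then show "sqrt (B (c *\<^sub>R x) (c *\<^sub>R x)) = \<bar>c\<bar> * sqrt (B x x)"
    by (simp add: closed_S scaleR_left scaleR_right real_sqrt_mult flip: power2_eq_square mult.assoc)
qed (use subspace_S in \<open>auto intro: self_nonneg\<close>)

end

lemma scaleR_fun_apply [simp]: "(c *\<^sub>R f) x = c *\<^sub>R f x"
  by (simp add: scaleR_fun_def)

lemma L2_iff:
  "f \<in> L2 L \<longleftrightarrow> f \<in> borel_measurable (lebesgue_on {0<..<L}) \<and>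
     integrable (lebesgue_on {0<..<L}) (\<lambda>x. (f x)\<^sup>2)"
  by (simp add: L2_def)

lemma L2_mult_integrable:
  assumes "f \<in> L2 L" "h \<in> L2 L"
  shows "integrable (lebesgue_on {0<..<L}) (\<lambda>x. f x * h x)"
proof (rule Bochner_Integration.integrable_bound)
  show "integrable (lebesgue_on {0<..<L}) (\<lambda>x. (f x)\<^sup>2 + (h x)\<^sup>2)"
    using assms by (auto simp: L2_iff)
  show "AE x in lebesgue_on {0<..<L}. norm (f x * h x) \<le> norm ((f x)\<^sup>2 + (h x)\<^sup>2)"
  proof (intro AE_I2)
    fix x
    have "0 \<le> (\<bar>f x\<bar> - \<bar>h x\<bar>)\<^sup>2" by simp
    then have "2 * (\<bar>f x\<bar> * \<bar>h x\<bar>) \<le> (f x)\<^sup>2 + (h x)\<^sup>2"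
      by (simp add: power2_diff)
    moreover have "0 \<le> \<bar>f x\<bar> * \<bar>h x\<bar>" by simp
    ultimately have "\<bar>f x\<bar> * \<bar>h x\<bar> \<le> (f x)\<^sup>2 + (h x)\<^sup>2" by linarith
    then show "norm (f x * h x) \<le> norm ((f x)\<^sup>2 + (h x)\<^sup>2)"
      by (simp add: abs_mult)
  qed
qed (use assms in \<open>auto simp: L2_iff\<close>)

lemma L2_subspace: "subspace (L2 L)"
proof (rule subspaceI)
  show "0 \<in> L2 L" by (simp add: L2_iff zero_fun_def)
next
  fix f h assume fh: "f \<in> L2 L" "h \<in> L2 L"
  have "integrable (lebesgue_on {0<..<L}) (\<lambda>x. (f x)\<^sup>2 + 2 * (f x * h x) + (h x)\<^sup>2)"
    using fh L2_mult_integrable[OF fh] by (auto simp: L2_iff)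
  then have "integrable (lebesgue_on {0<..<L}) (\<lambda>x. (f x + h x)\<^sup>2)"
    by (simp add: power2_sum algebra_simps)
  then show "f + h \<in> L2 L" using fh by (auto simp: L2_iff plus_fun_def intro: borel_measurable_add)
next
  fix f c assume "f \<in> L2 L"
  then show "c *\<^sub>R f \<in> L2 L" by (auto simp: L2_iff scaleR_fun_def power_mult_distrib intro: borel_measurable_times)
qed

interpretation L2: semi_inner_on "L2 L" "L2_inner L" for L
proof
  fix f h k :: "real \<Rightarrow> real" and c :: real
  assume f: "f \<in> L2 L"
  show "0 \<le> L2_inner L f f"
    unfolding L2_inner_def by (rule Bochner_Integration.integral_nonneg) simp
  assume h: "h \<in> L2 L"
  show "L2_inner L f h = L2_inner L h f"
    by (simp add: L2_inner_def mult.commute)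
  show "L2_inner L (c *\<^sub>R f) h = c * L2_inner L f h"
    by (simp add: L2_inner_def mult.assoc)
  assume k: "k \<in> L2 L"
  show "L2_inner L (f + h) k = L2_inner L f k + L2_inner L h k"
    using L2_mult_integrable[OF f k] L2_mult_integrable[OF h k]
    by (simp add: L2_inner_def distrib_right)
qed (rule L2_subspace)

text \<open>Meant for the weight \<open>x + 1\<close>, which is bounded on the interval only; hence
  the local hypothesis on \<open>m\<close>.\<close>

lemma L2_bounded_mult:
  assumes "f \<in> L2 L" "m \<in> borel_measurable (lebesgue_on {0<..<L})"
    and "\<And>x. 0 < x \<Longrightarrow> x < L \<Longrightarrow> \<bar>m x\<bar> \<le> C" "0 \<le> C"
  shows "(\<lambda>x. m x * f x) \<in> L2 L"
    "L2_inner L (\<lambda>x. m x * f x) (\<lambda>x. m x * f x) \<le> C\<^sup>2 * L2_inner L f f"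
proof -
  have le: "(m x * f x)\<^sup>2 \<le> C\<^sup>2 * (f x)\<^sup>2" if "0 < x" "x < L" for x
    using assms(3)[OF that] assms(4)
    by (auto simp: power_mult_distrib abs_le_square_iff[symmetric] intro!: mult_right_mono)
  have int: "integrable (lebesgue_on {0<..<L}) (\<lambda>x. (m x * f x)\<^sup>2)"
    by (rule Bochner_Integration.integrable_bound[where f="\<lambda>x. C\<^sup>2 * (f x)\<^sup>2"])
       (use assms le in \<open>auto simp: L2_iff intro!: AE_I2\<close>)
  then show "(\<lambda>x. m x * f x) \<in> L2 L"
    using assms by (auto simp: L2_iff)
  have "L2_inner L (\<lambda>x. m x * f x) (\<lambda>x. m x * f x) = (LINT x|lebesgue_on {0<..<L}. (m x * f x)\<^sup>2)"
    by (simp add: L2_inner_def power2_eq_square)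
  also have "\<dots> \<le> (LINT x|lebesgue_on {0<..<L}. C\<^sup>2 * (f x)\<^sup>2)"
    using assms int le by (intro integral_mono_AE) (auto simp: L2_iff intro!: AE_I2)
  also have "\<dots> = C\<^sup>2 * L2_inner L f f"
    by (simp add: L2_inner_def power2_eq_square)
  finally show "L2_inner L (\<lambda>x. m x * f x) (\<lambda>x. m x * f x) \<le> C\<^sup>2 * L2_inner L f f" .
qed

text \<open>The bridge between the two integrals: the definitions use the Lebesgue integral on the
  open interval, while the fundamental theorem and additivity over adjacent intervals are used for
  the gauge integral on the closed one.\<close>

lemma integrable_Ioo_absolutely_integrable:
  fixes f :: "real \<Rightarrow> real"
  shows "integrable (lebesgue_on {a<..<b}) f \<longleftrightarrow> f absolutely_integrable_on {a..b}"
  unfolding absolutely_integrable_on_Icc_iff_Ioo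
  by (simp add: set_integrable_def integrable_restrict_space)

lemma continuous_on_L2:
  fixes f :: "real \<Rightarrow> real"
  assumes "continuous_on {0..L} f"
  shows "f \<in> L2 L"
proof -
  have "(\<lambda>x. (f x)\<^sup>2) absolutely_integrable_on {0..L}" "f absolutely_integrable_on {0..L}"
    using assms by (intro absolutely_integrable_continuous_real continuous_intros; simp)+
  then show ?thesis
    unfolding L2_iff using integrable_Ioo_absolutely_integrable borel_measurable_integrable by blast
qed

lemma L2_integrable: "f \<in> L2 L \<Longrightarrow> integrable (lebesgue_on {0<..<L}) f"
  using L2_mult_integrable[OF _ continuous_on_L2[of _ "\<lambda>x. 1"]] by simp

lemma integral_Ioo_eq:
  fixes f :: "real \<Rightarrow> real"
  assumes "integrable (lebesgue_on {a<..<b}) f"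
  shows "(LINT x|lebesgue_on {a<..<b}. f x) = integral {a..b} f"
  using lebesgue_integral_eq_integral[OF assms] by (simp add: integral_open_interval_real)

lemma L2_inner_eq_integral:
  "f \<in> L2 L \<Longrightarrow> h \<in> L2 L \<Longrightarrow> L2_inner L f h = integral {0..L} (\<lambda>x. f x * h x)"
  unfolding L2_inner_def by (intro integral_Ioo_eq L2_mult_integrable)

lemma L2_absolutely_integrable: "f \<in> L2 L \<Longrightarrow> f absolutely_integrable_on {0..L}"
  using L2_integrable integrable_Ioo_absolutely_integrable by blast

lemma L2_mult_absolutely_integrable:
  "f \<in> L2 L \<Longrightarrow> h \<in> L2 L \<Longrightarrow> (\<lambda>x. f x * h x) absolutely_integrable_on {0..L}"
  using L2_mult_integrable integrable_Ioo_absolutely_integrable by blast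

text \<open>Lets identities for \<open>Dx\<close>, which hold only almost everywhere, be used inside
  scalar products.\<close>

lemma L2_inner_cong_AE:
  assumes "f \<in> L2 L" "f' \<in> L2 L" "h \<in> L2 L" "AE x in lebesgue_on {0<..<L}. f x = f' x"
  shows "L2_inner L f h = L2_inner L f' h"
  unfolding L2_inner_def
  by (intro integral_cong_AE) (use assms in \<open>auto simp: L2_iff elim: eventually_mono\<close>)

section \<open>Weak derivatives on an interval\<close>

text \<open>Absolute continuity of \<open>f\<close> on \<open>[0, L]\<close> with density
  \<open>w\<close>, in integral form: changing \<open>w\<close> on a null set makes no
  difference.\<close>

definition primitive :: "real \<Rightarrow> (real \<Rightarrow> real) \<Rightarrow> (real \<Rightarrow> real) \<Rightarrow> bool" where
  "primitive L f w \<longleftrightarrow>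
     w absolutely_integrable_on {0..L} \<and> (\<forall>x\<in>{0..L}. f x - f 0 = integral {0..x} w)"

lemma primitive_diff:
  assumes "primitive L f w" "0 \<le> x" "x \<le> y" "y \<le> L"
  shows "f y - f x = integral {x..y} w"
proof -
  have "w integrable_on {0..L}"
    using assms by (auto simp: primitive_def absolutely_integrable_on_def)
  then have "w integrable_on {0..y}"
    using assms by (auto intro: integrable_on_subinterval)
  then have "integral {0..x} w + integral {x..y} w = integral {0..y} w"
    using assms by (intro Henstock_Kurzweil_Integration.integral_combine) auto
  moreover have "f x - f 0 = integral {0..x} w" "f y - f 0 = integral {0..y} w"
    using assms by (auto simp: primitive_def)
  ultimately show ?thesis by simp
qed

lemma primitive_continuous:
  assumes "primitive L f w"
  shows "continuous_on {0..L} f"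
proof -
  have "continuous_on {0..L} (\<lambda>x. f 0 + integral {0..x} w)"
    using assms by (intro continuous_intros indefinite_integral_continuous_1)
      (auto simp: primitive_def absolutely_integrable_on_def)
  then show ?thesis
  proof (rule continuous_on_eq)
    fix x assume "x \<in> {0..L}"
    then have "f x - f 0 = integral {0..x} w" using assms by (simp add: primitive_def)
    then show "f 0 + integral {0..x} w = f x" by linarith
  qed
qed

lemma primitive_C1:
  assumes "\<And>x. (f has_real_derivative f' x) (at x)" "continuous_on {0..L} f'"
  shows "primitive L f f'"
  unfolding primitive_def
proof (intro conjI ballI)
  fix x assume "x \<in> {0..L}"
  then have "(f' has_integral f x - f 0) {0..x}"
    using assms by (intro fundamental_theorem_of_calculus)
      (auto simp flip: has_real_derivative_iff_has_vector_derivative intro: DERIV_subset)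
  then show "f x - f 0 = integral {0..x} f'" by (simp add: integral_unique)
qed (use assms in \<open>auto intro: absolutely_integrable_continuous_real\<close>)

lemma absolutely_integrable_continuous_mult:
  fixes f g :: "real \<Rightarrow> real"
  assumes "continuous_on {a..b} f" "g absolutely_integrable_on {a..b}"
  shows "(\<lambda>x. f x * g x) absolutely_integrable_on {a..b}"
proof (rule absolutely_integrable_bounded_measurable_product_real)
  show "f \<in> borel_measurable (lebesgue_on {a..b})"
    using assms(1) by (intro continuous_imp_measurable_on_sets_lebesgue) auto
  show "bounded (f ` {a..b})"
    using assms(1) by (intro compact_imp_bounded compact_continuous_image) auto
qed (use assms in auto)

text \<open>On a short interval \<open>[c, d]\<close> the error in the product formula is
  \<open>\<integral> w (h d - h) + q (f c - f)\<close>, hence at most \<open>\<epsilon> \<integral> \<bar>w\<bar> + \<bar>q\<bar>\<close>; this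
  bound is additive in the interval.\<close>

lemma primitive_mult:
  assumes f: "primitive L f w" and h: "primitive L h q"
  shows "primitive L (\<lambda>x. f x * h x) (\<lambda>x. w x * h x + f x * q x)"
proof -
  have cf: "continuous_on {0..L} f" and ch: "continuous_on {0..L} h"
    using f h primitive_continuous by auto
  have w: "w absolutely_integrable_on {0..L}" and q: "q absolutely_integrable_on {0..L}"
    using f h by (auto simp: primitive_def)
  have wh: "(\<lambda>x. w x * h x) absolutely_integrable_on {0..L}"
    using absolutely_integrable_continuous_mult[OF ch w] by (simp add: mult.commute)
  have fq: "(\<lambda>x. f x * q x) absolutely_integrable_on {0..L}"
    using absolutely_integrable_continuous_mult[OF cf q] .
  have *: "f b * h b - f 0 * h 0 = integral {0..b} (\<lambda>x. w x * h x + f x * q x)" if b: "0 \<le> b" "b \<le> L" for b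
  proof -
    define K where "K = integral {0..b} (\<lambda>x. \<bar>w x\<bar> + \<bar>q x\<bar>)"
    have int: "(\<lambda>x. \<bar>w x\<bar>) integrable_on {c..d}" "(\<lambda>x. \<bar>q x\<bar>) integrable_on {c..d}"
      "w integrable_on {c..d}" "q integrable_on {c..d}"
      "(\<lambda>x. w x * h x) integrable_on {c..d}" "(\<lambda>x. f x * q x) integrable_on {c..d}"
      if "0 \<le> c" "d \<le> b" for c d
      using w q wh fq that b unfolding absolutely_integrable_on_def
      by (auto intro: integrable_on_subinterval)
    define P where "P \<epsilon> c d \<longleftrightarrow> (0 \<le> c \<longrightarrow> d \<le> b \<longrightarrow>
       \<bar>f d * h d - f c * h c - integral {c..d} (\<lambda>x. w x * h x + f x * q x)\<bar>
         \<le> \<epsilon> * integral {c..d} (\<lambda>x. \<bar>w x\<bar> + \<bar>q x\<bar>))" for \<epsilon> c d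
    have P: "P \<epsilon> 0 b" if "\<epsilon> > 0" for \<epsilon>
    proof (rule Bolzano[OF b(1)])
      fix x y z assume "P \<epsilon> x y" "P \<epsilon> y z" and le: "x \<le> y" "y \<le> z"
      show "P \<epsilon> x z" unfolding P_def
      proof (intro impI)
        assume x: "0 \<le> x" and z: "z \<le> b"
        have 1: "\<bar>f y * h y - f x * h x - integral {x..y} (\<lambda>x. w x * h x + f x * q x)\<bar>
           \<le> \<epsilon> * integral {x..y} (\<lambda>x. \<bar>w x\<bar> + \<bar>q x\<bar>)"
          "\<bar>f z * h z - f y * h y - integral {y..z} (\<lambda>x. w x * h x + f x * q x)\<bar>
           \<le> \<epsilon> * integral {y..z} (\<lambda>x. \<bar>w x\<bar> + \<bar>q x\<bar>)"
          using \<open>P \<epsilon> x y\<close> \<open>P \<epsilon> y z\<close> le x z by (auto simp: P_def)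
        have "(\<lambda>x. w x * h x + f x * q x) integrable_on {x..z}"
          "(\<lambda>x. \<bar>w x\<bar> + \<bar>q x\<bar>) integrable_on {x..z}"
          using int[OF x z] by (auto intro: integrable_add)
        then have 2: "integral {x..z} (\<lambda>x. w x * h x + f x * q x)
            = integral {x..y} (\<lambda>x. w x * h x + f x * q x) + integral {y..z} (\<lambda>x. w x * h x + f x * q x)"
          "integral {x..z} (\<lambda>x. \<bar>w x\<bar> + \<bar>q x\<bar>)
            = integral {x..y} (\<lambda>x. \<bar>w x\<bar> + \<bar>q x\<bar>) + integral {y..z} (\<lambda>x. \<bar>w x\<bar> + \<bar>q x\<bar>)"
          using le by (simp_all add: Henstock_Kurzweil_Integration.integral_combine)
        show "\<bar>f z * h z - f x * h x - integral {x..z} (\<lambda>x. w x * h x + f x * q x)\<bar>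
         \<le> \<epsilon> * integral {x..z} (\<lambda>x. \<bar>w x\<bar> + \<bar>q x\<bar>)"
          unfolding 2 distrib_left using 1 by linarith
      qed
    next
      fix x assume x: "0 \<le> x" "x \<le> b"
      have "continuous (at x within {0..L}) f" "continuous (at x within {0..L}) h"
        using cf ch x b by (auto simp: continuous_on_eq_continuous_within)
      then obtain d1 d2 where d: "d1 > 0" "d2 > 0"
        "\<And>y. y \<in> {0..L} \<Longrightarrow> \<bar>y - x\<bar> < d1 \<Longrightarrow> \<bar>f y - f x\<bar> < \<epsilon> / 2"
        "\<And>y. y \<in> {0..L} \<Longrightarrow> \<bar>y - x\<bar> < d2 \<Longrightarrow> \<bar>h y - h x\<bar> < \<epsilon> / 2"
        using half_gt_zero[OF \<open>\<epsilon> > 0\<close>] unfolding continuous_within_eps_delta dist_real_def by metis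
      show "\<exists>d>0. \<forall>a b. a \<le> x \<and> x \<le> b \<and> b - a < d \<longrightarrow> P \<epsilon> a b"
      proof (intro exI[of _ "min d1 d2"] conjI allI impI)
        fix c e assume ce: "c \<le> x \<and> x \<le> e \<and> e - c < min d1 d2"
        show "P \<epsilon> c e" unfolding P_def
        proof (intro impI)
          assume c: "0 \<le> c" and e: "e \<le> b"
          have near: "\<bar>f s - f t\<bar> \<le> \<epsilon>" "\<bar>h s - h t\<bar> \<le> \<epsilon>" if "s \<in> {c..e}" "t \<in> {c..e}" for s t
          proof -
            have "s \<in> {0..L}" "t \<in> {0..L}" "\<bar>s - x\<bar> < min d1 d2" "\<bar>t - x\<bar> < min d1 d2"
              using that ce c e b by (auto simp: abs_less_iff)
            then have "\<bar>f s - f x\<bar> < \<epsilon> / 2" "\<bar>f t - f x\<bar> < \<epsilon> / 2"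
              "\<bar>h s - h x\<bar> < \<epsilon> / 2" "\<bar>h t - h x\<bar> < \<epsilon> / 2"
              using d(3,4) by auto
            then show "\<bar>f s - f t\<bar> \<le> \<epsilon>" "\<bar>h s - h t\<bar> \<le> \<epsilon>" by linarith+
          qed
          note i = int[OF c e]
          have wI: "f e - f c = integral {c..e} w" "h e - h c = integral {c..e} q"
            using primitive_diff[OF f, of c e] primitive_diff[OF h, of c e] c e ce b by auto
          have "f e * h e - f c * h c = integral {c..e} w * h e + f c * integral {c..e} q"
            unfolding wI[symmetric] by (simp add: algebra_simps)
          also have "\<dots> = integral {c..e} (\<lambda>x. w x * h e + f c * q x)"
            using i by (subst Henstock_Kurzweil_Integration.integral_add)
              (auto intro: integrable_on_mult_left integrable_on_mult_right)
          finally have e1: "f e * h e - f c * h c = integral {c..e} (\<lambda>x. w x * h e + f c * q x)" .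
          have e2: "integral {c..e} (\<lambda>x. w x * h e + f c * q x) - integral {c..e} (\<lambda>x. w x * h x + f x * q x)
              = integral {c..e} (\<lambda>x. w x * (h e - h x) + (f c - f x) * q x)"
            using i by (subst Henstock_Kurzweil_Integration.integral_diff[symmetric])
              (auto intro!: integrable_add integrable_on_mult_left integrable_on_mult_right
                Henstock_Kurzweil_Integration.integral_cong simp: algebra_simps)
          have eq: "f e * h e - f c * h c - integral {c..e} (\<lambda>x. w x * h x + f x * q x)
              = integral {c..e} (\<lambda>x. w x * (h e - h x) + (f c - f x) * q x)"
            unfolding e1 by (rule e2)
          have "norm (integral {c..e} (\<lambda>x. w x * (h e - h x) + (f c - f x) * q x))
              \<le> integral {c..e} (\<lambda>x. \<epsilon> * (\<bar>w x\<bar> + \<bar>q x\<bar>))"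
          proof (rule Henstock_Kurzweil_Integration.integral_norm_bound_integral)
            have "(\<lambda>x. w x * h e + f c * q x - (w x * h x + f x * q x)) integrable_on {c..e}"
              using i by (intro integrable_diff integrable_add integrable_on_mult_left
                  integrable_on_mult_right) auto
            then show "(\<lambda>x. w x * (h e - h x) + (f c - f x) * q x) integrable_on {c..e}"
              by (simp add: algebra_simps)
            show "(\<lambda>x. \<epsilon> * (\<bar>w x\<bar> + \<bar>q x\<bar>)) integrable_on {c..e}"
              using i by (intro integrable_on_mult_right integrable_add) auto
            fix s assume s: "s \<in> {c..e}"
            have "norm (w s * (h e - h s) + (f c - f s) * q s)
                \<le> \<bar>w s\<bar> * \<bar>h e - h s\<bar> + \<bar>f c - f s\<bar> * \<bar>q s\<bar>"
              by (simp flip: abs_mult)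
            also have "\<dots> \<le> \<bar>w s\<bar> * \<epsilon> + \<epsilon> * \<bar>q s\<bar>"
              using near s ce by (intro add_mono mult_left_mono mult_right_mono) auto
            finally show "norm (w s * (h e - h s) + (f c - f s) * q s) \<le> \<epsilon> * (\<bar>w s\<bar> + \<bar>q s\<bar>)"
              by (simp add: algebra_simps)
          qed
          then show "\<bar>f e * h e - f c * h c - integral {c..e} (\<lambda>x. w x * h x + f x * q x)\<bar>
             \<le> \<epsilon> * integral {c..e} (\<lambda>x. \<bar>w x\<bar> + \<bar>q x\<bar>)"
            unfolding eq by simp
        qed
      qed (use d in auto)
    qed
    have "K \<ge> 0"
      unfolding K_def using int[of 0 b] by (intro Henstock_Kurzweil_Integration.integral_nonneg) (auto intro: integrable_add)
    have "\<bar>f b * h b - f 0 * h 0 - integral {0..b} (\<lambda>x. w x * h x + f x * q x)\<bar> \<le> 0"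
    proof (rule field_le_epsilon)
      fix e :: real assume "e > 0"
      \<comment> \<open>Dividing by \<open>K + 1\<close> rather than \<open>K\<close> covers
        \<open>K = 0\<close>.\<close>
      have "\<bar>f b * h b - f 0 * h 0 - integral {0..b} (\<lambda>x. w x * h x + f x * q x)\<bar> \<le> e / (K + 1) * K"
        using P[of "e / (K + 1)"] \<open>e > 0\<close> \<open>K \<ge> 0\<close> by (simp add: P_def K_def)
      also have "\<dots> \<le> e" using \<open>e > 0\<close> \<open>K \<ge> 0\<close> by (simp add: field_simps)
      finally show "\<bar>f b * h b - f 0 * h 0 - integral {0..b} (\<lambda>x. w x * h x + f x * q x)\<bar> \<le> 0 + e"
        by simp
    qed
    then show ?thesis by simp
  qed
  show ?thesis
    unfolding primitive_def
  proof (intro conjI ballI)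
    show "(\<lambda>x. w x * h x + f x * q x) absolutely_integrable_on {0..L}"
      using wh fq by (rule set_integral_add)
  qed (use * in force)
qed

text \<open>The difference of the densities has zero integral over every interval, so all its means
  vanish; by Lebesgue differentiation it vanishes almost everywhere.\<close>

lemma primitive_unique_AE:
  assumes "primitive L f w" "primitive L f w'"
  shows "AE x in lebesgue_on {0<..<L}. w x = w' x"
proof -
  \<comment> \<open>Extended by zero, because the differentiation theorem is applied on the whole
    line.\<close>
  define v where "v = (\<lambda>x. if x \<in> {0..L} then w x - w' x else 0)"
  have wi: "w integrable_on {a..b}" "w' integrable_on {a..b}" if "0 \<le> a" "b \<le> L" for a b
    using assms that unfolding primitive_def absolutely_integrable_on_def
    by (auto intro: integrable_on_subinterval)
  have v0: "(v has_integral 0) {a..b}" for a b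
  proof -
    have "((\<lambda>x. w x - w' x) has_integral 0) ({0..L} \<inter> {a..b})"
    proof (cases "max 0 a \<le> min L b")
      case True
      have eq: "{0..L} \<inter> {a..b} = {max 0 a..min L b}" by auto
      have "integral {max 0 a..min L b} w = integral {max 0 a..min L b} w'"
        using primitive_diff[OF assms(1), of "max 0 a" "min L b"]
          primitive_diff[OF assms(2), of "max 0 a" "min L b"] True by auto
      then show ?thesis
        unfolding eq
        using has_integral_diff[OF wi[of "max 0 a" "min L b", THEN integrable_integral]] by simp
    next
      case False
      then have "{0..L} \<inter> {a..b} = {}" by auto
      then show ?thesis by simp
    qed
    then show ?thesis
      unfolding v_def by (subst has_integral_restrict_Int)
  qed
  obtain N where N: "negligible N" "\<And>x e. \<lbrakk>x \<notin> N; 0 < e\<rbrakk> \<Longrightarrow> \<exists>d>0. \<forall>h. 0 < h \<and> h < d \<longrightarrow>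
       norm (integral (cbox x (x + h *\<^sub>R One)) v /\<^sub>R h ^ DIM(real) - v x) < e"
    using integrable_ccontinuous_explicit[of v] v0 by (metis box_real(2) has_integral_integrable)
  have "v x = 0" if x: "x \<notin> N" for x
  proof (rule ccontr)
    assume "v x \<noteq> 0"
    then obtain d where d: "d > 0" "\<And>h. 0 < h \<Longrightarrow> h < d \<Longrightarrow>
       norm (integral (cbox x (x + h *\<^sub>R One)) v /\<^sub>R h ^ DIM(real) - v x) < \<bar>v x\<bar>"
      using N(2)[OF x, of "\<bar>v x\<bar>"] by auto
    show False using d(2)[of "d / 2"] d(1) integral_unique[OF v0] by simp
  qed
  then have "AE x in lebesgue. v x = 0"
    using N(1) by (intro AE_I'[of N]) (auto simp: negligible_iff_null_sets)
  then show ?thesis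
    by (subst AE_restrict_space_iff) (auto simp: v_def elim: eventually_mono)
qed

section \<open>Tent functions and the equivalence of weak derivative and density\<close>

text \<open>The hat of height \<delta> over \<open>[-\<delta>, \<delta>]\<close>. As a second
  difference of \<open>max 0 s\<close> it has an explicit antiderivative.\<close>

definition tent :: "real \<Rightarrow> real \<Rightarrow> real" where
  "tent \<delta> s = max 0 (s + \<delta>) - 2 * max 0 s + max 0 (s - \<delta>)"

definition tent_primitive :: "real \<Rightarrow> real \<Rightarrow> real" where
  "tent_primitive \<delta> s = ((max 0 (s + \<delta>))\<^sup>2 - 2 * (max 0 s)\<^sup>2 + (max 0 (s - \<delta>))\<^sup>2) / 2"

lemma tent_nonneg: "\<delta> > 0 \<Longrightarrow> 0 \<le> tent \<delta> s"
  by (auto simp: tent_def max_def)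

lemma tent_eq_0: "\<delta> > 0 \<Longrightarrow> \<bar>s\<bar> \<ge> \<delta> \<Longrightarrow> tent \<delta> s = 0"
  by (auto simp: tent_def max_def)

lemma tent_primitive_left: "\<delta> > 0 \<Longrightarrow> s \<le> - \<delta> \<Longrightarrow> tent_primitive \<delta> s = 0"
  by (auto simp: tent_primitive_def max_def)

lemma tent_primitive_right: "\<delta> > 0 \<Longrightarrow> s \<ge> \<delta> \<Longrightarrow> tent_primitive \<delta> s = \<delta>\<^sup>2"
  by (auto simp: tent_primitive_def max_def power2_eq_square algebra_simps)

text \<open>Squaring removes the kink at 0, where the difference quotient is at most
  \<open>\<bar>h\<bar>\<close>. This is why \<open>tent_primitive\<close> is continuously
  differentiable, as a test function has to be.\<close>

lemma max_square_deriv: "((\<lambda>s. (max 0 s)\<^sup>2) has_real_derivative 2 * max 0 s) (at (s :: real))"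
proof -
  consider "s > 0" | "s < 0" | "s = 0" by linarith
  then show ?thesis
  proof cases
    case 1
    have "((\<lambda>s. s\<^sup>2) has_real_derivative 2 * max 0 s) (at s)"
      using 1 by (auto intro!: derivative_eq_intros)
    moreover have "\<forall>\<^sub>F x in nhds s. x\<^sup>2 = (max 0 x)\<^sup>2"
      using 1 eventually_nhds_in_open[of "{0<..}" s] by (auto elim!: eventually_mono)
    ultimately show ?thesis by (subst DERIV_cong_ev[OF refl _ refl, of _ "\<lambda>s. s\<^sup>2"]) (auto elim: eventually_mono)
  next
    case 2
    have "((\<lambda>s. 0) has_real_derivative 2 * max 0 s) (at s)"
      using 2 by (auto intro!: derivative_eq_intros)
    moreover have "\<forall>\<^sub>F x in nhds s. 0 = (max 0 x)\<^sup>2"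
      using 2 eventually_nhds_in_open[of "{..<0}" s] by (auto elim!: eventually_mono)
    ultimately show ?thesis by (subst DERIV_cong_ev[OF refl _ refl, of _ "\<lambda>s. 0"]) (auto elim: eventually_mono)
  next
    case 3
    have "((\<lambda>h::real. (max 0 h)\<^sup>2 / h) \<longlongrightarrow> 0) (at 0)"
    proof (rule Lim_null_comparison)
      show "\<forall>\<^sub>F h in at 0. norm ((max 0 h)\<^sup>2 / h) \<le> \<bar>h\<bar>"
        by (intro always_eventually) (auto simp: max_def power2_eq_square)
      show "((\<lambda>h::real. \<bar>h\<bar>) \<longlongrightarrow> 0) (at 0)" by (intro tendsto_eq_intros) auto
    qed
    then show ?thesis using 3 by (simp add: DERIV_def)
  qed
qed

lemma tent_primitive_deriv: "(tent_primitive \<delta> has_real_derivative tent \<delta> s) (at s)"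
  unfolding tent_primitive_def tent_def
  by (rule derivative_eq_intros refl DERIV_chain2[OF max_square_deriv] | simp)+

lemma has_integral_tent:
  assumes "\<delta> > 0" "\<delta> \<le> x" "x + \<delta> \<le> L"
  shows "((\<lambda>s. tent \<delta> (s - x)) has_integral \<delta>\<^sup>2) {0..L}"
proof -
  have "((\<lambda>s. tent \<delta> (s - x)) has_integral
      tent_primitive \<delta> (L - x) - tent_primitive \<delta> (0 - x)) {0..L}"
  proof (rule fundamental_theorem_of_calculus)
    fix s
    have "((\<lambda>s. tent_primitive \<delta> (s - x)) has_real_derivative tent \<delta> (s - x) * 1) (at s)"
      by (rule DERIV_chain2[OF tent_primitive_deriv]) (auto intro!: derivative_eq_intros)
    then show "((\<lambda>s. tent_primitive \<delta> (s - x)) has_vector_derivative tent \<delta> (s - x)) (at s within {0..L})"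
      by (simp add: has_real_derivative_iff_has_vector_derivative has_vector_derivative_at_within)
  qed (use assms in auto)
  then show ?thesis
    using assms by (simp add: tent_primitive_left tent_primitive_right)
qed

text \<open>One primitive alone has no compact support, since it stays at
  \<open>\<delta>\<^sup>2\<close> on the right; subtracting a translate cancels this
  plateau.\<close>

lemma test_fun_tent:
  assumes "\<delta> > 0" "\<delta> < x" "x + \<delta> < L" "\<delta> < y" "y + \<delta> < L"
  shows "test_fun L (\<lambda>s. tent_primitive \<delta> (s - x) - tent_primitive \<delta> (s - y))
     (\<lambda>s. tent \<delta> (s - x) - tent \<delta> (s - y))"
  unfolding test_fun_def
proof (intro conjI allI exI impI)
  fix s
  have "((\<lambda>s. tent_primitive \<delta> (s - z)) has_real_derivative tent \<delta> (s - z) * 1) (at s)" for z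
    by (rule DERIV_chain2[OF tent_primitive_deriv]) (auto intro!: derivative_eq_intros)
  from DERIV_diff[OF this[of x] this[of y]]
  show "((\<lambda>s. tent_primitive \<delta> (s - x) - tent_primitive \<delta> (s - y)) has_real_derivative
     tent \<delta> (s - x) - tent \<delta> (s - y)) (at s)" by simp
  show "0 < min x y - \<delta>" "max x y + \<delta> < L" using assms by auto
  show "tent_primitive \<delta> (s - x) - tent_primitive \<delta> (s - y) = 0"
    if "s \<notin> {min x y - \<delta>..max x y + \<delta>}"
  proof (cases "s < min x y - \<delta>")
    case True then show ?thesis using assms by (simp add: tent_primitive_left)
  next
    case False
    then have "s - x \<ge> \<delta>" "s - y \<ge> \<delta>" using that by auto
    then show ?thesis using assms by (simp add: tent_primitive_right)
  qed
  show "continuous_on UNIV (\<lambda>s. tent \<delta> (s - x) - tent \<delta> (s - y))"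
    unfolding tent_def by (intro continuous_intros)
qed

text \<open>The tents have mass \<open>\<delta>\<^sup>2\<close> and shrinking support, so after
  division by the mass they act as an approximate identity on continuous functions.\<close>

lemma integral_tent_approx:
  assumes k: "continuous_on {0..L} k" and "\<delta> > 0" "\<delta> \<le> x" "x + \<delta> \<le> L"
    and near: "\<And>s. \<bar>s - x\<bar> < \<delta> \<Longrightarrow> \<bar>k s - k x\<bar> \<le> \<epsilon>"
  shows "\<bar>integral {0..L} (\<lambda>s. k s * tent \<delta> (s - x)) - k x * \<delta>\<^sup>2\<bar> \<le> \<epsilon> * \<delta>\<^sup>2"
proof -
  note T = has_integral_tent[OF assms(2-4)]
  have c: "continuous_on {0..L} (\<lambda>s. tent \<delta> (s - x))"
    unfolding tent_def by (intro continuous_intros)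
  have "integral {0..L} (\<lambda>s. k s * tent \<delta> (s - x)) - k x * \<delta>\<^sup>2
      = integral {0..L} (\<lambda>s. k s * tent \<delta> (s - x) - k x * tent \<delta> (s - x))"
    using integral_unique[OF T] k c
    by (subst Henstock_Kurzweil_Integration.integral_diff)
       (auto simp: integral_unique has_integral_integrable intro!: integrable_continuous_interval continuous_intros)
  also have "norm \<dots> \<le> integral {0..L} (\<lambda>s. \<epsilon> * tent \<delta> (s - x))"
  proof (rule Henstock_Kurzweil_Integration.integral_norm_bound_integral)
    show "(\<lambda>s. k s * tent \<delta> (s - x) - k x * tent \<delta> (s - x)) integrable_on {0..L}"
      "(\<lambda>s. \<epsilon> * tent \<delta> (s - x)) integrable_on {0..L}"
      using k c by (auto intro!: integrable_continuous_interval continuous_intros)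
    fix s
    have "norm (k s * tent \<delta> (s - x) - k x * tent \<delta> (s - x)) = \<bar>k s - k x\<bar> * tent \<delta> (s - x)"
      using tent_nonneg[OF \<open>\<delta> > 0\<close>, of "s - x"] by (simp add: abs_mult flip: left_diff_distrib)
    also have "\<dots> \<le> \<epsilon> * tent \<delta> (s - x)"
      using near tent_nonneg[OF \<open>\<delta> > 0\<close>] tent_eq_0[OF \<open>\<delta> > 0\<close>, of "s - x"]
      by (cases "\<bar>s - x\<bar> < \<delta>") (auto intro!: mult_right_mono)
    finally show "norm (k s * tent \<delta> (s - x) - k x * tent \<delta> (s - x)) \<le> \<epsilon> * tent \<delta> (s - x)" .
  qed
  also have "\<dots> = \<epsilon> * \<delta>\<^sup>2" using integral_unique[OF T] by simp
  finally show ?thesis by simp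
qed

text \<open>Du Bois-Reymond: \<open>u - \<integral> w\<close> integrates to zero against differences of translated
  tents, so it takes the same value at any two interior points.\<close>

lemma weak_deriv_primitive:
  assumes "L > 0" and u: "continuous_on {0..L} u" and w: "w \<in> L2 L" and wd: "weak_deriv L u w"
  shows "primitive L u w"
proof -
  define U where "U x = integral {0..x} w" for x
  define k where "k x = u x - U x" for x
  have wa: "w absolutely_integrable_on {0..L}" using w by (rule L2_absolutely_integrable)
  have U: "primitive L U w" using wa by (simp add: primitive_def U_def)
  have cU: "continuous_on {0..L} U" using U by (rule primitive_continuous)
  have ck: "continuous_on {0..L} k" unfolding k_def using u cU by (intro continuous_intros)
  \<comment> \<open>Both \<open>u\<close> and \<open>U\<close> have weak derivative
    \<open>w\<close>: for \<open>U\<close> this is the product formula for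
    \<open>U * \<phi>\<close>, whose boundary values vanish.\<close>
  have test: "integral {0..L} (\<lambda>x. k x * \<phi>' x) = 0" if t: "test_fun L \<phi> \<phi>'" for \<phi> \<phi>'
  proof -
    have cp': "continuous_on {0..L} \<phi>'" and d: "\<And>x. (\<phi> has_real_derivative \<phi>' x) (at x)"
      using t by (auto simp: test_fun_def intro: continuous_on_subset)
    have cp: "continuous_on {0..L} \<phi>"
      using d by (meson DERIV_continuous_on has_field_derivative_at_within)
    have p0: "\<phi> 0 = 0" "\<phi> L = 0" using t by (auto simp: test_fun_def)
    have "primitive L (\<lambda>x. U x * \<phi> x) (\<lambda>x. w x * \<phi> x + U x * \<phi>' x)"
      using U primitive_C1[OF d cp'] by (rule primitive_mult)
    from primitive_diff[OF this, of 0 L]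
    have "0 = integral {0..L} (\<lambda>x. w x * \<phi> x + U x * \<phi>' x)"
      using p0 \<open>L > 0\<close> by simp
    also have "\<dots> = integral {0..L} (\<lambda>x. w x * \<phi> x) + integral {0..L} (\<lambda>x. U x * \<phi>' x)"
      using absolutely_integrable_continuous_mult[OF cp wa] cU cp'
      by (intro Henstock_Kurzweil_Integration.integral_add)
         (auto simp: absolutely_integrable_on_def mult.commute intro!: integrable_continuous_interval continuous_intros)
    also have "integral {0..L} (\<lambda>x. w x * \<phi> x) = - integral {0..L} (\<lambda>x. u x * \<phi>' x)"
    proof -
      have "L2_inner L u \<phi>' = - L2_inner L w \<phi>" using wd t unfolding weak_deriv_def by blast
      then show ?thesis using u w cp cp' by (simp add: L2_inner_eq_integral continuous_on_L2)
    qed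
    finally have "integral {0..L} (\<lambda>x. u x * \<phi>' x) - integral {0..L} (\<lambda>x. U x * \<phi>' x) = 0"
      by simp
    then show ?thesis
      using u cU cp' by (subst (asm) Henstock_Kurzweil_Integration.integral_diff[symmetric])
        (auto simp: k_def left_diff_distrib intro!: integrable_continuous_interval continuous_intros)
  qed
  have eq: "k x = k y" if x: "0 < x" "x < L" and y: "0 < y" "y < L" for x y
  proof -
    have "\<bar>k x - k y\<bar> \<le> 0"
    proof (rule field_le_epsilon)
      fix e :: real assume "e > 0"
      have "continuous (at x within {0..L}) k" "continuous (at y within {0..L}) k"
        using ck x y by (auto simp: continuous_on_eq_continuous_within)
      then obtain d1 d2 where d: "d1 > 0" "d2 > 0"
        "\<And>s. s \<in> {0..L} \<Longrightarrow> \<bar>s - x\<bar> < d1 \<Longrightarrow> \<bar>k s - k x\<bar> < e / 2"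
        "\<And>s. s \<in> {0..L} \<Longrightarrow> \<bar>s - y\<bar> < d2 \<Longrightarrow> \<bar>k s - k y\<bar> < e / 2"
        using half_gt_zero[OF \<open>e > 0\<close>] unfolding continuous_within_eps_delta dist_real_def by metis
      \<comment> \<open>Half the distances to 0 and \<open>L\<close> keep both tents strictly inside
        the interval, as compact support demands.\<close>
      define \<delta> where "\<delta> = min (min (min d1 d2) (min (x / 2) (y / 2))) (min ((L - x) / 2) ((L - y) / 2))"
      have \<delta>: "\<delta> > 0" "\<delta> \<le> d1" "\<delta> \<le> d2" "\<delta> < x" "\<delta> < y" "x + \<delta> < L" "y + \<delta> < L"
      proof -
        show "\<delta> > 0" "\<delta> \<le> d1" "\<delta> \<le> d2" using d(1,2) x y by (auto simp: \<delta>_def)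
        have "\<delta> \<le> x / 2" "\<delta> \<le> y / 2" "\<delta> \<le> (L - x) / 2" "\<delta> \<le> (L - y) / 2"
          unfolding \<delta>_def by linarith+
        then show "\<delta> < x" "\<delta> < y" "x + \<delta> < L" "y + \<delta> < L" using x y by simp_all
      qed
      have cT: "continuous_on {0..L} (\<lambda>s. tent \<delta> (s - z))" for z
        unfolding tent_def by (intro continuous_intros)
      have "0 = integral {0..L} (\<lambda>s. k s * (tent \<delta> (s - x) - tent \<delta> (s - y)))"
        using test[OF test_fun_tent, of \<delta> x y] \<delta> by simp
      also have "\<dots> = integral {0..L} (\<lambda>s. k s * tent \<delta> (s - x)) - integral {0..L} (\<lambda>s. k s * tent \<delta> (s - y))"
        using ck cT unfolding right_diff_distrib
        by (intro Henstock_Kurzweil_Integration.integral_diff integrable_continuous_interval continuous_intros)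
      finally have I: "integral {0..L} (\<lambda>s. k s * tent \<delta> (s - x)) = integral {0..L} (\<lambda>s. k s * tent \<delta> (s - y))"
        by simp
      have nx: "\<bar>k s - k x\<bar> \<le> e / 2" if "\<bar>s - x\<bar> < \<delta>" for s
      proof -
        have "0 \<le> s" "s \<le> L" "\<bar>s - x\<bar> < d1" using that \<delta> by linarith+
        then show ?thesis using d(3)[of s] by simp
      qed
      have ny: "\<bar>k s - k y\<bar> \<le> e / 2" if "\<bar>s - y\<bar> < \<delta>" for s
      proof -
        have "0 \<le> s" "s \<le> L" "\<bar>s - y\<bar> < d2" using that \<delta> by linarith+
        then show ?thesis using d(4)[of s] by simp
      qed
      have "\<bar>k x * \<delta>\<^sup>2 - k y * \<delta>\<^sup>2\<bar> \<le> e / 2 * \<delta>\<^sup>2 + e / 2 * \<delta>\<^sup>2"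
      proof -
        have "\<bar>integral {0..L} (\<lambda>s. k s * tent \<delta> (s - x)) - k x * \<delta>\<^sup>2\<bar> \<le> e / 2 * \<delta>\<^sup>2"
          by (rule integral_tent_approx[OF ck]) (use \<delta> nx in auto)
        moreover have "\<bar>integral {0..L} (\<lambda>s. k s * tent \<delta> (s - y)) - k y * \<delta>\<^sup>2\<bar> \<le> e / 2 * \<delta>\<^sup>2"
          by (rule integral_tent_approx[OF ck]) (use \<delta> ny in auto)
        ultimately show ?thesis using I by linarith
      qed
      moreover have "\<bar>k x * \<delta>\<^sup>2 - k y * \<delta>\<^sup>2\<bar> = \<bar>k x - k y\<bar> * \<delta>\<^sup>2"
        by (simp add: abs_mult flip: left_diff_distrib)
      moreover have "e / 2 * \<delta>\<^sup>2 + e / 2 * \<delta>\<^sup>2 = e * \<delta>\<^sup>2" by simp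
      ultimately have "\<bar>k x - k y\<bar> * \<delta>\<^sup>2 \<le> e * \<delta>\<^sup>2" by linarith
      then show "\<bar>k x - k y\<bar> \<le> 0 + e" using \<delta> by simp
    qed
    then show ?thesis by simp
  qed
  \<comment> \<open>Tents reach interior points only; continuity carries the value to 0 and
    \<open>L\<close>. The midpoint is just an interior reference point.\<close>
  have const: "k x = k (L / 2)" if "x \<in> {0..L}" for x
  proof (rule continuous_constant_on_closure[where f = k and S = "{0<..<L}"])
    show "continuous_on (closure {0<..<L}) k" "x \<in> closure {0<..<L}"
      using ck that \<open>L > 0\<close> by simp_all
    show "k y = k (L / 2)" if "y \<in> {0<..<L}" for y
      by (rule eq) (use that \<open>L > 0\<close> in auto)
  qed
  have k0: "k x = k 0" if "x \<in> {0..L}" for x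
    using const[OF that] const[of 0] \<open>L > 0\<close> by simp
  have "u x - u 0 = integral {0..x} w" if "x \<in> {0..L}" for x
  proof -
    have "k 0 = u 0" by (simp add: k_def U_def)
    then have "u x - U x = u 0" using k0[OF that] by (simp add: k_def)
    then show ?thesis by (simp add: U_def)
  qed
  then show ?thesis using wa by (simp add: primitive_def)
qed

section \<open>Function spaces and the multiplier form\<close>

lemma semi_inner_on_add:
  assumes "semi_inner_on S B" "semi_inner_on S B'"
  shows "semi_inner_on S (\<lambda>x y. B x y + B' x y)"
proof -
  interpret B: semi_inner_on S B by fact
  interpret B': semi_inner_on S B' by fact
  show ?thesis
    by standard (auto simp: B.subspace_S B.commute B'.commute B.add_left B'.add_left
        B.scaleR_left B'.scaleR_left B.self_nonneg B'.self_nonneg algebra_simps)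
qed

text \<open>With \<open>semi_inner_on_add\<close> this assembles the scalar products of the product
  spaces from those of their components.\<close>

lemma semi_inner_on_pullback:
  assumes "semi_inner_on S B" "subspace T" "linear f" "f ` T \<subseteq> S"
  shows "semi_inner_on T (\<lambda>x y. B (f x) (f y))"
proof -
  interpret semi_inner_on S B by fact
  have "f x \<in> S" if "x \<in> T" for x using assms that by blast
  then show ?thesis
    using assms(2) by unfold_locales
      (auto simp: linear_add[OF assms(3)] linear_scale[OF assms(3)] add_left scaleR_left self_nonneg
        intro: commute)
qed

lemma semi_inner_on_real: "semi_inner_on UNIV ((*) :: real \<Rightarrow> real \<Rightarrow> real)"
  by standard (auto simp: algebra_simps)

lemma test_fun_L2:
  assumes "test_fun L \<phi> \<phi>'"
  shows "\<phi> \<in> L2 L" "\<phi>' \<in> L2 L"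
proof -
  have "\<And>x. (\<phi> has_real_derivative \<phi>' x) (at x)" using assms by (auto simp: test_fun_def)
  then have "continuous_on {0..L} \<phi>"
    by (meson DERIV_continuous_on has_field_derivative_at_within)
  then show "\<phi> \<in> L2 L" by (rule continuous_on_L2)
  show "\<phi>' \<in> L2 L"
    using assms by (intro continuous_on_L2) (auto simp: test_fun_def intro: continuous_on_subset)
qed

lemma weak_deriv_add:
  assumes "u \<in> L2 L" "v \<in> L2 L" "w \<in> L2 L" "z \<in> L2 L" "weak_deriv L u w" "weak_deriv L v z"
  shows "weak_deriv L (u + v) (w + z)"
  unfolding weak_deriv_def
proof (intro allI impI)
  fix \<phi> \<phi>' assume t: "test_fun L \<phi> \<phi>'"
  have "L2_inner L u \<phi>' = - L2_inner L w \<phi>" "L2_inner L v \<phi>' = - L2_inner L z \<phi>"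
    using assms t unfolding weak_deriv_def by blast+
  then show "L2_inner L (u + v) \<phi>' = - L2_inner L (w + z) \<phi>"
    using assms test_fun_L2[OF t] by (simp add: L2.add_left)
qed

lemma weak_deriv_scaleR:
  assumes "u \<in> L2 L" "w \<in> L2 L" "weak_deriv L u w"
  shows "weak_deriv L (c *\<^sub>R u) (c *\<^sub>R w)"
  unfolding weak_deriv_def
proof (intro allI impI)
  fix \<phi> \<phi>' assume t: "test_fun L \<phi> \<phi>'"
  have "L2_inner L u \<phi>' = - L2_inner L w \<phi>"
    using assms t unfolding weak_deriv_def by blast
  then show "L2_inner L (c *\<^sub>R u) \<phi>' = - L2_inner L (c *\<^sub>R w) \<phi>"
    using assms test_fun_L2[OF t] by (simp add: L2.scaleR_left)
qed

lemma H1_D: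
  assumes "u \<in> H1 L"
  shows Dx_L2: "Dx L u \<in> L2 L" and H1_L2: "u \<in> L2 L"
    and H1_continuous: "continuous_on {0..L} u" and Dx_weak_deriv: "weak_deriv L u (Dx L u)"
proof -
  show "u \<in> L2 L" "continuous_on {0..L} u" using assms by (auto simp: H1_def)
  have "Dx L u \<in> L2 L \<and> weak_deriv L u (Dx L u)"
  proof (cases "u \<in> H2 L")
    case True
    then have "\<exists>w. w \<in> H1 L \<and> weak_deriv L u w" by (auto simp: H2_def)
    from someI_ex[OF this] show ?thesis using True by (auto simp: Dx_def H1_def)
  next
    case False
    have "\<exists>w. w \<in> L2 L \<and> weak_deriv L u w" using assms by (auto simp: H1_def)
    from someI_ex[OF this] show ?thesis using False by (auto simp: Dx_def)
  qed
  then show "Dx L u \<in> L2 L" "weak_deriv L u (Dx L u)" by auto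
qed

lemma Dx_H1:
  assumes "u \<in> H2 L"
  shows "Dx L u \<in> H1 L"
proof -
  have "\<exists>w. w \<in> H1 L \<and> weak_deriv L u w" using assms by (auto simp: H2_def)
  from someI_ex[OF this] show ?thesis using assms by (simp add: Dx_def)
qed

lemma H1_I: "u \<in> L2 L \<Longrightarrow> continuous_on {0..L} u \<Longrightarrow> w \<in> L2 L \<Longrightarrow> weak_deriv L u w \<Longrightarrow> u \<in> H1 L"
  by (auto simp: H1_def)

lemma H1_subspace: "subspace (H1 L)"
proof (rule subspaceI)
  have "weak_deriv L 0 0" by (simp add: weak_deriv_def L2_inner_def)
  then show "0 \<in> H1 L"
    using L2.closed(4) by (intro H1_I[of _ _ 0]) (auto simp: zero_fun_def)
next
  fix u v assume uv: "u \<in> H1 L" "v \<in> H1 L"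
  show "u + v \<in> H1 L"
  proof (rule H1_I[of _ _ "Dx L u + Dx L v"])
    show "continuous_on {0..L} (u + v)"
      unfolding plus_fun_def using uv by (intro continuous_intros H1_continuous)
  qed (use uv in \<open>auto simp: H1_D intro!: weak_deriv_add L2.closed\<close>)
next
  fix u c assume u: "u \<in> H1 L"
  show "c *\<^sub>R u \<in> H1 L"
  proof (rule H1_I[of _ _ "c *\<^sub>R Dx L u"])
    show "continuous_on {0..L} (c *\<^sub>R u)"
      unfolding scaleR_fun_def using u by (intro continuous_intros H1_D)
  qed (use u in \<open>auto simp: L2.closed H1_D intro!: weak_deriv_scaleR\<close>)
qed

lemma Dx_primitive: "L > 0 \<Longrightarrow> u \<in> H1 L \<Longrightarrow> primitive L u (Dx L u)"
  by (rule weak_deriv_primitive) (auto intro: H1_D)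

text \<open>Both functions are densities of the same primitive \<open>u\<close>. This restores
  linearity of \<open>Dx\<close>, which choice alone does not provide, outside a null set.\<close>

lemma Dx_AE_unique:
  assumes "L > 0" "u \<in> H1 L" "w \<in> L2 L" "weak_deriv L u w"
  shows "AE x in lebesgue_on {0<..<L}. Dx L u x = w x"
  using Dx_primitive[OF assms(1,2)] weak_deriv_primitive[OF assms(1) _ assms(3,4)] H1_D[OF assms(2)]
  by (intro primitive_unique_AE)

lemma Dx_add_AE:
  assumes "L > 0" "u \<in> H1 L" "v \<in> H1 L"
  shows "AE x in lebesgue_on {0<..<L}. Dx L (u + v) x = (Dx L u + Dx L v) x"
  using assms by (intro Dx_AE_unique[where w = "Dx L u + Dx L v"] weak_deriv_add)
    (auto simp: H1_D L2.closed subspace_add[OF H1_subspace])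

lemma Dx_scaleR_AE:
  assumes "L > 0" "u \<in> H1 L"
  shows "AE x in lebesgue_on {0<..<L}. Dx L (c *\<^sub>R u) x = (c *\<^sub>R Dx L u) x"
  using assms by (intro Dx_AE_unique[where w = "c *\<^sub>R Dx L u"] weak_deriv_scaleR)
    (auto simp: H1_D L2.closed subspace_scale[OF H1_subspace])

lemma semi_inner_Dx:
  assumes "L > 0"
  shows "semi_inner_on (H1 L) (\<lambda>u v. L2_inner L (Dx L u) (Dx L v))"
proof
  fix u v z and c :: real
  assume u: "u \<in> H1 L"
  show "0 \<le> L2_inner L (Dx L u) (Dx L u)" using u by (intro L2.self_nonneg H1_D)
  assume z: "z \<in> H1 L"
  have "L2_inner L (Dx L (c *\<^sub>R u)) (Dx L z) = L2_inner L (c *\<^sub>R Dx L u) (Dx L z)"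
    using u z by (intro L2_inner_cong_AE Dx_scaleR_AE assms H1_D L2.closed subspace_scale[OF H1_subspace])
  then show "L2_inner L (Dx L (c *\<^sub>R u)) (Dx L z) = c * L2_inner L (Dx L u) (Dx L z)"
    using u z by (simp add: L2.scaleR_left H1_D)
  show "L2_inner L (Dx L u) (Dx L z) = L2_inner L (Dx L z) (Dx L u)"
    using u z by (intro L2.commute H1_D)
  assume v: "v \<in> H1 L"
  have "L2_inner L (Dx L (u + v)) (Dx L z) = L2_inner L (Dx L u + Dx L v) (Dx L z)"
    using u v z by (intro L2_inner_cong_AE Dx_add_AE assms H1_D L2.closed subspace_add[OF H1_subspace])
  then show "L2_inner L (Dx L (u + v)) (Dx L z) = L2_inner L (Dx L u) (Dx L z) + L2_inner L (Dx L v) (Dx L z)"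
    using u v z by (simp add: L2.add_left H1_D)
qed (rule H1_subspace)

lemma V_space_iff: "p \<in> V_space L \<longleftrightarrow> fst p \<in> H1 L \<and> snd p = fst p 0"
  by (cases p) (auto simp: V_space_def)

lemma V_space_subspace: "subspace (V_space L)"
  by (rule subspaceI)
     (auto simp: V_space_iff subspace_0[OF H1_subspace] subspace_add[OF H1_subspace]
        subspace_scale[OF H1_subspace])

lemma H_space_iff: "p \<in> H_space L \<longleftrightarrow> fst p \<in> L2 L"
  by (cases p) (auto simp: H_space_def)

lemma H_space_subspace: "subspace (H_space L)"
  unfolding H_space_def by (intro subspace_Times L2_subspace subspace_UNIV)

lemma state_space_iff: "X \<in> state_space L \<longleftrightarrow> fst X \<in> V_space L \<and> snd X \<in> H_space L"
  by (cases X) (auto simp: state_space_def)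

lemma state_space_subspace: "subspace (state_space L)"
  unfolding state_space_def by (intro subspace_Times V_space_subspace H_space_subspace)

lemma linear_fst: "linear fst" and linear_snd: "linear snd"
  by (auto intro!: linearI)

lemma semi_inner_H: "semi_inner_on (H_space L) (H_inner L)"
  unfolding H_inner_def[abs_def]
  by (intro semi_inner_on_add semi_inner_on_pullback[OF L2.semi_inner_on_axioms]
      semi_inner_on_pullback[OF semi_inner_on_real] H_space_subspace linear_fst linear_snd)
     (auto simp: H_space_iff)

lemma semi_inner_V:
  assumes "L > 0"
  shows "semi_inner_on (V_space L) (V_inner L)"
  unfolding V_inner_def[abs_def]
  by (intro semi_inner_on_add semi_inner_on_pullback[OF L2.semi_inner_on_axioms]
      semi_inner_on_pullback[OF semi_inner_Dx[OF assms]]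
      semi_inner_on_pullback[OF semi_inner_on_real] V_space_subspace linear_fst linear_snd)
     (auto simp: V_space_iff H1_D)

definition state_inner :: "real \<Rightarrow> state \<Rightarrow> state \<Rightarrow> real" where
  "state_inner L X Y = V_inner L (fst X) (fst Y) + H_inner L (snd X) (snd Y)"

text \<open>The polar form of twice the energy. Constant displacements are invisible to it, so it is
  dominated by \<open>state_inner\<close> but not equivalent to it.\<close>

definition energy_inner :: "real \<Rightarrow> state \<Rightarrow> state \<Rightarrow> real" where
  "energy_inner L X Y =
     L2_inner L (Dx L (fst (fst X))) (Dx L (fst (fst Y))) + H_inner L (snd X) (snd Y)"

text \<open>The multiplier is \<open>x + 1\<close>: the boundary term at \<open>x = 0\<close> which it produces has the
  sign needed to absorb the kinetic energy of the point mass.\<close>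

definition multiplier_form :: "real \<Rightarrow> state \<Rightarrow> state \<Rightarrow> real" where
  "multiplier_form L X Y = L2_inner L (\<lambda>x. (x + 1) * Dx L (fst (fst X)) x) (fst (snd Y))"

text \<open>A bilinear form in two states rather than a functional of one, so that the abstract
  product rule differentiates it along a curve. On the diagonal, \<open>\<epsilon> = 0\<close> gives
  the energy.\<close>

definition lyapunov_form :: "real \<Rightarrow> real \<Rightarrow> state \<Rightarrow> state \<Rightarrow> real" where
  "lyapunov_form L \<epsilon> X Y = energy_inner L X Y / 2 + \<epsilon> * multiplier_form L X Y"

lemma linear_fst_fst: "linear (\<lambda>X. fst (fst X))"
  by (auto intro!: linearI)

section \<open>The forms on the state space and their bounds\<close>

locale interval =
  fixes L :: real
  assumes L_pos: "L > 0"
begin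

sublocale H: semi_inner_on "H_space L" "H_inner L" by (rule semi_inner_H)

sublocale V: semi_inner_on "V_space L" "V_inner L" by (rule semi_inner_V[OF L_pos])

sublocale D: semi_inner_on "H1 L" "\<lambda>u v. L2_inner L (Dx L u) (Dx L v)"
  by (rule semi_inner_Dx[OF L_pos])

sublocale St: semi_inner_on "state_space L" "state_inner L"
  unfolding state_inner_def[abs_def]
  by (intro semi_inner_on_add semi_inner_on_pullback[OF V.semi_inner_on_axioms]
      semi_inner_on_pullback[OF H.semi_inner_on_axioms] state_space_subspace linear_fst linear_snd)
     (auto simp: state_space_iff)

sublocale En: semi_inner_on "state_space L" "energy_inner L"
  unfolding energy_inner_def[abs_def]
  by (intro semi_inner_on_add semi_inner_on_pullback[OF D.semi_inner_on_axioms]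
      semi_inner_on_pullback[OF H.semi_inner_on_axioms] state_space_subspace linear_fst_fst linear_snd)
     (auto simp: state_space_iff V_space_iff)

lemma state_norm_eq: "state_norm L = (\<lambda>X. sqrt (state_inner L X X))"
  by (simp add: fun_eq_iff state_norm_def state_inner_def)

lemma H_norm_eq: "H_norm L = (\<lambda>X. sqrt (H_inner L X X))"
  by (simp add: fun_eq_iff H_norm_def)

lemma energy_eq: "(u, v) \<in> state_space L \<Longrightarrow> energy L u v = energy_inner L (u, v) (u, v) / 2"
  by (simp add: energy_def energy_inner_def H_norm_def L2_inner_def power2_eq_square H.self_nonneg
      state_space_iff)

lemma inner_le_state_inner:
  assumes "X \<in> state_space L"
  shows "energy_inner L X X \<le> state_inner L X X"
    "H_inner L (fst X) (fst X) \<le> state_inner L X X"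
    "H_inner L (snd X) (snd X) \<le> state_inner L X X"
    "L2_inner L (Dx L (fst (fst X))) (Dx L (fst (fst X))) \<le> energy_inner L X X"
    "L2_inner L (fst (snd X)) (fst (snd X)) \<le> energy_inner L X X"
proof -
  have X: "fst (fst X) \<in> H1 L" "fst (snd X) \<in> L2 L" "snd X \<in> H_space L"
    using assms by (auto simp: state_space_iff V_space_iff H_space_iff)
  have "0 \<le> L2_inner L (fst (fst X)) (fst (fst X))" "0 \<le> L2_inner L (fst (snd X)) (fst (snd X))"
    "0 \<le> L2_inner L (Dx L (fst (fst X))) (Dx L (fst (fst X)))" "0 \<le> H_inner L (snd X) (snd X)"
    using X by (auto intro: L2.self_nonneg H1_D H.self_nonneg)
  moreover have "0 \<le> snd (fst X) * snd (fst X)" "0 \<le> snd (snd X) * snd (snd X)" by auto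
  ultimately show "energy_inner L X X \<le> state_inner L X X"
    "H_inner L (fst X) (fst X) \<le> state_inner L X X"
    "H_inner L (snd X) (snd X) \<le> state_inner L X X"
    "L2_inner L (Dx L (fst (fst X))) (Dx L (fst (fst X))) \<le> energy_inner L X X"
    "L2_inner L (fst (snd X)) (fst (snd X)) \<le> energy_inner L X X"
    unfolding energy_inner_def state_inner_def V_inner_def H_inner_def by auto
qed

lemma weighted_Dx:
  assumes "p \<in> L2 L"
  shows "(\<lambda>x. (x + 1) * p x) \<in> L2 L"
    "L2_inner L (\<lambda>x. (x + 1) * p x) (\<lambda>x. (x + 1) * p x) \<le> (L + 1)\<^sup>2 * L2_inner L p p"
proof -
  have m: "(\<lambda>x. x + 1) \<in> borel_measurable (lebesgue_on {0<..<L})"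
    using continuous_on_L2[of L "\<lambda>x. x + 1"] continuous_on_add[OF continuous_on_id continuous_on_const]
    by (auto simp: L2_iff)
  show "(\<lambda>x. (x + 1) * p x) \<in> L2 L"
    "L2_inner L (\<lambda>x. (x + 1) * p x) (\<lambda>x. (x + 1) * p x) \<le> (L + 1)\<^sup>2 * L2_inner L p p"
    using L2_bounded_mult[OF assms m, of "L + 1"] L_pos by auto
qed

lemma multiplier_form_bound:
  assumes X: "X \<in> state_space L" and Y: "Y \<in> state_space L"
  shows "\<bar>multiplier_form L X Y\<bar> \<le>
    (L + 1) * (sqrt (L2_inner L (Dx L (fst (fst X))) (Dx L (fst (fst X))))
       * sqrt (L2_inner L (fst (snd Y)) (fst (snd Y))))"
proof -
  let ?p = "Dx L (fst (fst X))" and ?v = "fst (snd Y)"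
  have p: "?p \<in> L2 L" and v: "?v \<in> L2 L"
    using X Y by (auto simp: state_space_iff V_space_iff H_space_iff H1_D)
  have "\<bar>multiplier_form L X Y\<bar> \<le> sqrt (L2_inner L (\<lambda>x. (x + 1) * ?p x) (\<lambda>x. (x + 1) * ?p x))
      * sqrt (L2_inner L ?v ?v)"
    unfolding multiplier_form_def by (intro L2.Cauchy_Schwarz weighted_Dx p v)
  also have "\<dots> \<le> sqrt ((L + 1)\<^sup>2 * L2_inner L ?p ?p) * sqrt (L2_inner L ?v ?v)"
    using weighted_Dx[OF p] L2.self_nonneg[OF v] by (intro mult_right_mono) auto
  also have "\<dots> = (L + 1) * (sqrt (L2_inner L ?p ?p) * sqrt (L2_inner L ?v ?v))"
    using L_pos by (simp add: real_sqrt_mult)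
  finally show ?thesis .
qed

text \<open>Cauchy-Schwarz followed by the inequality of arithmetic and geometric means; the factor
  is the maximum \<open>L + 1\<close> of the weight.\<close>

lemma multiplier_form_le_energy:
  assumes X: "X \<in> state_space L"
  shows "\<bar>multiplier_form L X X\<bar> \<le> (L + 1) * (energy_inner L X X / 2)"
proof -
  define a where "a = L2_inner L (Dx L (fst (fst X))) (Dx L (fst (fst X)))"
  define b where "b = L2_inner L (fst (snd X)) (fst (snd X))"
  have nn: "0 \<le> a" "0 \<le> b"
    using X by (auto simp: a_def b_def state_space_iff V_space_iff H_space_iff intro: L2.self_nonneg H1_D)
  have "0 \<le> (sqrt a - sqrt b)\<^sup>2" by simp
  then have "sqrt a * sqrt b \<le> (a + b) / 2" using nn by (simp add: power2_diff)
  also have "\<dots> \<le> energy_inner L X X / 2"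
    by (simp add: energy_inner_def H_inner_def a_def b_def)
  finally have "(L + 1) * (sqrt a * sqrt b) \<le> (L + 1) * (energy_inner L X X / 2)"
    using L_pos by (intro mult_left_mono) auto
  then show ?thesis using multiplier_form_bound[OF X X] by (simp add: a_def b_def)
qed

lemma multiplier_form_left:
  assumes "X \<in> state_space L" "Y \<in> state_space L" "Z \<in> state_space L"
  shows "multiplier_form L (X + Y) Z = multiplier_form L X Z + multiplier_form L Y Z"
    "multiplier_form L (c *\<^sub>R X) Z = c * multiplier_form L X Z"
proof -
  have H1: "fst (fst X) \<in> H1 L" "fst (fst Y) \<in> H1 L" and Z: "fst (snd Z) \<in> L2 L"
    using assms by (auto simp: state_space_iff V_space_iff H_space_iff)
  note cl = subspace_add[OF H1_subspace] subspace_scale[OF H1_subspace]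
  let ?m = "\<lambda>u x. (x + 1) * Dx L u x"
  have "L2_inner L (?m (fst (fst X) + fst (fst Y))) (fst (snd Z))
     = L2_inner L (?m (fst (fst X)) + ?m (fst (fst Y))) (fst (snd Z))"
  proof (intro L2_inner_cong_AE)
    show "AE x in lebesgue_on {0<..<L}. ?m (fst (fst X) + fst (fst Y)) x = (?m (fst (fst X)) + ?m (fst (fst Y))) x"
      using Dx_add_AE[OF L_pos H1] by (elim eventually_mono) (simp add: distrib_left)
  qed (use H1 Z in \<open>simp_all add: weighted_Dx H1_D L2.closed cl\<close>)
  then show "multiplier_form L (X + Y) Z = multiplier_form L X Z + multiplier_form L Y Z"
    using H1 Z by (simp add: multiplier_form_def L2.add_left weighted_Dx H1_D)
  have "L2_inner L (?m (c *\<^sub>R fst (fst X))) (fst (snd Z))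
     = L2_inner L (c *\<^sub>R ?m (fst (fst X))) (fst (snd Z))"
  proof (intro L2_inner_cong_AE)
    show "AE x in lebesgue_on {0<..<L}. ?m (c *\<^sub>R fst (fst X)) x = (c *\<^sub>R ?m (fst (fst X))) x"
      using Dx_scaleR_AE[OF L_pos H1(1), of c] by (elim eventually_mono) simp
  qed (use H1 Z in \<open>simp_all add: weighted_Dx H1_D L2.closed cl\<close>)
  then show "multiplier_form L (c *\<^sub>R X) Z = c * multiplier_form L X Z"
    using H1 Z by (simp add: multiplier_form_def L2.scaleR_left weighted_Dx H1_D)
qed

lemma multiplier_form_right:
  assumes "X \<in> state_space L" "Y \<in> state_space L" "Z \<in> state_space L"
  shows "multiplier_form L X (Y - Z) = multiplier_form L X Y - multiplier_form L X Z"
    "multiplier_form L X (c *\<^sub>R Y) = c * multiplier_form L X Y"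
proof -
  have "fst (fst X) \<in> H1 L" "fst (snd Y) \<in> L2 L" "fst (snd Z) \<in> L2 L"
    using assms by (auto simp: state_space_iff V_space_iff H_space_iff)
  then show "multiplier_form L X (Y - Z) = multiplier_form L X Y - multiplier_form L X Z"
    "multiplier_form L X (c *\<^sub>R Y) = c * multiplier_form L X Y"
    by (simp_all add: multiplier_form_def L2.scaleR_right L2.diff_right weighted_Dx H1_D)
qed

text \<open>In the constant, \<open>1 / 2\<close> comes from the energy part and
  \<open>\<epsilon> * (L + 1)\<close> from the weight of the multiplier. Continuity is needed in the
  full state norm, the one in which solutions are absolutely continuous.\<close>

lemma lyapunov_bilinear:
  assumes "0 \<le> \<epsilon>"
  shows "bilinear_on (state_space L) (state_norm L) (state_space L) (state_norm L)
     (lyapunov_form L \<epsilon>) (1 / 2 + \<epsilon> * (L + 1))"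
  unfolding bilinear_on_def state_norm_eq
proof (intro conjI St.seminorm_on_axioms, unfold_locales)
  fix X X' Y and c :: real assume X: "X \<in> state_space L" and Y: "Y \<in> state_space L"
  have en: "sqrt (energy_inner L Z Z) \<le> sqrt (state_inner L Z Z)" if "Z \<in> state_space L" for Z
    using inner_le_state_inner(1)[OF that] by simp
  have vs: "fst (snd Y) \<in> L2 L" "fst (fst X) \<in> H1 L"
    using X Y by (auto simp: state_space_iff V_space_iff H_space_iff)
  show "lyapunov_form L \<epsilon> (c *\<^sub>R X) Y = c * lyapunov_form L \<epsilon> X Y"
    using X Y by (simp add: lyapunov_form_def En.scaleR_left multiplier_form_left(2)[OF X X Y] algebra_simps)
  show "lyapunov_form L \<epsilon> X (c *\<^sub>R Y) = c * lyapunov_form L \<epsilon> X Y"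
    using X Y
    by (simp add: lyapunov_form_def En.scaleR_right multiplier_form_right(2)[OF X Y Y] algebra_simps)
  have "\<bar>energy_inner L X Y\<bar> \<le> sqrt (energy_inner L X X) * sqrt (energy_inner L Y Y)"
    using X Y by (rule En.Cauchy_Schwarz)
  also have "\<dots> \<le> sqrt (state_inner L X X) * sqrt (state_inner L Y Y)"
    using en[OF X] en[OF Y] X Y by (intro mult_mono) (simp_all add: En.self_nonneg St.self_nonneg)
  finally have 1: "\<bar>energy_inner L X Y\<bar> \<le> sqrt (state_inner L X X) * sqrt (state_inner L Y Y)" .
  have "\<bar>multiplier_form L X Y\<bar> \<le>
    (L + 1) * (sqrt (L2_inner L (Dx L (fst (fst X))) (Dx L (fst (fst X))))
       * sqrt (L2_inner L (fst (snd Y)) (fst (snd Y))))"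
    using X Y by (rule multiplier_form_bound)
  also have "\<dots> \<le> (L + 1) * (sqrt (state_inner L X X) * sqrt (state_inner L Y Y))"
    using inner_le_state_inner(1,4)[OF X] inner_le_state_inner(1,5)[OF Y] L_pos vs
      St.self_nonneg[OF X] L2.self_nonneg[OF vs(1)]
    by (intro mult_left_mono mult_mono) (auto intro: L2.self_nonneg)
  finally have 2: "\<bar>multiplier_form L X Y\<bar> \<le> (L + 1) * (sqrt (state_inner L X X) * sqrt (state_inner L Y Y))" .
  have "\<bar>lyapunov_form L \<epsilon> X Y\<bar> \<le> \<bar>energy_inner L X Y\<bar> / 2 + \<epsilon> * \<bar>multiplier_form L X Y\<bar>"
    using assms abs_triangle_ineq[of "energy_inner L X Y / 2" "\<epsilon> * multiplier_form L X Y"]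
    by (simp add: lyapunov_form_def abs_mult)
  also have "\<dots> \<le> sqrt (state_inner L X X) * sqrt (state_inner L Y Y) / 2
      + \<epsilon> * ((L + 1) * (sqrt (state_inner L X X) * sqrt (state_inner L Y Y)))"
    using 1 2 assms by (intro add_mono mult_left_mono divide_right_mono) auto
  also have "\<dots> = (1 / 2 + \<epsilon> * (L + 1)) * (sqrt (state_inner L X X) * sqrt (state_inner L Y Y))"
    by (simp add: algebra_simps)
  finally show "\<bar>lyapunov_form L \<epsilon> X Y\<bar> \<le> (1 / 2 + \<epsilon> * (L + 1)) * (sqrt (state_inner L X X) * sqrt (state_inner L Y Y))" .
  assume X': "X' \<in> state_space L"
  have m: "multiplier_form L (X - X') Y = multiplier_form L X Y - multiplier_form L X' Y"
    using multiplier_form_left(1)[of "X - X'" X' Y] X X' Y by (simp add: St.closed)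
  show "lyapunov_form L \<epsilon> (X - X') Y = lyapunov_form L \<epsilon> X Y - lyapunov_form L \<epsilon> X' Y"
    unfolding lyapunov_form_def m using X X' Y by (simp add: En.diff_left algebra_simps diff_divide_distrib)
next
  fix X Y Y' assume X: "X \<in> state_space L" and Y: "Y \<in> state_space L" "Y' \<in> state_space L"
  show "lyapunov_form L \<epsilon> X (Y - Y') = lyapunov_form L \<epsilon> X Y - lyapunov_form L \<epsilon> X Y'"
    using X Y by (simp add: lyapunov_form_def En.diff_right multiplier_form_right(1)
        algebra_simps diff_divide_distrib)
qed (use assms L_pos in auto)

section \<open>Integration by parts and the multiplier identity\<close>

lemma integration_by_parts:
  assumes "primitive L f w" "primitive L h q" "f \<in> L2 L" "h \<in> L2 L" "w \<in> L2 L" "q \<in> L2 L"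
  shows "L2_inner L w h + L2_inner L f q = f L * h L - f 0 * h 0"
proof -
  have "L2_inner L w h + L2_inner L f q = integral {0..L} (\<lambda>x. w x * h x + f x * q x)"
    using assms L2_mult_absolutely_integrable[of w L h] L2_mult_absolutely_integrable[of f L q]
    by (simp add: L2_inner_eq_integral Henstock_Kurzweil_Integration.integral_add absolutely_integrable_on_def)
  also have "\<dots> = f L * h L - f 0 * h 0"
    using primitive_diff[OF primitive_mult[OF assms(1,2)], of 0 L] L_pos by simp
  finally show ?thesis .
qed

text \<open>Integrate the derivative of \<open>(x + 1) * (v x)\<^sup>2\<close> over the interval. It
  is applied both to the velocity and to the space derivative of the displacement; the last term
  yields the decay.\<close>

lemma multiplier_identity:
  assumes v: "v \<in> H1 L"
  shows "2 * L2_inner L (\<lambda>x. (x + 1) * Dx L v x) v = (L + 1) * (v L)\<^sup>2 - (v 0)\<^sup>2 - L2_inner L v v"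
proof -
  let ?w = "Dx L v"
  note L2 = H1_D[OF v]
  have pv: "primitive L v ?w" using L_pos v by (rule Dx_primitive)
  have m: "primitive L (\<lambda>x. x + 1) (\<lambda>x. 1)"
    by (rule primitive_C1) (auto intro!: derivative_eq_intros)
  have pm: "primitive L (\<lambda>x. (x + 1) * v x) (\<lambda>x. 1 * v x + (x + 1) * ?w x)"
    using m pv by (rule primitive_mult)
  have e: "(\<lambda>x. 1 * v x + (x + 1) * ?w x) = v + (\<lambda>x. (x + 1) * ?w x)"
    by (simp add: fun_eq_iff)
  have "L2_inner L (v + (\<lambda>x. (x + 1) * ?w x)) v + L2_inner L (\<lambda>x. (x + 1) * v x) ?w
     = ((L + 1) * v L) * v L - ((0 + 1) * v 0) * v 0"
    using pm[unfolded e] pv by (rule integration_by_parts)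
       (use L2 weighted_Dx in \<open>auto intro!: L2.closed\<close>)
  moreover have "L2_inner L (\<lambda>x. (x + 1) * v x) ?w = L2_inner L (\<lambda>x. (x + 1) * ?w x) v"
    by (simp add: L2_inner_def mult_ac)
  ultimately show ?thesis
    using L2 weighted_Dx by (simp add: L2.add_left power2_eq_square algebra_simps)
qed

end

section \<open>Strong solutions\<close>

text \<open>Makes the product of two scalar absolutely continuous functions, the integrating factor
  and the functional, an instance of the bilinear case.\<close>

lemma bilinear_on_real_mult: "bilinear_on UNIV abs UNIV abs ((*) :: real \<Rightarrow> real \<Rightarrow> real) 1"
  by unfold_locales (auto simp: algebra_simps abs_mult)

lemma loc_abs_cont_diff_const: "loc_abs_cont abs f \<Longrightarrow> loc_abs_cont abs (\<lambda>t. f t - c :: real)"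
  by (simp add: loc_abs_cont_def)

lemma loc_abs_cont_const: "N 0 = 0 \<Longrightarrow> loc_abs_cont N (\<lambda>_. k)"
  unfolding loc_abs_cont_def by (auto intro!: exI[of _ 1] simp: case_prod_unfold)

lemma loc_abs_cont_exp: "loc_abs_cont abs (\<lambda>t. exp (\<mu> * t) :: real)"
proof (rule loc_abs_cont_le_lipschitz)
  fix T :: real
  show "\<exists>C. \<forall>s\<in>{0..T}. \<forall>t\<in>{0..T}. \<bar>exp (\<mu> * s) - exp (\<mu> * t)\<bar> \<le> C * \<bar>s - t\<bar>"
  proof (intro exI ballI)
    fix s t assume st: "s \<in> {0..T}" "t \<in> {0..T}"
    have "norm (exp (\<mu> * s) - exp (\<mu> * t)) \<le> (\<bar>\<mu>\<bar> * exp (\<bar>\<mu>\<bar> * T)) * norm (s - t)"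
    proof (rule field_differentiable_bound[of "{0..T}"])
      fix z assume z: "z \<in> {0..T}"
      show "((\<lambda>t. exp (\<mu> * t)) has_field_derivative \<mu> * exp (\<mu> * z)) (at z within {0..T})"
        by (auto intro!: derivative_eq_intros)
      have "\<mu> * z \<le> \<bar>\<mu>\<bar> * T" using z by (intro mult_mono) auto
      then show "norm (\<mu> * exp (\<mu> * z)) \<le> \<bar>\<mu>\<bar> * exp (\<bar>\<mu>\<bar> * T)"
        by (simp add: abs_mult mult_left_mono)
    qed (use st in auto)
    then show "\<bar>exp (\<mu> * s) - exp (\<mu> * t)\<bar> \<le> (\<bar>\<mu>\<bar> * exp (\<bar>\<mu>\<bar> * T)) * \<bar>s - t\<bar>" by simp
  qed
qed

context interval
begin

lemma dom_A_cases:
  assumes "X \<in> dom_A L g"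
  obtains u v where "X = ((u, u 0), (v, v 0))" "u \<in> H2 L" "v \<in> H1 L" "Dx L u L = - g (v L)"
  using assms unfolding dom_A_def W_space_def
  by (cases X) (auto simp: V_space_iff)

text \<open>The computation at a single time. Hypothesis \<open>K\<close> says that the damping at
  \<open>L\<close> pays for \<epsilon> times the boundary term of the multiplier, up to a
  constant.\<close>

lemma lyapunov_form_derivative:
  assumes X: "X \<in> dom_A L g" and eq: "X' + op_A L X = op_F F X" and "0 \<le> \<epsilon>"
    and F: "\<And>s. s * F s \<le> 0"
    and K: "\<And>s. \<epsilon> / 2 * ((L + 1) * (s\<^sup>2 + (g s)\<^sup>2)) \<le> s * g s + \<epsilon> * K"
  shows "lyapunov_form L \<epsilon> X' X + lyapunov_form L \<epsilon> X X' \<le> \<epsilon> * (K - energy_inner L X X / 2)"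
proof -
  obtain u v where uv: "X = ((u, u 0), (v, v 0))" "u \<in> H2 L" "v \<in> H1 L" "Dx L u L = - g (v L)"
    using dom_A_cases[OF X] .
  define p where "p = Dx L u"
  define q where "q = Dx L p"
  define w where "w = Dx L v"
  have "X' = op_F F X - op_A L X" using eq by (simp add: eq_diff_eq)
  then have X': "X' = ((v, v 0), (q, p 0 + F (v 0)))"
    by (simp add: uv(1) op_F_def op_A_def p_def q_def zero_prod_def prod_eq_iff)
  have p: "p \<in> H1 L" unfolding p_def using uv by (intro Dx_H1)
  have L2: "p \<in> L2 L" "q \<in> L2 L" "v \<in> L2 L" "w \<in> L2 L"
    using p uv by (auto simp: q_def w_def H1_D)
  have pL: "p L = - g (v L)" using uv(4) by (simp add: p_def)
  have qv: "L2_inner L q v = L2_inner L v q" and pw: "L2_inner L w p = L2_inner L p w"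
    using L2 by (auto intro: L2.commute)
  have "L2_inner L w p + L2_inner L v q = v L * p L - v 0 * p 0"
    using L2 p uv(3) L_pos unfolding w_def q_def by (intro integration_by_parts Dx_primitive) auto
  then have wp: "L2_inner L p w + L2_inner L v q = - (v L * g (v L)) - v 0 * p 0"
    by (simp add: pw pL)
  \<comment> \<open>The flux \<open>v 0 * p 0\<close> from integration by parts cancels against the
    force of the string on the point mass.\<close>
  have e: "energy_inner L X' X + energy_inner L X X' = 2 * (v 0 * F (v 0) - v L * g (v L))"
    using wp qv pw unfolding X' uv(1) energy_inner_def H_inner_def
    by (simp add: p_def[symmetric] w_def[symmetric] algebra_simps)
  \<comment> \<open>The multiplier identity for \<open>v\<close> and for \<open>p\<close>, where
    \<open>p L\<close> is replaced by the boundary condition. The term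
    \<open>- (v 0)\<^sup>2\<close> completes the bulk terms to minus the energy form.\<close>
  have m: "2 * (multiplier_form L X' X + multiplier_form L X X')
     = (L + 1) * ((v L)\<^sup>2 + (g (v L))\<^sup>2) - (v 0)\<^sup>2 - (p 0)\<^sup>2 - L2_inner L v v - L2_inner L p p"
  proof -
    have "L2_inner L (\<lambda>x. (x + 1) * p x) q = L2_inner L (\<lambda>x. (x + 1) * q x) p"
      by (simp add: L2_inner_def mult_ac)
    then have "multiplier_form L X' X + multiplier_form L X X'
       = L2_inner L (\<lambda>x. (x + 1) * w x) v + L2_inner L (\<lambda>x. (x + 1) * q x) p"
      unfolding multiplier_form_def X' uv(1) by (simp add: p_def[symmetric] w_def[symmetric])
    then show ?thesis
      using multiplier_identity[OF uv(3)] multiplier_identity[OF p] uv(4)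
      by (simp add: w_def[symmetric] q_def[symmetric] p_def[symmetric] distrib_left)
  qed
  have en: "energy_inner L X X = L2_inner L p p + L2_inner L v v + (v 0)\<^sup>2"
    by (simp add: energy_inner_def H_inner_def uv(1) p_def power2_eq_square)
  have "lyapunov_form L \<epsilon> X' X + lyapunov_form L \<epsilon> X X'
     = (energy_inner L X' X + energy_inner L X X') / 2
       + \<epsilon> / 2 * (2 * (multiplier_form L X' X + multiplier_form L X X'))"
    by (simp add: lyapunov_form_def algebra_simps add_divide_distrib)
  also have "\<dots> = v 0 * F (v 0) - v L * g (v L) + \<epsilon> / 2 * ((L + 1) * ((v L)\<^sup>2 + (g (v L))\<^sup>2))
      - \<epsilon> / 2 * (p 0)\<^sup>2 - \<epsilon> * (energy_inner L X X / 2)"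
    unfolding e m en by (simp add: algebra_simps add_divide_distrib diff_divide_distrib)
  \<comment> \<open>The sign of \<open>F\<close> removes its term, \<open>K\<close> bounds the
    boundary term at \<open>L\<close>, and \<open>- \<epsilon> / 2 * (p 0)\<^sup>2\<close> is
    dropped.\<close>
  also have "\<dots> \<le> 0 - v L * g (v L) + (v L * g (v L) + \<epsilon> * K) - 0 - \<epsilon> * (energy_inner L X X / 2)"
    using F[of "v 0"] K[of "v L"] \<open>0 \<le> \<epsilon>\<close> by (intro diff_mono add_mono) auto
  finally show ?thesis by (simp add: algebra_simps)
qed

lemma strong_solutionD:
  assumes "strong_solution L g F X"
  shows "t \<ge> 0 \<Longrightarrow> X t \<in> state_space L" "loc_abs_cont (state_norm L) X"
    "AE t in lebesgue. t \<ge> 0 \<longrightarrow> X t \<in> dom_A L g \<and>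
        (\<exists>X' \<in> state_space L. has_time_deriv (state_norm L) X X' t \<and> X' + op_A L (X t) = op_F F (X t))"
  using assms by (auto simp: strong_solution_def)

lemma strong_lyapunov:
  assumes X: "strong_solution L g F X" and "0 \<le> \<epsilon>"
    and F: "\<And>s. s * F s \<le> 0"
    and K: "\<And>s. \<epsilon> / 2 * ((L + 1) * (s\<^sup>2 + (g s)\<^sup>2)) \<le> s * g s + \<epsilon> * K"
  shows "loc_abs_cont abs (\<lambda>t. lyapunov_form L \<epsilon> (X t) (X t))"
    "AE t in lebesgue. t \<ge> 0 \<longrightarrow> (\<exists>D \<le> \<epsilon> * (K - energy_inner L (X t) (X t) / 2).
       has_time_deriv abs (\<lambda>t. lyapunov_form L \<epsilon> (X t) (X t)) D t)"
proof -
  interpret B: bilinear_on "state_space L" "state_norm L" "state_space L" "state_norm L"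
    "lyapunov_form L \<epsilon>" "1 / 2 + \<epsilon> * (L + 1)"
    using \<open>0 \<le> \<epsilon>\<close> by (rule lyapunov_bilinear)
  note D = strong_solutionD[OF X]
  show "loc_abs_cont abs (\<lambda>t. lyapunov_form L \<epsilon> (X t) (X t))"
    using D by (intro B.loc_abs_cont)
  show "AE t in lebesgue. t \<ge> 0 \<longrightarrow> (\<exists>D \<le> \<epsilon> * (K - energy_inner L (X t) (X t) / 2).
       has_time_deriv abs (\<lambda>t. lyapunov_form L \<epsilon> (X t) (X t)) D t)"
    using D(3)
  proof (elim eventually_mono, intro impI)
    fix t :: real assume "t \<ge> 0" and "t \<ge> 0 \<longrightarrow> X t \<in> dom_A L g \<and>
        (\<exists>X' \<in> state_space L. has_time_deriv (state_norm L) X X' t \<and> X' + op_A L (X t) = op_F F (X t))"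
    then obtain X' where "X t \<in> dom_A L g" and X': "X' \<in> state_space L"
      "has_time_deriv (state_norm L) X X' t" "X' + op_A L (X t) = op_F F (X t)"
      by blast
    then show "\<exists>D \<le> \<epsilon> * (K - energy_inner L (X t) (X t) / 2).
       has_time_deriv abs (\<lambda>t. lyapunov_form L \<epsilon> (X t) (X t)) D t"
      using B.has_time_deriv[OF D(2,1) D(2,1) \<open>t \<ge> 0\<close> X'(2,1) X'(2,1)]
        lyapunov_form_derivative[OF \<open>X t \<in> dom_A L g\<close> X'(3) \<open>0 \<le> \<epsilon>\<close> F K] by blast
  qed
qed

text \<open>The case \<open>\<epsilon> = 0\<close>: the functional is the energy, the upper bound
  for its derivative becomes 0, and the condition on \<open>K\<close> reduces to the sign of
  \<open>s * g s\<close>.\<close>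

lemma strong_energy_le_initial:
  assumes X: "strong_solution L g F X" and F: "\<And>s. s * F s \<le> 0" and g: "\<And>s. 0 \<le> s * g s" and "0 \<le> t"
  shows "energy_inner L (X t) (X t) \<le> energy_inner L (X 0) (X 0)"
proof -
  note * = strong_lyapunov[OF X order_refl F, of 0, simplified, OF g]
  have "lyapunov_form L 0 (X t) (X t) - lyapunov_form L 0 (X 0) (X 0) \<le> 0 * (t - 0)"
    by (rule loc_abs_cont_growth_le[OF *(1) order_refl \<open>0 \<le> t\<close>])
       (use *(2) in \<open>auto elim!: eventually_mono\<close>)
  then show ?thesis by (simp add: lyapunov_form_def)
qed

text \<open>The perturbation is at most half the energy, so the functional lies between 1/2 and 3/2
  of it.\<close>

lemma lyapunov_form_equivalent:
  assumes "X \<in> state_space L" "0 \<le> \<epsilon>" "\<epsilon> * (L + 1) \<le> 1 / 2"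
  shows "energy_inner L X X / 2 \<le> 2 * lyapunov_form L \<epsilon> X X"
    "lyapunov_form L \<epsilon> X X \<le> 3 / 2 * (energy_inner L X X / 2)"
proof -
  have "\<bar>\<epsilon> * multiplier_form L X X\<bar> \<le> \<epsilon> * ((L + 1) * (energy_inner L X X / 2))"
    using mult_left_mono[OF multiplier_form_le_energy[OF assms(1)] assms(2)] assms(2)
    by (simp add: abs_mult)
  also have "\<dots> = (\<epsilon> * (L + 1)) * (energy_inner L X X / 2)" by simp
  also have "\<dots> \<le> 1 / 2 * (energy_inner L X X / 2)"
    using assms(3) En.self_nonneg[OF assms(1)] by (intro mult_right_mono) auto
  finally show "energy_inner L X X / 2 \<le> 2 * lyapunov_form L \<epsilon> X X"
    "lyapunov_form L \<epsilon> X X \<le> 3 / 2 * (energy_inner L X X / 2)"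
    by (auto simp: lyapunov_form_def abs_le_iff)
qed

text \<open>A Gronwall argument with an integrating factor: \<open>\<Lambda> - 3 / 2 * K\<close>
  times \<open>exp (\<mu> * t)\<close> does not increase. Returning from \<Lambda> to the energy
  costs the factor 2, which turns 3/2 into 3 twice.\<close>

lemma strong_energy_decay:
  assumes X: "strong_solution L g F X" and \<epsilon>: "0 < \<epsilon>" "\<epsilon> * (L + 1) \<le> 1 / 2"
    and F: "\<And>s. s * F s \<le> 0"
    and K: "\<And>s. \<epsilon> / 2 * ((L + 1) * (s\<^sup>2 + (g s)\<^sup>2)) \<le> s * g s + \<epsilon> * K" and "0 \<le> K" "0 \<le> t"
  shows "energy_inner L (X t) (X t) / 2 \<le> 3 * exp (- (2 * \<epsilon> / 3) * t) * (energy_inner L (X 0) (X 0) / 2) + 3 * K"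
proof -
  \<comment> \<open>Chosen so that \<open>\<mu> * 3 / 2 = \<epsilon>\<close>: then the bound
    \<open>\<epsilon> * (K - E s)\<close> cancels exactly against \<open>\<mu>\<close> times the
    upper bound of \<open>\<Lambda> s - 3 / 2 * K\<close>.\<close>
  define \<mu> where "\<mu> = 2 * \<epsilon> / 3"
  define \<Lambda> where "\<Lambda> t = lyapunov_form L \<epsilon> (X t) (X t)" for t
  define E where "E t = energy_inner L (X t) (X t) / 2" for t
  note * = strong_lyapunov[OF X less_imp_le[OF \<epsilon>(1)] F K, folded \<Lambda>_def E_def]
  have S: "X s \<in> state_space L" if "s \<ge> 0" for s using strong_solutionD(1)[OF X that] .
  have eqv: "E s \<le> 2 * \<Lambda> s" "\<Lambda> s \<le> 3 / 2 * E s" if "s \<ge> 0" for s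
    using lyapunov_form_equivalent[OF S[OF that] less_imp_le[OF \<epsilon>(1)] \<epsilon>(2)] by (simp_all add: \<Lambda>_def E_def)
  interpret B: bilinear_on UNIV abs UNIV abs "(*) :: real \<Rightarrow> real \<Rightarrow> real" 1
    by (rule bilinear_on_real_mult)
  define \<Psi> where "\<Psi> t = exp (\<mu> * t) * (\<Lambda> t - 3 / 2 * K)" for t
  have ac: "loc_abs_cont abs \<Psi>"
    unfolding \<Psi>_def using *(1) by (intro B.loc_abs_cont loc_abs_cont_exp loc_abs_cont_diff_const) auto
  have "\<Psi> t - \<Psi> 0 \<le> 0 * (t - 0)"
  proof (rule loc_abs_cont_growth_le[OF ac order_refl \<open>0 \<le> t\<close>])
    show "AE s in lebesgue. 0 \<le> s \<and> s \<le> t \<longrightarrow> (\<exists>D\<le>0. has_time_deriv abs \<Psi> D s)"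
      using *(2)
    proof (elim eventually_mono, intro impI)
      fix s assume "0 \<le> s \<and> s \<le> t" "0 \<le> s \<longrightarrow> (\<exists>D\<le>\<epsilon> * (K - E s). has_time_deriv abs \<Lambda> D s)"
      then obtain D where s: "0 \<le> s" and D: "D \<le> \<epsilon> * (K - E s)" "has_time_deriv abs \<Lambda> D s" by blast
      have "(\<Psi> has_real_derivative exp (\<mu> * s) * (\<mu> * (\<Lambda> s - 3 / 2 * K) + D)) (at s within {0..})"
        unfolding \<Psi>_def using D(2)[unfolded has_time_deriv_abs_iff]
        by (auto intro!: derivative_eq_intros simp: algebra_simps)
      moreover have "\<mu> * (\<Lambda> s - 3 / 2 * K) + D \<le> \<mu> * (3 / 2 * E s - 3 / 2 * K) + \<epsilon> * (K - E s)"
        using D(1) eqv(2)[OF s] \<epsilon>(1) by (intro add_mono mult_left_mono) (auto simp: \<mu>_def)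
      then have "\<mu> * (\<Lambda> s - 3 / 2 * K) + D \<le> 0"
        by (simp add: \<mu>_def algebra_simps)
      then have "exp (\<mu> * s) * (\<mu> * (\<Lambda> s - 3 / 2 * K) + D) \<le> 0"
        by (intro mult_nonneg_nonpos) auto
      ultimately show "\<exists>D\<le>0. has_time_deriv abs \<Psi> D s"
        unfolding has_time_deriv_abs_iff by blast
    qed
  qed
  then have le: "exp (\<mu> * t) * (\<Lambda> t - 3 / 2 * K) \<le> \<Lambda> 0 - 3 / 2 * K" by (simp add: \<Psi>_def)
  have "\<Lambda> t - 3 / 2 * K = exp (- \<mu> * t) * (exp (\<mu> * t) * (\<Lambda> t - 3 / 2 * K))"
    by (simp add: exp_minus)
  also have "\<dots> \<le> exp (- \<mu> * t) * (\<Lambda> 0 - 3 / 2 * K)"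
    using le by (intro mult_left_mono) auto
  also have "\<dots> \<le> exp (- \<mu> * t) * (3 / 2 * E 0)"
    using eqv(2)[of 0] \<open>0 \<le> K\<close> by (intro mult_left_mono) auto
  finally have "\<Lambda> t \<le> exp (- \<mu> * t) * (3 / 2 * E 0) + 3 / 2 * K" by simp
  then have "E t \<le> 3 * exp (- \<mu> * t) * E 0 + 3 * K"
    using eqv(1)[OF \<open>0 \<le> t\<close>] by simp
  then show ?thesis by (simp add: E_def \<mu>_def)
qed

section \<open>A mean value inequality for the position\<close>

lemma position_bilinear:
  "bilinear_on (state_space L) (state_norm L) (H_space L) (H_norm L) (\<lambda>X k. H_inner L (fst X) k) 1"
  unfolding bilinear_on_def state_norm_eq H_norm_eq
proof (intro conjI St.seminorm_on_axioms H.seminorm_on_axioms, unfold_locales)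
  fix X k assume X: "X \<in> state_space L" and k: "k \<in> H_space L"
  have "fst X \<in> H_space L" using X by (auto simp: state_space_iff V_space_iff H_space_iff H1_D)
  then have "\<bar>H_inner L (fst X) k\<bar> \<le> sqrt (H_inner L (fst X) (fst X)) * sqrt (H_inner L k k)"
    using k by (rule H.Cauchy_Schwarz)
  also have "\<dots> \<le> sqrt (state_inner L X X) * sqrt (H_inner L k k)"
    using inner_le_state_inner(2)[OF X] k by (intro mult_right_mono) (auto simp: H.self_nonneg)
  finally show "\<bar>H_inner L (fst X) k\<bar> \<le> 1 * (sqrt (state_inner L X X) * sqrt (H_inner L k k))" by simp
qed (auto simp: state_space_iff V_space_iff H_space_iff H1_D H.diff_left H.diff_right H.scaleR_left H.scaleR_right)

lemma V_subset_H: "V_space L \<subseteq> H_space L"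
  by (auto simp: V_space_iff H_space_iff H1_D)

lemma H_norm_le_state_norm:
  assumes "X \<in> state_space L"
  shows "H_norm L (fst X) \<le> state_norm L X" "H_norm L (snd X) \<le> state_norm L X"
  using inner_le_state_inner(2,3)[OF assms] by (simp_all add: H_norm_eq state_norm_eq)

text \<open>The mean value inequality in \<open>H_space\<close>, by duality: the position is paired
  with the error vector itself, which gives a real absolutely continuous function with derivative
  bounded by Cauchy-Schwarz. The vector \<open>h\<close> is a reference velocity.\<close>

lemma strong_increment:
  assumes X: "strong_solution L g F X" and ab: "0 \<le> a" "a \<le> b" and h: "h \<in> H_space L"
    and M: "\<And>r. a \<le> r \<Longrightarrow> r \<le> b \<Longrightarrow> H_norm L (snd (X r) - h) \<le> M"
  shows "H_norm L (fst (X b) - fst (X a) - (b - a) *\<^sub>R h) \<le> M * (b - a)"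
proof -
  note D = strong_solutionD[OF X]
  interpret B: bilinear_on "state_space L" "state_norm L" "H_space L" "H_norm L"
    "\<lambda>X k. H_inner L (fst X) k" 1 by (rule position_bilinear)
  have Vf: "fst (X s) \<in> H_space L" "snd (X s) \<in> H_space L" if "s \<ge> 0" for s
    using D(1)[OF that] V_subset_H by (auto simp: state_space_iff)
  \<comment> \<open>The vector to be estimated, used as its own test vector; it stays fixed while
    time varies.\<close>
  define k where "k = fst (X b) - fst (X a) - (b - a) *\<^sub>R h"
  have k: "k \<in> H_space L" unfolding k_def using ab h Vf by (intro H.closed) auto
  have "b \<ge> 0" using ab by simp
  have M0: "0 \<le> M" using M[of a] B.B.nonneg[of "snd (X a) - h"] ab h Vf[of a] by (simp add: H.closed)
  have H0: "H_norm L 0 = 0" using B.B.scale[of 0 0] by (simp add: H.closed)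
  have ac: "loc_abs_cont abs (\<lambda>t. H_inner L (fst (X t)) k)"
    using D k H0 by (intro B.loc_abs_cont loc_abs_cont_const) auto
  have "H_inner L (fst (X b)) k - H_inner L (fst (X a)) k \<le> (M * H_norm L k + H_inner L h k) * (b - a)"
  proof (rule loc_abs_cont_growth_le[OF ac ab])
    show "AE t in lebesgue. a \<le> t \<and> t \<le> b \<longrightarrow> (\<exists>D\<le>M * H_norm L k + H_inner L h k.
        has_time_deriv abs (\<lambda>t. H_inner L (fst (X t)) k) D t)"
      using D(3)
    proof (elim eventually_mono, intro impI)
      fix t assume t: "a \<le> t \<and> t \<le> b" and "t \<ge> 0 \<longrightarrow> X t \<in> dom_A L g \<and>
        (\<exists>X' \<in> state_space L. has_time_deriv (state_norm L) X X' t \<and> X' + op_A L (X t) = op_F F (X t))"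
      then obtain X' where X': "X' \<in> state_space L"
        "has_time_deriv (state_norm L) X X' t" "X' + op_A L (X t) = op_F F (X t)"
        using ab by auto
      have "t \<ge> 0" using t ab by simp
      have "X' = op_F F (X t) - op_A L (X t)" using X'(3) by (simp add: eq_diff_eq)
      then have f: "fst X' = snd (X t)"
        by (auto simp: op_F_def op_A_def zero_prod_def prod_eq_iff split: prod.splits)
      have "has_time_deriv (H_norm L) (\<lambda>_. k) 0 t"
        by (simp add: has_time_deriv_def H0)
      from B.has_time_deriv[OF D(2,1) _ k \<open>t \<ge> 0\<close> X'(2,1) this] loc_abs_cont_const[of "H_norm L" k, OF H0]
      have "has_time_deriv abs (\<lambda>t. H_inner L (fst (X t)) k)
          (H_inner L (snd (X t)) k + H_inner L (fst (X t)) 0) t"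
        by (simp add: f H.closed)
      moreover have "H_inner L (fst (X t)) 0 = 0"
        using H.scaleR_right[of 0 "fst (X t)" 0] Vf[OF \<open>t \<ge> 0\<close>] by (simp add: H.closed)
      moreover have "H_inner L (snd (X t)) k \<le> M * H_norm L k + H_inner L h k"
      proof -
        have "H_inner L (snd (X t)) k = H_inner L (snd (X t) - h) k + H_inner L h k"
          using H.diff_left[of "snd (X t)" h k] Vf[OF \<open>t \<ge> 0\<close>] h k by simp
        also have "H_inner L (snd (X t) - h) k \<le> H_norm L (snd (X t) - h) * H_norm L k"
          using H.Cauchy_Schwarz[of "snd (X t) - h" k] Vf[OF \<open>t \<ge> 0\<close>] h k
          by (simp add: H.closed H_norm_eq abs_le_iff)
        also have "\<dots> \<le> M * H_norm L k"
          using M t B.B.nonneg[OF k] by (intro mult_right_mono) auto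
        finally show ?thesis by simp
      qed
      ultimately show "\<exists>D\<le>M * H_norm L k + H_inner L h k.
        has_time_deriv abs (\<lambda>t. H_inner L (fst (X t)) k) D t" by auto
    qed
  qed
  moreover have "H_inner L k k = H_inner L (fst (X b)) k - H_inner L (fst (X a)) k - (b - a) * H_inner L h k"
    using Vf(1)[OF \<open>b \<ge> 0\<close>] Vf(1)[OF \<open>0 \<le> a\<close>] h k
    by (subst k_def) (simp add: H.diff_left H.scaleR_left H.closed)
  ultimately have "H_inner L k k \<le> (M * (b - a)) * H_norm L k"
    by (simp add: algebra_simps)
  then have "H_norm L k * H_norm L k \<le> (M * (b - a)) * H_norm L k"
    using H.self_nonneg[OF k] by (simp add: H_norm_eq)
  \<comment> \<open>Cancel one factor \<open>H_norm L k\<close>; if it is zero, \<open>M0\<close>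
    gives the claim.\<close>
  then have "H_norm L k \<le> M * (b - a)"
    using B.B.nonneg[OF k] M0 ab by (cases "H_norm L k = 0") auto
  then show ?thesis by (simp add: k_def)
qed

end

section \<open>Weak solutions\<close>

lemma at_within_atLeast_neq_bot:
  assumes "(0::real) \<le> t"
  shows "at t within {0..} \<noteq> bot"
proof
  assume "at t within {0..} = bot"
  moreover have "at_right t \<le> at t within {0..}" using assms by (intro at_le) auto
  ultimately have "at_right t = bot" by (simp add: bot_unique)
  then show False using trivial_limit_at_right_real[of t] by (simp add: trivial_limit_def)
qed

context seminorm_on
begin

text \<open>The difference quotients approach both candidates. Only the seminorm of the difference
  is determined, which is enough for the energy.\<close>

lemma has_time_deriv_unique:
  assumes X: "\<And>s. s \<ge> 0 \<Longrightarrow> X s \<in> S" and "Y \<in> S" "Z \<in> S" "0 \<le> t"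
    and "has_time_deriv N X Y t" "has_time_deriv N X Z t"
  shows "N (Y - Z) = 0"
proof -
  define q where "q s = (X s - X t) /\<^sub>R (s - t)" for s
  have "((\<lambda>s. N (q s - Y) + N (q s - Z)) \<longlongrightarrow> 0 + 0) (at t within {0..})"
    using assms(5,6) unfolding has_time_deriv_def q_def by (intro tendsto_add)
  moreover have "\<forall>\<^sub>F s in at t within {0..}. N (Y - Z) \<le> N (q s - Y) + N (q s - Z)"
    unfolding eventually_at_filter
  proof (intro always_eventually allI impI)
    fix s :: real assume "s \<in> {0..}"
    then have "q s \<in> S" using X[of s] X[of t] \<open>0 \<le> t\<close> by (auto simp: q_def intro!: closed)
    then show "N (Y - Z) \<le> N (q s - Y) + N (q s - Z)"
      using triangle_diff[of Y "q s" Z] diff_commute[of Y "q s"] assms by simp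
  qed
  ultimately have "N (Y - Z) \<le> 0 + 0"
    using at_within_atLeast_neq_bot[OF \<open>0 \<le> t\<close>] by (intro tendsto_lowerbound)
  then show ?thesis using nonneg[of "Y - Z"] assms by (simp add: closed)
qed

end

context interval
begin

lemma strong_approx_tendsto:
  fixes X :: "real \<Rightarrow> state"
  assumes "\<And>t. t \<ge> 0 \<Longrightarrow> X t \<in> state_space L"
    and "\<And>T \<epsilon>. T > 0 \<Longrightarrow> \<epsilon> > 0 \<Longrightarrow> \<forall>\<^sub>F n in sequentially. \<forall>t\<in>{0..T}. state_norm L (Xn n t - X t) < \<epsilon>"
    and "\<And>n t. t \<ge> 0 \<Longrightarrow> Xn n t \<in> state_space L" and "0 \<le> t"
  shows "(\<lambda>n. state_norm L (Xn n t - X t)) \<longlonglongrightarrow> 0"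
proof (rule tendstoI)
  fix e :: real assume "e > 0"
  \<comment> \<open>The horizon \<open>t + 1\<close> is positive even for
    \<open>t = 0\<close>.\<close>
  have "\<forall>\<^sub>F n in sequentially. \<forall>s\<in>{0..t + 1}. state_norm L (Xn n s - X s) < e"
    using assms(2)[of "t + 1" e] \<open>0 \<le> t\<close> \<open>e > 0\<close> by simp
  then show "\<forall>\<^sub>F n in sequentially. dist (state_norm L (Xn n t - X t)) 0 < e"
  proof (elim eventually_mono)
    fix n assume "\<forall>s\<in>{0..t + 1}. state_norm L (Xn n s - X s) < e"
    then have "state_norm L (Xn n t - X t) < e" using \<open>0 \<le> t\<close> by simp
    moreover have "0 \<le> state_norm L (Xn n t - X t)"
      unfolding state_norm_eq using assms \<open>0 \<le> t\<close> by (intro St.nonneg St.closed) auto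
    ultimately show "dist (state_norm L (Xn n t - X t)) 0 < e" by simp
  qed
qed

text \<open>The square root of the energy form is 1-Lipschitz for the state norm; squaring then
  gives the claim.\<close>

lemma energy_inner_tendsto:
  assumes "X \<in> state_space L" "\<And>n. Xn n \<in> state_space L"
    and lim: "(\<lambda>n. state_norm L (Xn n - X)) \<longlonglongrightarrow> 0"
  shows "(\<lambda>n. energy_inner L (Xn n) (Xn n)) \<longlonglongrightarrow> energy_inner L X X"
proof -
  have "(\<lambda>n. sqrt (energy_inner L (Xn n) (Xn n)) - sqrt (energy_inner L X X)) \<longlonglongrightarrow> 0"
  proof (rule Lim_null_comparison[OF always_eventually lim], intro allI)
    fix n
    have S: "Xn n - X \<in> state_space L" using assms by (intro St.closed) auto
    have "norm (sqrt (energy_inner L (Xn n) (Xn n)) - sqrt (energy_inner L X X))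
        \<le> sqrt (energy_inner L (Xn n - X) (Xn n - X))"
      using En.abs_diff_le[OF assms(2)[of n] assms(1)] by simp
    also have "\<dots> \<le> state_norm L (Xn n - X)"
      using inner_le_state_inner(1)[OF S] by (simp add: state_norm_eq)
    finally show "norm (sqrt (energy_inner L (Xn n) (Xn n)) - sqrt (energy_inner L X X))
        \<le> state_norm L (Xn n - X)" .
  qed
  then have "(\<lambda>n. sqrt (energy_inner L (Xn n) (Xn n))) \<longlonglongrightarrow> sqrt (energy_inner L X X)"
    by (rule LIM_zero_cancel)
  then have "(\<lambda>n. (sqrt (energy_inner L (Xn n) (Xn n)))\<^sup>2) \<longlonglongrightarrow> (sqrt (energy_inner L X X))\<^sup>2"
    by (rule tendsto_power)
  moreover have "(sqrt (energy_inner L Y Y))\<^sup>2 = energy_inner L Y Y" if "Y \<in> state_space L" for Y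
    using En.self_nonneg[OF that] by simp
  ultimately show ?thesis using assms(1,2) by (simp only:)
qed

text \<open>A weak solution is given only as a limit, so its derivative is read off from the
  approximants. Their velocities near \<open>t\<close> oscillate little, uniformly in the index,
  hence \<open>strong_increment\<close> gives a first-order expansion at \<open>t\<close> with
  uniform error, and this passes to the limit at each fixed \<open>s\<close>.\<close>

lemma weak_solution_time_deriv:
  assumes wX: "weak_solution_state L g F X" and "0 \<le> t"
  shows "has_time_deriv (H_norm L) (\<lambda>s. fst (X s)) (snd (X t)) t"
  unfolding has_time_deriv_def
proof (rule tendstoI)
  obtain Xn where S: "\<And>t. t \<ge> 0 \<Longrightarrow> X t \<in> state_space L"
    and strong: "\<And>n. strong_solution L g F (Xn n)"
    and unif: "\<And>T \<epsilon>. T > 0 \<Longrightarrow> \<epsilon> > 0 \<Longrightarrow> \<forall>\<^sub>F n in sequentially. \<forall>t\<in>{0..T}. state_norm L (Xn n t - X t) < \<epsilon>"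
    using wX unfolding weak_solution_state_def by blast
  have Sn: "Xn n s \<in> state_space L" if "s \<ge> 0" for n s
    using strong_solutionD(1)[OF strong that] .
  interpret N: seminorm_on "state_space L" "state_norm L"
    unfolding state_norm_eq by (rule St.seminorm_on_axioms)
  interpret HN: seminorm_on "H_space L" "H_norm L"
    unfolding H_norm_eq by (rule H.seminorm_on_axioms)
  fix e :: real assume "e > 0"
  \<comment> \<open>Five errors of size \<eta> will occur, and \<open>5 * \<eta>\<close> must stay
    strictly below \<open>e\<close>.\<close>
  define \<eta> where "\<eta> = e / 10"
  have "\<eta> > 0" using \<open>e > 0\<close> by (simp add: \<eta>_def)
  define T where "T = t + 1"
  have "T > 0" using \<open>0 \<le> t\<close> by (simp add: T_def)
  obtain m where m: "\<And>n s. n \<ge> m \<Longrightarrow> s \<in> {0..T} \<Longrightarrow> state_norm L (Xn n s - X s) < \<eta>"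
    using unif[OF \<open>T > 0\<close> \<open>\<eta> > 0\<close>] unfolding eventually_sequentially by blast
  obtain \<delta> where \<delta>: "\<delta> > 0"
    "\<And>s r. \<lbrakk>0 \<le> s; s \<le> T; 0 \<le> r; r \<le> T; \<bar>s - r\<bar> < \<delta>\<rbrakk> \<Longrightarrow> state_norm L (Xn m s - Xn m r) < \<eta>"
    using loc_abs_cont_delta[OF strong_solutionD(2)[OF strong[of m]] \<open>T > 0\<close> \<open>\<eta> > 0\<close>]
      N.diff_commute[OF Sn Sn] by metis
  \<comment> \<open>A single approximant \<open>m\<close> supplies the modulus of continuity. The
    other four errors are the distances of approximants \<open>n\<close> and \<open>m\<close> to the
    limit at \<open>r\<close> and at \<open>t\<close>.\<close>
  have vel: "H_norm L (snd (Xn n r) - snd (Xn n t)) \<le> 5 * \<eta>"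
    if n: "n \<ge> m" and r: "0 \<le> r" "r \<le> T" "\<bar>r - t\<bar> < \<delta>" for n r
  proof -
    have t: "t \<in> {0..T}" using \<open>0 \<le> t\<close> by (simp add: T_def)
    have "H_norm L (snd (Xn n r) - snd (Xn n t)) \<le> state_norm L (Xn n r - Xn n t)"
      using H_norm_le_state_norm(2)[of "Xn n r - Xn n t"] Sn[OF r(1)] Sn[OF \<open>0 \<le> t\<close>] by (simp add: N.closed)
    also have "\<dots> \<le> state_norm L (Xn n r - X r) + state_norm L (X r - Xn n t)"
      using S Sn r \<open>0 \<le> t\<close> by (intro N.triangle_diff) auto
    also have "state_norm L (X r - Xn n t) \<le> state_norm L (X r - Xn m r) + state_norm L (Xn m r - Xn n t)"
      using S Sn r \<open>0 \<le> t\<close> by (intro N.triangle_diff) auto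
    also have "state_norm L (Xn m r - Xn n t) \<le> state_norm L (Xn m r - Xn m t) + state_norm L (Xn m t - Xn n t)"
      using S Sn r \<open>0 \<le> t\<close> by (intro N.triangle_diff) auto
    also have "state_norm L (Xn m t - Xn n t) \<le> state_norm L (Xn m t - X t) + state_norm L (X t - Xn n t)"
      using S Sn r \<open>0 \<le> t\<close> by (intro N.triangle_diff) auto
    finally show ?thesis
      using m[OF n, of r] m[OF order_refl, of r] m[OF n t] m[OF order_refl t] \<delta>(2)[of r t] r t
        N.diff_commute[OF S[OF r(1)] Sn[OF r(1), of m]] N.diff_commute[OF S[OF \<open>0 \<le> t\<close>] Sn[OF \<open>0 \<le> t\<close>, of n]]
      by simp
  qed
  have Hf: "fst Y \<in> H_space L" "snd Y \<in> H_space L" if "Y \<in> state_space L" for Y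
    using that V_subset_H by (auto simp: state_space_iff)
  have incr: "H_norm L (fst (Xn n s) - fst (Xn n t) - (s - t) *\<^sub>R snd (Xn n t)) \<le> 5 * \<eta> * \<bar>s - t\<bar>"
    if n: "n \<ge> m" and s: "0 \<le> s" "s \<le> T" "\<bar>s - t\<bar> < \<delta>" for n s
  proof (cases "t \<le> s")
    case True
    have "H_norm L (fst (Xn n s) - fst (Xn n t) - (s - t) *\<^sub>R snd (Xn n t)) \<le> 5 * \<eta> * (s - t)"
      using True s \<open>0 \<le> t\<close> Hf Sn by (intro strong_increment[OF strong] vel[OF n]) auto
    then show ?thesis using True by simp
  next
    case False
    \<comment> \<open>\<open>strong_increment\<close> runs forward in time: for \<open>s < t\<close>
      the endpoints are exchanged, while the reference velocity remains that at
      \<open>t\<close>.\<close>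
    have "H_norm L (fst (Xn n t) - fst (Xn n s) - (t - s) *\<^sub>R snd (Xn n t)) \<le> 5 * \<eta> * (t - s)"
      using False s \<open>0 \<le> t\<close> Hf Sn by (intro strong_increment[OF strong] vel[OF n]) (auto simp: T_def)
    moreover have eq: "fst (Xn n s) - fst (Xn n t) - (s - t) *\<^sub>R snd (Xn n t)
       = - (fst (Xn n t) - fst (Xn n s) - (t - s) *\<^sub>R snd (Xn n t))"
      by (simp add: algebra_simps)
    moreover have mem: "fst (Xn n t) - fst (Xn n s) - (t - s) *\<^sub>R snd (Xn n t) \<in> H_space L"
      using s \<open>0 \<le> t\<close> Hf Sn by (intro HN.closed) auto
    ultimately show ?thesis using False unfolding eq HN.minus[OF mem] by simp
  qed
  \<comment> \<open>Replacing the approximant by the limit costs its error at \<open>s\<close>, at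
    \<open>t\<close>, and \<open>\<bar>s - t\<bar>\<close> times the latter; all tend to 0 because
    \<open>s\<close> is fixed.\<close>
  have incr_lim: "H_norm L (fst (X s) - fst (X t) - (s - t) *\<^sub>R snd (X t)) \<le> 5 * \<eta> * \<bar>s - t\<bar>"
    if s: "0 \<le> s" "s \<le> T" "\<bar>s - t\<bar> < \<delta>" for s
  proof (rule LIMSEQ_le_const)
    let ?y = "\<lambda>Y Z. fst Y - fst Z - (s - t) *\<^sub>R snd Z"
    have lim: "(\<lambda>n. state_norm L (Xn n r - X r)) \<longlonglongrightarrow> 0" if "0 \<le> r" for r
      by (rule strong_approx_tendsto) (use S unif Sn that in auto)
    show "(\<lambda>n. 5 * \<eta> * \<bar>s - t\<bar> + state_norm L (Xn n s - X s) + state_norm L (Xn n t - X t)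
        + \<bar>s - t\<bar> * state_norm L (Xn n t - X t)) \<longlonglongrightarrow> 5 * \<eta> * \<bar>s - t\<bar>"
      using lim[OF s(1)] lim[OF \<open>0 \<le> t\<close>] by (auto intro!: tendsto_eq_intros)
    show "\<exists>k. \<forall>n\<ge>k. H_norm L (?y (X s) (X t)) \<le> 5 * \<eta> * \<bar>s - t\<bar> + state_norm L (Xn n s - X s)
        + state_norm L (Xn n t - X t) + \<bar>s - t\<bar> * state_norm L (Xn n t - X t)"
    proof (intro exI allI impI)
      fix n assume n: "n \<ge> m"
      define A where "A = fst (Xn n s - X s)"
      define B where "B = fst (Xn n t - X t)"
      define V where "V = snd (Xn n t - X t)"
      have St': "Xn n s - X s \<in> state_space L" "Xn n t - X t \<in> state_space L"
        using S Sn s \<open>0 \<le> t\<close> by (auto intro!: N.closed)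
      have H: "A \<in> H_space L" "B \<in> H_space L" "V \<in> H_space L"
        unfolding A_def B_def V_def using St' Hf by blast+
      have nA: "H_norm L A \<le> state_norm L (Xn n s - X s)" "H_norm L B \<le> state_norm L (Xn n t - X t)"
        "H_norm L V \<le> state_norm L (Xn n t - X t)"
        unfolding A_def B_def V_def using St' H_norm_le_state_norm by blast+
      have Y: "?y (Xn n s) (Xn n t) \<in> H_space L"
        using S Sn s \<open>0 \<le> t\<close> Hf by (intro HN.closed) auto
      have eq: "?y (X s) (X t) = ?y (Xn n s) (Xn n t) - (A - B - (s - t) *\<^sub>R V)"
        by (simp add: A_def B_def V_def algebra_simps)
      have "H_norm L (?y (X s) (X t)) \<le> H_norm L (?y (Xn n s) (Xn n t)) + H_norm L (A - B - (s - t) *\<^sub>R V)"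
        unfolding eq using HN.triangle[of "?y (Xn n s) (Xn n t)" "- (A - B - (s - t) *\<^sub>R V)"]
          HN.minus[of "A - B - (s - t) *\<^sub>R V"] Y H
        by (simp add: HN.closed subspace_neg[OF HN.subspace] del: minus_diff_eq)
      also have "H_norm L (A - B - (s - t) *\<^sub>R V) \<le> H_norm L (A - B) + H_norm L ((s - t) *\<^sub>R V)"
        using HN.triangle[of "A - B" "- ((s - t) *\<^sub>R V)"] HN.minus[of "(s - t) *\<^sub>R V"] H
        by (simp add: HN.closed subspace_neg[OF HN.subspace])
      also have "H_norm L (A - B) \<le> H_norm L A + H_norm L B"
        using HN.triangle[of A "- B"] HN.minus[of B] H by (simp add: subspace_neg[OF HN.subspace])
      also have "H_norm L ((s - t) *\<^sub>R V) \<le> \<bar>s - t\<bar> * state_norm L (Xn n t - X t)"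
        using HN.scale[OF H(3)] nA(3) by (simp add: mult_left_mono)
      finally show "H_norm L (?y (X s) (X t)) \<le> 5 * \<eta> * \<bar>s - t\<bar> + state_norm L (Xn n s - X s)
        + state_norm L (Xn n t - X t) + \<bar>s - t\<bar> * state_norm L (Xn n t - X t)"
        using incr[OF n s] nA(1,2) by linarith
    qed
  qed
  show "\<forall>\<^sub>F s in at t within {0..}. dist (H_norm L ((fst (X s) - fst (X t)) /\<^sub>R (s - t) - snd (X t))) 0 < e"
    unfolding eventually_at
  proof (intro exI[of _ "min \<delta> 1"] conjI ballI impI)
    fix s assume "s \<in> {0..}" and d: "s \<noteq> t \<and> dist s t < min \<delta> 1"
    then have s: "0 \<le> s" "s \<le> T" "\<bar>s - t\<bar> < \<delta>" "s \<noteq> t" by (auto simp: dist_real_def T_def)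
    let ?Y = "fst (X s) - fst (X t) - (s - t) *\<^sub>R snd (X t)"
    have Y: "?Y \<in> H_space L" using S s \<open>0 \<le> t\<close> Hf by (intro HN.closed) auto
    have "(fst (X s) - fst (X t)) /\<^sub>R (s - t) - snd (X t) = inverse (s - t) *\<^sub>R ?Y"
      using s by (simp add: scaleR_diff_right)
    then have "H_norm L ((fst (X s) - fst (X t)) /\<^sub>R (s - t) - snd (X t)) = \<bar>inverse (s - t)\<bar> * H_norm L ?Y"
      using HN.scale[OF Y] by simp
    also have "\<dots> \<le> \<bar>inverse (s - t)\<bar> * (5 * \<eta> * \<bar>s - t\<bar>)"
      using incr_lim[OF s(1-3)] by (intro mult_left_mono) auto
    also have "\<dots> = 5 * \<eta>" using s by (simp add: abs_inverse)
    also have "\<dots> < e" using \<open>e > 0\<close> by (simp add: \<eta>_def)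
    finally have "H_norm L ((fst (X s) - fst (X t)) /\<^sub>R (s - t) - snd (X t)) < e" .
    moreover have "0 \<le> H_norm L ((fst (X s) - fst (X t)) /\<^sub>R (s - t) - snd (X t))"
      using S s \<open>0 \<le> t\<close> Hf by (intro HN.nonneg HN.closed) auto
    ultimately show "dist (H_norm L ((fst (X s) - fst (X t)) /\<^sub>R (s - t) - snd (X t))) 0 < e" by simp
  qed (use \<delta> in auto)
qed

text \<open>\<open>Dt\<close> is chosen among all time derivatives, and the velocity component is
  one of them; two such differ by a vector of zero \<open>H_norm\<close>, so they give the same
  energy.\<close>

lemma solution_energy_eq:
  assumes wX: "weak_solution_state L g F (\<lambda>t. (u t, v t))" and "0 \<le> t"
  shows "solution_energy L u t = energy_inner L (u t, v t) (u t, v t) / 2"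
proof -
  interpret HN: seminorm_on "H_space L" "H_norm L"
    unfolding H_norm_eq by (rule H.seminorm_on_axioms)
  have S: "(u s, v s) \<in> state_space L" if "s \<ge> 0" for s
    using wX that by (auto simp: weak_solution_state_def)
  have uv: "u s \<in> H_space L" "v s \<in> H_space L" if "s \<ge> 0" for s
    using S[OF that] V_subset_H by (auto simp: state_space_iff)
  have v: "v t \<in> H_space L \<and> has_time_deriv (H_norm L) u (v t) t"
    using weak_solution_time_deriv[OF wX \<open>0 \<le> t\<close>] uv \<open>0 \<le> t\<close> by simp
  have D: "Dt L u t \<in> H_space L \<and> has_time_deriv (H_norm L) u (Dt L u t) t"
    unfolding Dt_def by (rule someI[of _ "v t"]) (rule v)
  have "H_norm L (Dt L u t - v t) = 0"
    using D v uv \<open>0 \<le> t\<close> by (intro HN.has_time_deriv_unique[of u]) auto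
  then have "H_norm L (Dt L u t) = H_norm L (v t)"
    using HN.abs_diff_le[of "Dt L u t" "v t"] D v by simp
  then have "solution_energy L u t = energy L (u t) (v t)"
    by (simp add: solution_energy_def energy_def)
  then show ?thesis using energy_eq[OF S[OF \<open>0 \<le> t\<close>]] by simp
qed

lemma weak_energy_bounds:
  assumes "weak_solution L g F u" "0 \<le> t" and \<epsilon>: "0 < \<epsilon>" "\<epsilon> * (L + 1) \<le> 1 / 2"
    and F: "\<And>s. s * F s \<le> 0" and g: "\<And>s. 0 \<le> s * g s"
    and K: "\<And>s. \<epsilon> / 2 * ((L + 1) * (s\<^sup>2 + (g s)\<^sup>2)) \<le> s * g s + \<epsilon> * K" and "0 \<le> K"
  shows "solution_energy L u t \<le> solution_energy L u 0"
    "solution_energy L u t \<le> 3 * exp (- (2 * \<epsilon> / 3) * t) * solution_energy L u 0 + 3 * K"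
    "0 \<le> solution_energy L u t"
proof -
  obtain v where wX: "weak_solution_state L g F (\<lambda>t. (u t, v t))"
    using assms(1) by (auto simp: weak_solution_def)
  obtain Xn where S: "\<And>t. t \<ge> 0 \<Longrightarrow> (u t, v t) \<in> state_space L"
    and strong: "\<And>n. strong_solution L g F (Xn n)"
    and unif: "\<And>T \<epsilon>. T > 0 \<Longrightarrow> \<epsilon> > 0 \<Longrightarrow> \<forall>\<^sub>F n in sequentially. \<forall>t\<in>{0..T}. state_norm L (Xn n t - (u t, v t)) < \<epsilon>"
    using wX unfolding weak_solution_state_def by blast
  have Sn: "Xn n s \<in> state_space L" if "s \<ge> 0" for n s
    using strong_solutionD(1)[OF strong that] .
  have lim: "(\<lambda>n. energy_inner L (Xn n s) (Xn n s) / 2) \<longlonglongrightarrow> solution_energy L u s" if "s \<ge> 0" for s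
    unfolding solution_energy_eq[OF wX that]
  proof (intro tendsto_intros energy_inner_tendsto)
    show "(\<lambda>n. state_norm L (Xn n s - (u s, v s))) \<longlonglongrightarrow> 0"
      by (rule strong_approx_tendsto[of "\<lambda>t. (u t, v t)"]) (use S unif Sn that in auto)
  qed (use S Sn that in auto)
  note l0 = lim[OF order_refl] and lt = lim[OF \<open>0 \<le> t\<close>]
  show "solution_energy L u t \<le> solution_energy L u 0"
    using strong_energy_le_initial[OF strong F g \<open>0 \<le> t\<close>] by (intro LIMSEQ_le[OF lt l0]) auto
  have "(\<lambda>n. 3 * exp (- (2 * \<epsilon> / 3) * t) * (energy_inner L (Xn n 0) (Xn n 0) / 2) + 3 * K)
      \<longlonglongrightarrow> 3 * exp (- (2 * \<epsilon> / 3) * t) * solution_energy L u 0 + 3 * K"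
    using l0 by (intro tendsto_intros)
  then show "solution_energy L u t \<le> 3 * exp (- (2 * \<epsilon> / 3) * t) * solution_energy L u 0 + 3 * K"
    using strong_energy_decay[OF strong \<epsilon> F K \<open>0 \<le> K\<close> \<open>0 \<le> t\<close>] by (intro LIMSEQ_le[OF lt]) auto
  show "0 \<le> solution_energy L u t"
    using solution_energy_eq[OF wX \<open>0 \<le> t\<close>] En.self_nonneg[OF S[OF \<open>0 \<le> t\<close>]] by simp
qed

end

text \<open>The additive constant is absorbed by raising the threshold to \<open>6 K\<close>: once
  \<open>6 exp (- \<mu> t) \<le> 1\<close> the excess \<open>18 K exp (- \<mu> t)\<close> is at most \<open>3 K\<close>; for smaller \<open>t\<close>
  monotonicity suffices, at the price of the factor 6.\<close>

lemma pos_part_decay: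
  fixes E\<^sub>0 :: real
  assumes "0 \<le> K" "E \<le> E\<^sub>0" "E \<le> 3 * exp (- \<mu> * t) * E\<^sub>0 + 3 * K"
  shows "pos_part (E - 6 * K) \<le> 6 * exp (- \<mu> * t) * pos_part (E\<^sub>0 - 6 * K)"
proof (cases "E \<le> 6 * K")
  case True
  then show ?thesis by (simp add: pos_part_def)
next
  case False
  let ?q = "exp (- \<mu> * t)"
  have pos: "pos_part (E\<^sub>0 - 6 * K) = E\<^sub>0 - 6 * K" "pos_part (E - 6 * K) = E - 6 * K" "E\<^sub>0 - 6 * K \<ge> 0"
    using False assms by (auto simp: pos_part_def)
  have "E - 6 * K \<le> 6 * ?q * (E\<^sub>0 - 6 * K)"
  proof (cases "6 * ?q \<le> 1")
    case True
    then have "6 * ?q * K \<le> 1 * K" using assms(1) by (rule mult_right_mono)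
    moreover have "3 * ?q * E\<^sub>0 = 3 * ?q * (E\<^sub>0 - 6 * K) + 3 * (6 * ?q * K)" by (simp add: algebra_simps)
    moreover have "0 \<le> 3 * ?q * (E\<^sub>0 - 6 * K)" using pos(3) by simp
    moreover have "6 * ?q * (E\<^sub>0 - 6 * K) = 3 * ?q * (E\<^sub>0 - 6 * K) + 3 * ?q * (E\<^sub>0 - 6 * K)" by simp
    ultimately show ?thesis using assms(1,3) by linarith
  next
    case False
    then have "1 * (E\<^sub>0 - 6 * K) \<le> 6 * ?q * (E\<^sub>0 - 6 * K)"
      using pos(3) by (intro mult_right_mono) auto
    then show ?thesis using assms(2) by simp
  qed
  then show ?thesis using pos by simp
qed

section \<open>Damping at the boundary and the choice of constants\<close>

text \<open>For large \<open>s\<close> the lower growth bound controls \<open>s\<^sup>2\<close> and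
  the upper one \<open>(g s)\<^sup>2\<close>, each by a multiple of \<open>s * g s\<close>. For
  \<open>\<bar>s\<bar> < S\<close> monotonicity confines \<open>g s\<close> between
  \<open>g (- S)\<close> and \<open>g S\<close>, which yields the constant.\<close>

lemma boundary_dissipation:
  fixes g :: "real \<Rightarrow> real"
  assumes "mono g" "g 0 = 0" "0 < \<alpha>\<^sub>1" "\<alpha>\<^sub>1 \<le> \<alpha>\<^sub>2" "0 \<le> S" "growth_condition \<alpha>\<^sub>1 \<alpha>\<^sub>2 S g"
  obtains K where "0 \<le> K" "S = 0 \<Longrightarrow> K = 0"
    "\<And>s. s\<^sup>2 + (g s)\<^sup>2 \<le> (1 / \<alpha>\<^sub>1 + \<alpha>\<^sub>2) * (s * g s) + K"
proof
  define m where "m = max \<bar>g S\<bar> \<bar>g (- S)\<bar>"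
  show "0 \<le> S\<^sup>2 + m\<^sup>2" by simp
  show "S\<^sup>2 + m\<^sup>2 = 0" if "S = 0" using that assms(2) by (simp add: m_def)
  fix s :: real
  have gs: "0 \<le> s * g s"
    using monoD[OF assms(1), of 0 s] monoD[OF assms(1), of s 0] assms(2)
    by (cases "0 \<le> s") (auto simp: zero_le_mult_iff)
  show "s\<^sup>2 + (g s)\<^sup>2 \<le> (1 / \<alpha>\<^sub>1 + \<alpha>\<^sub>2) * (s * g s) + (S\<^sup>2 + m\<^sup>2)"
  proof (cases "\<bar>s\<bar> \<ge> S")
    case True
    then have b: "\<alpha>\<^sub>1 * \<bar>s\<bar> \<le> \<bar>g s\<bar>" "\<bar>g s\<bar> \<le> \<alpha>\<^sub>2 * \<bar>s\<bar>"
      using assms(6) by (auto simp: growth_condition_def)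
    have sg: "\<bar>s\<bar> * \<bar>g s\<bar> = s * g s" using gs by (simp flip: abs_mult)
    have "\<bar>s\<bar> * (\<alpha>\<^sub>1 * \<bar>s\<bar>) \<le> \<bar>s\<bar> * \<bar>g s\<bar>" using b(1) by (rule mult_left_mono) simp
    then have "\<alpha>\<^sub>1 * s\<^sup>2 \<le> s * g s" using sg by (simp add: power2_eq_square mult_ac)
    then have 1: "s\<^sup>2 \<le> 1 / \<alpha>\<^sub>1 * (s * g s)" using assms(3) by (simp add: field_simps)
    have "\<bar>g s\<bar> * \<bar>g s\<bar> \<le> \<bar>g s\<bar> * (\<alpha>\<^sub>2 * \<bar>s\<bar>)" using b(2) by (rule mult_left_mono) simp
    also have "\<dots> = \<alpha>\<^sub>2 * (s * g s)" by (simp flip: sg)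
    finally have 2: "(g s)\<^sup>2 \<le> \<alpha>\<^sub>2 * (s * g s)" by (simp add: power2_eq_square)
    have "s\<^sup>2 + (g s)\<^sup>2 \<le> 1 / \<alpha>\<^sub>1 * (s * g s) + \<alpha>\<^sub>2 * (s * g s)" using 1 2 by (rule add_mono)
    also have "\<dots> \<le> (1 / \<alpha>\<^sub>1 + \<alpha>\<^sub>2) * (s * g s) + (S\<^sup>2 + m\<^sup>2)" by (simp add: distrib_right)
    finally show ?thesis .
  next
    case False
    then have "g (- S) \<le> g s" "g s \<le> g S" by (auto intro: monoD[OF assms(1)])
    then have "\<bar>g s\<bar> \<le> m" by (auto simp: m_def)
    then have "(g s)\<^sup>2 \<le> m\<^sup>2" "s\<^sup>2 \<le> S\<^sup>2"
      using False by (simp_all add: abs_le_square_iff[symmetric])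
    moreover have "0 \<le> (1 / \<alpha>\<^sub>1 + \<alpha>\<^sub>2) * (s * g s)" by (intro mult_nonneg_nonneg gs) (use assms in auto)
    ultimately show ?thesis by linarith
  qed
qed

text \<open>Stated so that both halves of the theorem follow: the clause for \<open>S = 0\<close>
  and the nonnegativity of the energy serve the second half.\<close>

lemma energy_decay:
  fixes L \<alpha>\<^sub>1 \<alpha>\<^sub>2 S :: real
  assumes "L > 0" "mono g" "g 0 = 0" "F 0 = 0" "antimono F"
    and \<alpha>: "0 < \<alpha>\<^sub>1" "\<alpha>\<^sub>1 \<le> \<alpha>\<^sub>2" "0 \<le> S" "growth_condition \<alpha>\<^sub>1 \<alpha>\<^sub>2 S g"
  shows "\<exists>E\<^sub>S M \<mu>. 0 \<le> E\<^sub>S \<and> (S = 0 \<longrightarrow> E\<^sub>S = 0) \<and> 0 < M \<and> 0 < \<mu> \<and>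
    (\<forall>u. weak_solution L g F u \<longrightarrow> (\<forall>t\<ge>0. 0 \<le> solution_energy L u t \<and>
       pos_part (solution_energy L u t - E\<^sub>S)
         \<le> M * exp (- \<mu> * t) * pos_part (solution_energy L u 0 - E\<^sub>S)))"
proof -
  interpret interval L using assms(1) by unfold_locales
  obtain k where k: "0 \<le> k" "S = 0 \<Longrightarrow> k = 0" "\<And>s. s\<^sup>2 + (g s)\<^sup>2 \<le> (1 / \<alpha>\<^sub>1 + \<alpha>\<^sub>2) * (s * g s) + k"
    using boundary_dissipation[OF assms(2,3) \<alpha>] by metis
  \<comment> \<open>The constant \<open>k\<close> enters the boundary term with the factor
    \<open>\<epsilon> / 2 * (L + 1)\<close>, and this product is
    \<open>\<epsilon> * K\<close>.\<close>
  define K where "K = (L + 1) * k / 2"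
  define c where "c = 1 / \<alpha>\<^sub>1 + \<alpha>\<^sub>2"
  have "c > 0" using \<alpha> by (simp add: c_def add_pos_pos)
  \<comment> \<open>The first bound keeps the functional equivalent to the energy; the second makes
    the coefficient \<open>\<epsilon> / 2 * (L + 1) * c\<close> of \<open>s * g s\<close> at most
    1.\<close>
  define \<epsilon> where "\<epsilon> = min (1 / 2 / (L + 1)) (2 / (c * (L + 1)))"
  have L1: "L + 1 > 0" using assms(1) by simp
  have "\<epsilon> > 0" using L1 \<open>c > 0\<close> by (simp add: \<epsilon>_def)
  have "\<epsilon> * (L + 1) \<le> 1 / 2 / (L + 1) * (L + 1)" "\<epsilon> * (c * (L + 1)) \<le> 2 / (c * (L + 1)) * (c * (L + 1))"
    using L1 \<open>c > 0\<close> unfolding \<epsilon>_def by (intro mult_right_mono; simp)+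
  moreover have "a / x * x = a" if "x > 0" for a x :: real
    using that by simp
  note this[OF L1] this[OF mult_pos_pos[OF \<open>c > 0\<close> L1]]
  ultimately have \<epsilon>: "\<epsilon> * (L + 1) \<le> 1 / 2" "\<epsilon> * (c * (L + 1)) \<le> 2" by (simp_all only:)
  have "0 \<le> K" using k(1) L1 by (simp add: K_def)
  have K0: "S = 0 \<Longrightarrow> K = 0" using k(2) by (simp add: K_def)
  have F: "s * F s \<le> 0" for s
    using antimonoD[OF assms(5), of 0 s] antimonoD[OF assms(5), of s 0] assms(4)
    by (cases "0 \<le> s") (auto simp: mult_le_0_iff)
  have g: "0 \<le> s * g s" for s
    using monoD[OF assms(2), of 0 s] monoD[OF assms(2), of s 0] assms(3)
    by (cases "0 \<le> s") (auto simp: zero_le_mult_iff)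
  have bound: "\<epsilon> / 2 * ((L + 1) * (s\<^sup>2 + (g s)\<^sup>2)) \<le> s * g s + \<epsilon> * K" for s
  proof -
    have "\<epsilon> / 2 * ((L + 1) * (s\<^sup>2 + (g s)\<^sup>2)) \<le> \<epsilon> / 2 * ((L + 1) * (c * (s * g s) + k))"
      using k(3)[of s] L1 \<open>\<epsilon> > 0\<close> by (intro mult_left_mono) (auto simp: c_def)
    also have "\<dots> = (\<epsilon> * (c * (L + 1))) * (s * g s) / 2 + \<epsilon> * K"
      by (simp add: K_def algebra_simps add_divide_distrib)
    also have "\<dots> \<le> 2 * (s * g s) / 2 + \<epsilon> * K"
      using mult_right_mono[OF \<epsilon>(2) g[of s]] by simp
    finally show ?thesis by simp
  qed
  \<comment> \<open>The threshold \<open>6 * K\<close> and the factor 6 come from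
    \<open>pos_part_decay\<close>, the rate from \<open>strong_energy_decay\<close>.\<close>
  show ?thesis
  proof (rule exI[of _ "6 * K"], rule exI[of _ 6], rule exI[of _ "2 * \<epsilon> / 3"], intro conjI allI impI)
    fix u and t :: real assume "weak_solution L g F u" "0 \<le> t"
    note W = weak_energy_bounds[OF this \<open>\<epsilon> > 0\<close> \<epsilon>(1) F g bound \<open>0 \<le> K\<close>]
    show "0 \<le> solution_energy L u t" by (rule W(3))
    show "pos_part (solution_energy L u t - 6 * K)
        \<le> 6 * exp (- (2 * \<epsilon> / 3) * t) * pos_part (solution_energy L u 0 - 6 * K)"
      using W(1,2) \<open>0 \<le> K\<close> by (intro pos_part_decay)
  qed (use \<open>0 \<le> K\<close> \<open>\<epsilon> > 0\<close> K0 in auto)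
qed

theorem theorem2:
  fixes L \<alpha>\<^sub>1 \<alpha>\<^sub>2 S :: real and g F :: "real \<Rightarrow> real"
  assumes "L > 0"
    and "continuous_on UNIV g" and "mono g" and "g 0 = 0"
    and "\<exists>K. K-lipschitz_on UNIV F" and "F 0 = 0" and "antimono F"
    and "0 < \<alpha>\<^sub>1" and "\<alpha>\<^sub>1 \<le> \<alpha>\<^sub>2" and "0 \<le> S"
    and "growth_condition \<alpha>\<^sub>1 \<alpha>\<^sub>2 S g"
  shows "(\<exists>E\<^sub>S\<ge>0. \<exists>M>0. \<exists>\<mu>>0. \<forall>u. weak_solution L g F u \<longrightarrow>
            (\<forall>t\<ge>0. pos_part (solution_energy L u t - E\<^sub>S)
                     \<le> M * exp (- \<mu> * t) * pos_part (solution_energy L u 0 - E\<^sub>S)))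
       \<and> (growth_condition \<alpha>\<^sub>1 \<alpha>\<^sub>2 0 g \<longrightarrow>
            (\<exists>M>0. \<exists>\<mu>>0. \<forall>u. weak_solution L g F u \<longrightarrow>
               (\<forall>t\<ge>0. solution_energy L u t \<le> M * exp (- \<mu> * t) * solution_energy L u 0)))"
proof (intro conjI impI)
  show "\<exists>E\<^sub>S\<ge>0. \<exists>M>0. \<exists>\<mu>>0. \<forall>u. weak_solution L g F u \<longrightarrow>
            (\<forall>t\<ge>0. pos_part (solution_energy L u t - E\<^sub>S)
                     \<le> M * exp (- \<mu> * t) * pos_part (solution_energy L u 0 - E\<^sub>S))"
    using energy_decay[OF assms(1,3,4,6-11)] by blast
next
  assume "growth_condition \<alpha>\<^sub>1 \<alpha>\<^sub>2 0 g"
  \<comment> \<open>Applied with threshold 0 in place of \<open>S\<close>, which forces the energy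
    threshold to be 0.\<close>
  then obtain E\<^sub>S M \<mu> where M: "E\<^sub>S = 0" "0 < M" "0 < \<mu>"
    and decay: "\<And>u t. weak_solution L g F u \<Longrightarrow> 0 \<le> t \<Longrightarrow> 0 \<le> solution_energy L u t \<and>
       pos_part (solution_energy L u t - E\<^sub>S)
         \<le> M * exp (- \<mu> * t) * pos_part (solution_energy L u 0 - E\<^sub>S)"
    using energy_decay[OF assms(1,3,4,6-9) order_refl] by blast
  \<comment> \<open>Nonnegative energies equal their positive parts, at time \<open>t\<close> and at
    time 0.\<close>
  have "solution_energy L u t \<le> M * exp (- \<mu> * t) * solution_energy L u 0"
    if "weak_solution L g F u" "0 \<le> t" for u t
    using decay[OF that] decay[OF that(1) order_refl] by (simp add: M(1) pos_part_def)
  then show "\<exists>M>0. \<exists>\<mu>>0. \<forall>u. weak_solution L g F u \<longrightarrow>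
               (\<forall>t\<ge>0. solution_energy L u t \<le> M * exp (- \<mu> * t) * solution_energy L u 0)"
    using M(2,3) by blast
qed

end
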